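(* Let $N\ge 2$ and let $J_1,\dots,J_N$ be independent subordinators with means $\rho_i=\mathrm{E}J_i(1)$, $\rho_N>0$, $\rho=\sum_{i=1}^N\rho_i<1$, and Laplace exponents $\eta_i(\alpha)=-\log\mathrm{E}e^{-\alpha J_i(1)}$. Consider the $N$-class accumulating priority queue with unit service rate, class $i$ input $J_i$, and accumulating priority rates $b_1>b_2>\cdots>b_N>0$ (class $N$ is the lowest priority class). Put $a_i=1-b_N/b_i$ for $i=1,\dots,N-1$, $J_a(t)=\sum_{i=1}^{N-1}J_i(a_it)$, $$\varphi(\alpha)=\alpha-\sum_{i=1}^N\eta_i(\alpha),\qquad \varphi_a(\alpha)=\log\mathrm{E}e^{-\alpha(J_a(1)-1)}=\alpha-\sum_{i=1}^{N-1}a_i\,\eta_i(\alpha),$$ and let $\varphi_a^{-1}$ be the inverse of $\varphi_a$ on $[0,\infty)$. Then the Laplace-Stieltjes transform of the steady state waiting time $W_N$ of class $N$ particles is, for $\alpha>0$, $$\mathrm{E}e^{-\alpha W_N}=\frac{\varphi'(0)\,\eta_N(\varphi_a^{-1}(\alpha))}{\rho_N\,\varphi\left(\varphi_a^{-1}(\alpha)\right)}.$$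
   Context: A subordinator is a non-decreasing right-continuous Lévy process started at $0$; write $\eta_i(\alpha)=c_i\alpha+\int_{(0,\infty)}(1-e^{-\alpha x})\nu_i(dx)$ with drift $c_i\ge 0$ and Lévy measure $\nu_i$. The queue. A single server removes work at rate $1$ whenever the system is non-empty. Work of class $i$ consists of infinitesimal customers ("particles") arriving according to $J_i$, either continuously (drift part) or in batches (jumps). The total workload $W(t)$ is the reflection at $0$ of $\sum_{i=1}^NJ_i(t)-t$ (started from $W(0)=0$). A class $i$ particle that arrived at time $s$ has at time $t\ge s$ the accumulated priority $b_i(t-s)$, and the server always processes next the particles of highest accumulated priority. Content in front of a class $N$ particle. A class $N$ particle arriving on its own at time $s$ has content $W(s-)=W(s)$ in front of it at arrival; a class $N$ particle at location $x\in[0,\Delta J_N(s)]$ in a batch (a jump of $J_N$ at time $s$, of size $\Delta J_N(s)$) has content $W(s-)+x$ in front of it. All of this content is served before the particle. The steady state content in front of an arriving class $N$ particle is a random variable $V$ whose distribution is the long-run average over arriving class $N$ particles: for bounded continuous $f$, $$\mathrm{E}f(V)=\lim_{t\to\infty}\frac{1}{J_N(t)}\Big(c_N\int_0^t f(W(s))\,ds+\sum_{0<s\le t}\int_0^{\Delta J_N(s)}f(W(s-)+x)\,dx\Big)\quad\text{a.s.}$$ Waiting time. Measure time from the arrival of a tagged class $N$ particle, let $v$ be the content in front of it at arrival, and let $J_1,\dots,J_{N-1}$ now denote the class inputs after its arrival. If the particle is known to wait at least time $w$, then for each $i<N$ the class $i$ work arriving at times $t$ with $b_i(w-t)\ge b_Nw$,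 i.e. $t\le a_iw$, overtakes it. Accordingly set $T_0=v$ and $T_{n+1}=v+J_a(T_n)$ for $n\ge 0$; the waiting time of the tagged particle is $T=\lim_{n\to\infty}T_n$. The steady state waiting time $W_N$ is the random variable $T$ obtained when $v$ is replaced by $V$, with $V$ independent of the input processes $J_1,\dots,J_{N-1}$ after the arrival. *)

theory Defs
  imports "HOL-Probability.Probability"
begin

text \<open>A stochastic process with time set \<open>[0, \<infinity>)\<close> is a function of time and outcome; its values at
  negative times are irrelevant. Path properties are required for every outcome, not merely almost
  surely, so that evaluations at random times are measurable also on an incomplete space.\<close>

definition subordinator :: "'a measure \<Rightarrow> (real \<Rightarrow> 'a \<Rightarrow> real) \<Rightarrow> bool" where
  "subordinator M X \<longleftrightarrow>
     (\<forall>t\<ge>0. X t \<in> borel_measurable M) \<and>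
     (\<forall>\<omega>\<in>space M. X 0 \<omega> = 0 \<and> mono_on {0..} (\<lambda>t. X t \<omega>) \<and>
        (\<forall>t\<ge>0. continuous (at_right t) (\<lambda>u. X u \<omega>))) \<and>
     (\<forall>\<tau> :: nat \<Rightarrow> real. 0 \<le> \<tau> 0 \<and> mono \<tau> \<longrightarrow>
        prob_space.indep_vars M (\<lambda>_. borel) (\<lambda>k \<omega>. X (\<tau> (Suc k)) \<omega> - X (\<tau> k) \<omega>) UNIV) \<and>
     (\<forall>s\<ge>0. \<forall>t\<ge>0. distr M borel (\<lambda>\<omega>. X (s + t) \<omega> - X s \<omega>) = distr M borel (X t))"

definition path_space :: "(real \<Rightarrow> real) measure" where
  "path_space = Pi\<^sub>M {0..} (\<lambda>_. borel)"

definition sample_path :: "(real \<Rightarrow> 'a \<Rightarrow> real) \<Rightarrow> 'a \<Rightarrow> real \<Rightarrow> real" where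
  "sample_path X \<omega> = (\<lambda>t\<in>{0..}. X t \<omega>)"

definition laplace_exponent :: "'a measure \<Rightarrow> (real \<Rightarrow> 'a \<Rightarrow> real) \<Rightarrow> real \<Rightarrow> real" where
  "laplace_exponent M X \<alpha> = - ln (\<integral>\<omega>. exp (- \<alpha> * X 1 \<omega>) \<partial>M)"

text \<open>The Laplace exponent \<open>\<eta>\<close> belongs to drift \<open>c\<close> and Levy measure \<open>\<nu>\<close>; the latter is a measure
  on the whole line that is concentrated on \<open>(0, \<infinity>)\<close>.\<close>

definition levy_khintchine :: "(real \<Rightarrow> real) \<Rightarrow> real \<Rightarrow> real measure \<Rightarrow> bool" where
  "levy_khintchine \<eta> c \<nu> \<longleftrightarrow>
     0 \<le> c \<and> sets \<nu> = sets borel \<and> emeasure \<nu> {..0} = 0 \<and> integrable \<nu> (\<lambda>x. min 1 x) \<and>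
     (\<forall>\<alpha>\<ge>0. \<eta> \<alpha> = c * \<alpha> + (\<integral>x. 1 - exp (- \<alpha> * x) \<partial>\<nu>))"

text \<open>Reflection at 0 of \<open>X t = (\<Sum>i\<le>N. J i t) - t\<close>. As \<open>X 0 = 0\<close>, the infimum is at most 0 and no
  further minimum with 0 is needed.\<close>

definition net_input :: "nat \<Rightarrow> (nat \<Rightarrow> real \<Rightarrow> 'a \<Rightarrow> real) \<Rightarrow> real \<Rightarrow> 'a \<Rightarrow> real" where
  "net_input N J t \<omega> = (\<Sum>i\<in>{1..N}. J i t \<omega>) - t"

definition workload :: "nat \<Rightarrow> (nat \<Rightarrow> real \<Rightarrow> 'a \<Rightarrow> real) \<Rightarrow> real \<Rightarrow> 'a \<Rightarrow> real" where
  "workload N J t \<omega> = net_input N J t \<omega> - (INF s\<in>{0..t}. net_input N J s \<omega>)"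

definition left_lim :: "(real \<Rightarrow> 'a \<Rightarrow> real) \<Rightarrow> real \<Rightarrow> 'a \<Rightarrow> real" where
  "left_lim X s \<omega> = Lim (at_left s) (\<lambda>u. X u \<omega>)"

definition jump :: "(real \<Rightarrow> 'a \<Rightarrow> real) \<Rightarrow> real \<Rightarrow> 'a \<Rightarrow> real" where
  "jump X s \<omega> = X s \<omega> - left_lim X s \<omega>"

text \<open>Average of \<open>f\<close> applied to the content in front of the class \<open>N\<close> particles arriving during
  \<open>[0, t]\<close>, where \<open>c\<close> is the drift of \<open>J N\<close>. The sum ranges over all times in \<open>(0, t]\<close>; its terms
  vanish outside the countably many jump times of \<open>J N\<close>.\<close>

definition content_average ::
  "nat \<Rightarrow> (nat \<Rightarrow> real \<Rightarrow> 'a \<Rightarrow> real) \<Rightarrow> real \<Rightarrow> (real \<Rightarrow> real) \<Rightarrow> real \<Rightarrow> 'a \<Rightarrow> real" where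
  "content_average N J c f t \<omega> = 1 / J N t \<omega> *
     (c * (LINT s:{0..t}|lborel. f (workload N J s \<omega>)) +
      (\<Sum>\<^sub>\<infinity>s\<in>{0<..t}. LINT x:{0..jump (J N) s \<omega>}|lborel. f (left_lim (workload N J) s \<omega> + x)))"

definition steady_state_content_law ::
  "'a measure \<Rightarrow> nat \<Rightarrow> (nat \<Rightarrow> real \<Rightarrow> 'a \<Rightarrow> real) \<Rightarrow> real \<Rightarrow> real measure \<Rightarrow> bool" where
  "steady_state_content_law M N J c \<mu> \<longleftrightarrow>
     prob_space \<mu> \<and> sets \<mu> = sets borel \<and>
     (\<forall>f. continuous_on UNIV f \<and> bounded (range f) \<longrightarrow>
        (AE \<omega> in M. ((\<lambda>t. content_average N J c f t \<omega>) \<longlongrightarrow> (\<integral>v. f v \<partial>\<mu>)) at_top))"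

definition overtaking_input ::
  "nat \<Rightarrow> (nat \<Rightarrow> real) \<Rightarrow> (nat \<Rightarrow> real \<Rightarrow> 'a \<Rightarrow> real) \<Rightarrow> real \<Rightarrow> 'a \<Rightarrow> real" where
  "overtaking_input N a J t \<omega> = (\<Sum>i\<in>{1..<N}. J i (a i * t) \<omega>)"

primrec waiting_iterate ::
  "nat \<Rightarrow> (nat \<Rightarrow> real) \<Rightarrow> (nat \<Rightarrow> real \<Rightarrow> 'a \<Rightarrow> real) \<Rightarrow> ('a \<Rightarrow> real) \<Rightarrow> nat \<Rightarrow> 'a \<Rightarrow> real" where
  "waiting_iterate N a J V 0 \<omega> = V \<omega>"
| "waiting_iterate N a J V (Suc n) \<omega> =
     V \<omega> + overtaking_input N a J (waiting_iterate N a J V n \<omega>) \<omega>"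

definition waiting_time ::
  "nat \<Rightarrow> (nat \<Rightarrow> real) \<Rightarrow> (nat \<Rightarrow> real \<Rightarrow> 'a \<Rightarrow> real) \<Rightarrow> ('a \<Rightarrow> real) \<Rightarrow> 'a \<Rightarrow> real" where
  "waiting_time N a J V \<omega> = lim (\<lambda>n. waiting_iterate N a J V n \<omega>)"

end

theory Submission
  imports Defs "HOL-Real_Asymp.Real_Asymp"
begin

text \<open>Everything is computed on grids of mesh \<open>h\<close>: the net input plus \<open>t\<close> is nondecreasing, so grid
  values control the paths up to \<open>h\<close>.

  Waiting time: with \<open>\<beta> > 0\<close> and \<open>\<alpha> = \<phi>\<^sub>a \<beta>\<close>, the process \<open>exp (- \<beta> (V + J\<^sub>a t - t) - \<alpha> t)\<close> is a
  martingale. Stopping it at the first grid point with \<open>V + J\<^sub>a t \<le> t\<close>, where \<open>t - V - J\<^sub>a t \<le> h\<close>, gives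
  \<open>E exp (- \<alpha> T) = E exp (- \<beta> V)\<close> as \<open>h\<close> tends to 0. This grid point is an upper bound for \<open>T\<close>, and a
  lower bound if \<open>V\<close> is replaced by \<open>max (V - h) 0\<close>.

  Content in front: the Lindley recursion of the sampled workload yields
  \<open>\<phi> \<beta> E \<integral>\<^sub>0\<^sup>n exp (- \<beta> W) = E exp (- \<beta> W n) - 1 + \<beta> E L n\<close> in the limit, with \<open>L\<close> the idle time. Here
  \<open>E L n / n\<close> is at least \<open>\<phi>' 0\<close>, and the same identity at \<open>\<gamma>\<close> bounds it by \<open>\<phi> \<gamma> / \<gamma> + 1 / (\<gamma> n)\<close>;
  with \<open>\<gamma>\<close> tending to 0 the time average of \<open>E exp (- \<beta> W)\<close> tends to \<open>\<beta> \<phi>' 0 / \<phi> \<beta>\<close>. For the jumps of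
  \<open>J\<^sub>N\<close>, the sums of \<open>exp (- \<beta> W) ((1 - exp (- \<beta> \<Delta>)) / \<beta> - (1 - exp (- \<gamma> \<Delta>)) / \<gamma>)\<close> over grid increments
  \<open>\<Delta>\<close> converge to the sum over jumps: the bracket is of second order at 0, so the continuous part of
  \<open>J\<^sub>N\<close> does not contribute. Then \<open>\<gamma>\<close> tends to infinity, and \<open>\<eta>\<^sub>N \<gamma> / \<gamma>\<close> to the drift \<open>c\<close>. The almost
  sure limit of the ratio is identified by taking expectations, with the uniform integrability of
  \<open>J\<^sub>N n / n\<close> replacing the law of large numbers.\<close>

section \<open>Subordinators and their Laplace exponents\<close>

text \<open>Independent increments are given only along sequences of times. On a grid, the past and
  the next increment become disjoint blocks of one independent family, and every identity is an
  exact discrete recursion before its limit is taken. The almost sure existence of the limiting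
  average is part of \<open>steady_state_content_law\<close>; only its value is sought, and for this
  expectations suffice. Sums of \<open>eps \<beta>\<close> over the grid increments of the class N
  input would converge to the jump sum plus the drift times the occupation integral; subtracting the
  sum with \<gamma> removes this drift term. As \<gamma> grows, the subtracted term vanishes on each
  jump, but its mean still leaves the drift c times the occupation integral. The content average
  contains c times the same integral, so its numerator has mean
  \<open>\<eta>\<^sub>N \<beta> / \<beta>\<close> times the mean occupation, whatever c is. After
  division by time this tends to \<open>\<eta>\<^sub>N \<beta> * \<phi>' 0 / \<phi> \<beta>\<close>,
  while the denominator has mean rate \<open>\<rho>\<^sub>N\<close>. Together with the waiting time
  identity at the \<beta> with \<open>\<phi>\<^sub>a \<beta> = \<alpha>\<close> this is the
  formula.\<close>

lemma additive_nonneg_linear: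
  fixes f :: "real \<Rightarrow> real"
  assumes add: "\<And>s t. 0 \<le> s \<Longrightarrow> 0 \<le> t \<Longrightarrow> f (s + t) = f s + f t"
    and nn: "\<And>t. 0 \<le> t \<Longrightarrow> 0 \<le> f t" and t: "0 \<le> t"
  shows "f t = t * f 1"
proof -
  have f0: "f 0 = 0" using add[of 0 0] by simp
  have mult: "f (real n * s) = real n * f s" if "0 \<le> s" for n s
    by (induction n) (use that f0 add[of "real _ * s" s] in \<open>auto simp: algebra_simps\<close>)
  have mono: "f s \<le> f u" if "0 \<le> s" "s \<le> u" for s u
    using add[of s "u - s"] nn[of "u - s"] that by simp
  \<comment> \<open>Nonnegativity makes \<open>f\<close> monotone, so comparing
    \<open>f (n t)\<close> with the values at the integers around \<open>n t\<close> bounds the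
    scaled deviation by \<open>f 1\<close> for every \<open>n\<close>. The Archimedean property then
    forces the deviation to be zero.\<close>
  have bound: "real n * \<bar>f t - t * f 1\<bar> \<le> f 1" for n :: nat
  proof -
    define k where "k = nat \<lfloor>real n * t\<rfloor>"
    have k: "real k \<le> real n * t" "real n * t \<le> real k + 1"
      unfolding k_def using t by (auto simp: of_nat_nat)
    have "real k * f 1 \<le> real n * f t"
      using mono[OF _ k(1)] mult[of 1 k] mult[of t n] t by simp
    moreover have "real n * f t \<le> (real k + 1) * f 1"
      using mono[OF _ k(2)] mult[of 1 "Suc k"] mult[of t n] t by (simp add: add.commute)
    moreover have "real k * f 1 \<le> real n * t * f 1" "real n * t * f 1 \<le> (real k + 1) * f 1"
      using k nn[of 1] by (auto intro: mult_right_mono)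
    ultimately have "\<bar>real n * f t - real n * t * f 1\<bar> \<le> f 1" by (auto simp: algebra_simps abs_le_iff)
    also have "real n * f t - real n * t * f 1 = real n * (f t - t * f 1)" by (simp add: algebra_simps)
    finally show ?thesis by (simp add: abs_mult)
  qed
  show ?thesis
  proof (rule ccontr)
    assume "f t \<noteq> t * f 1"
    then obtain n where "real n * \<bar>f t - t * f 1\<bar> > f 1"
      using reals_Archimedean3[of "\<bar>f t - t * f 1\<bar>"] by auto
    with bound[of n] show False by simp
  qed
qed

locale subordinator_process = prob_space M for M :: "'a measure" +
  fixes X :: "real \<Rightarrow> 'a \<Rightarrow> real"
  assumes subordinator: "subordinator M X"
begin

lemma measurable_X [measurable (raw)]: "0 \<le> t \<Longrightarrow> X t \<in> borel_measurable M"
  using subordinator by (auto simp: subordinator_def)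

lemma X_0: "\<omega> \<in> space M \<Longrightarrow> X 0 \<omega> = 0"
  using subordinator by (auto simp: subordinator_def)

lemma X_mono: "\<omega> \<in> space M \<Longrightarrow> 0 \<le> s \<Longrightarrow> s \<le> t \<Longrightarrow> X s \<omega> \<le> X t \<omega>"
  using subordinator by (auto simp: subordinator_def mono_on_def)

lemma X_nonneg: "\<omega> \<in> space M \<Longrightarrow> 0 \<le> t \<Longrightarrow> 0 \<le> X t \<omega>"
  using X_mono[of \<omega> 0 t] X_0[of \<omega>] by simp

lemma X_right_cont: "\<omega> \<in> space M \<Longrightarrow> 0 \<le> t \<Longrightarrow> continuous (at_right t) (\<lambda>u. X u \<omega>)"
  using subordinator by (auto simp: subordinator_def)

lemma indep_increments:
  "0 \<le> \<tau> 0 \<Longrightarrow> mono \<tau> \<Longrightarrow> indep_vars (\<lambda>_. borel) (\<lambda>k \<omega>. X (\<tau> (Suc k)) \<omega> - X (\<tau> k) \<omega>) UNIV"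
  using subordinator by (auto simp: subordinator_def)

lemma stationary: "0 \<le> s \<Longrightarrow> 0 \<le> t \<Longrightarrow>
    distr M borel (\<lambda>\<omega>. X (s + t) \<omega> - X s \<omega>) = distr M borel (X t)"
  using subordinator by (auto simp: subordinator_def)

lemma integral_increment:
  fixes g :: "real \<Rightarrow> real"
  assumes "0 \<le> s" "0 \<le> t" "g \<in> borel_measurable borel"
  shows "(\<integral>\<omega>. g (X (s + t) \<omega> - X s \<omega>) \<partial>M) = (\<integral>\<omega>. g (X t \<omega>) \<partial>M)"
proof -
  have "(\<integral>\<omega>. g (X (s + t) \<omega> - X s \<omega>) \<partial>M) = (\<integral>x. g x \<partial>distr M borel (\<lambda>\<omega>. X (s + t) \<omega> - X s \<omega>))"
    using assms by (subst integral_distr) auto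
  also have "\<dots> = (\<integral>\<omega>. g (X t \<omega>) \<partial>M)"
    using assms by (subst stationary, simp, simp, subst integral_distr) auto
  finally show ?thesis .
qed

lemma integrable_increment:
  fixes g :: "real \<Rightarrow> real"
  assumes "0 \<le> s" "0 \<le> t" "g \<in> borel_measurable borel"
  shows "integrable M (\<lambda>\<omega>. g (X (s + t) \<omega> - X s \<omega>)) \<longleftrightarrow> integrable M (\<lambda>\<omega>. g (X t \<omega>))"
proof -
  have "integrable M (\<lambda>\<omega>. g (X (s + t) \<omega> - X s \<omega>)) \<longleftrightarrow> integrable (distr M borel (\<lambda>\<omega>. X (s + t) \<omega> - X s \<omega>)) g"
    using assms by (subst integrable_distr_eq) auto
  also have "\<dots> \<longleftrightarrow> integrable M (\<lambda>\<omega>. g (X t \<omega>))"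
    using assms by (subst stationary, simp, simp, subst integrable_distr_eq) auto
  finally show ?thesis .
qed

definition L :: "real \<Rightarrow> real \<Rightarrow> real" where
  "L \<alpha> t = (\<integral>\<omega>. exp (- \<alpha> * X t \<omega>) \<partial>M)"

lemma integrable_exp: "0 \<le> \<alpha> \<Longrightarrow> 0 \<le> t \<Longrightarrow> integrable M (\<lambda>\<omega>. exp (- \<alpha> * X t \<omega>))"
  by (rule integrable_const_bound[of _ 1]) (auto intro!: AE_I2 simp: X_nonneg)

lemma L_add:
  assumes "0 \<le> \<alpha>" "0 \<le> s" "0 \<le> t"
  shows "L \<alpha> (s + t) = L \<alpha> s * L \<alpha> t"
proof -
  \<comment> \<open>Independence is stated for infinite time sequences; this one runs through 0,
    \<open>s\<close>, \<open>s + t\<close> and then stays put.\<close>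
  define \<tau> where "\<tau> k = (if k = 0 then 0 else if k = 1 then s else s + t)" for k :: nat
  have "mono \<tau>" using assms by (auto simp: \<tau>_def mono_def)
  define D where "D k \<omega> = exp (- \<alpha> * (X (\<tau> (Suc k)) \<omega> - X (\<tau> k) \<omega>))" for k \<omega>
  have "indep_vars (\<lambda>_. borel) (\<lambda>k \<omega>. X (\<tau> (Suc k)) \<omega> - X (\<tau> k) \<omega>) UNIV"
    by (rule indep_increments[OF _ \<open>mono \<tau>\<close>]) (simp add: \<tau>_def)
  then have "indep_vars (\<lambda>_. borel) D UNIV"
    unfolding D_def by (rule indep_vars_compose2) simp
  then have ind: "indep_vars (\<lambda>_. borel) D {0, 1}" by (rule indep_vars_subset) simp
  have D0: "D 0 \<omega> = exp (- \<alpha> * X s \<omega>)" if "\<omega> \<in> space M" for \<omega>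
    using that by (simp add: D_def \<tau>_def X_0)
  have D1: "D (Suc 0) \<omega> = exp (- \<alpha> * (X (s + t) \<omega> - X s \<omega>))" for \<omega>
    by (simp add: D_def \<tau>_def)
  have i0: "integrable M (D 0)"
    using integrable_exp[OF assms(1,2)] by (subst Bochner_Integration.integrable_cong[OF refl D0]) auto
  have i1: "integrable M (D (Suc 0))"
    unfolding D1 using integrable_exp[OF assms(1,3)] integrable_increment[OF assms(2,3), of "\<lambda>x. exp (- \<alpha> * x)"]
    by auto
  have "L \<alpha> (s + t) = (\<integral>\<omega>. (\<Prod>k\<in>{0,1}. D k \<omega>) \<partial>M)"
    unfolding L_def by (rule Bochner_Integration.integral_cong) (auto simp: D0 D1 exp_add[symmetric] algebra_simps)
  also have "\<dots> = (\<Prod>k\<in>{0,1}. \<integral>\<omega>. D k \<omega> \<partial>M)"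
    using i0 i1 by (intro indep_vars_lebesgue_integral ind) auto
  also have "\<dots> = (\<integral>\<omega>. D 0 \<omega> \<partial>M) * (\<integral>\<omega>. D (Suc 0) \<omega> \<partial>M)" by simp
  also have "(\<integral>\<omega>. D 0 \<omega> \<partial>M) = L \<alpha> s"
    unfolding L_def by (rule Bochner_Integration.integral_cong) (auto simp: D0)
  also have "(\<integral>\<omega>. D (Suc 0) \<omega> \<partial>M) = L \<alpha> t"
    unfolding L_def D1 using integral_increment[OF assms(2,3), of "\<lambda>x. exp (- \<alpha> * x)"] by simp
  finally show ?thesis .
qed

lemma L_pos: "0 \<le> \<alpha> \<Longrightarrow> 0 \<le> t \<Longrightarrow> 0 < L \<alpha> t"
proof -
  assume *: "0 \<le> \<alpha>" "0 \<le> t"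
  have "L \<alpha> t \<noteq> 0"
    unfolding L_def using integrable_exp[OF *] by (subst integral_nonneg_eq_0_iff_AE) (auto simp: AE_False)
  moreover have "0 \<le> L \<alpha> t" unfolding L_def by (rule integral_nonneg_AE) auto
  ultimately show ?thesis by simp
qed

lemma L_le_1: "0 \<le> \<alpha> \<Longrightarrow> 0 \<le> t \<Longrightarrow> L \<alpha> t \<le> 1"
  unfolding L_def by (rule integral_le_const[OF integrable_exp]) (auto intro!: AE_I2 simp: X_nonneg)

abbreviation \<eta> :: "real \<Rightarrow> real" where "\<eta> \<equiv> laplace_exponent M X"

text \<open>Multiplicativity of \<open>L\<close> in time together with \<open>L_le_1\<close> makes
  \<open>- ln (L \<alpha> t)\<close> additive and nonnegative in \<open>t\<close>, hence linear; its
  slope is the exponent by definition.\<close>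

lemma laplace_transform:
  assumes "0 \<le> \<alpha>" "0 \<le> t"
  shows "(\<integral>\<omega>. exp (- \<alpha> * X t \<omega>) \<partial>M) = exp (- t * \<eta> \<alpha>)"
proof -
  have "- ln (L \<alpha> t) = t * (- ln (L \<alpha> 1))"
    using assms by (intro additive_nonneg_linear[of "\<lambda>t. - ln (L \<alpha> t)"])
      (auto simp: L_add L_pos ln_mult_pos L_le_1)
  then have "ln (L \<alpha> t) = - t * \<eta> \<alpha>"
    by (simp add: laplace_exponent_def L_def)
  then show ?thesis
    using L_pos[OF assms] by (metis L_def exp_ln)
qed

lemma \<eta>_0: "\<eta> 0 = 0"
  by (simp add: laplace_exponent_def prob_space)

lemma \<eta>_mono: "0 \<le> \<alpha> \<Longrightarrow> \<alpha> \<le> \<beta> \<Longrightarrow> \<eta> \<alpha> \<le> \<eta> \<beta>"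
proof -
  assume "0 \<le> \<alpha>" "\<alpha> \<le> \<beta>"
  then have "L \<beta> 1 \<le> L \<alpha> 1"
    unfolding L_def by (intro integral_mono integrable_exp) (auto simp: X_nonneg mult_right_mono)
  then show ?thesis
    using L_pos[of \<beta> 1] L_pos[of \<alpha> 1] \<open>0 \<le> \<alpha>\<close> \<open>\<alpha> \<le> \<beta>\<close> by (simp add: laplace_exponent_def L_def)
qed

lemma \<eta>_nonneg: "0 \<le> \<alpha> \<Longrightarrow> 0 \<le> \<eta> \<alpha>"
  using \<eta>_mono[of 0 \<alpha>] \<eta>_0 by simp

context
  assumes integrable_X1: "integrable M (X 1)"
begin

lemma integrable_X:
  assumes "0 \<le> t" shows "integrable M (X t)"
proof -
  have nat: "integrable M (X (real n))" for n
  proof (induction n)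
    case 0
    have "integrable M (X 0) \<longleftrightarrow> integrable M (\<lambda>_. 0::real)"
      by (rule Bochner_Integration.integrable_cong) (auto simp: X_0)
    then show ?case by simp
  next
    case (Suc n)
    have "integrable M (\<lambda>\<omega>. (X (real n + 1) \<omega> - X (real n) \<omega>) + X (real n) \<omega>)"
      using integrable_increment[of "real n" 1 "\<lambda>x. x"] integrable_X1 Suc
      by (intro Bochner_Integration.integrable_add) auto
    then show ?case by (simp add: add.commute)
  qed
  obtain n where "t \<le> real n" using real_arch_simple by blast
  then show ?thesis
    by (intro Bochner_Integration.integrable_bound[OF nat[of n]])
      (auto intro!: AE_I2 simp: assms X_nonneg X_mono)
qed

lemma expectation_X: "0 \<le> t \<Longrightarrow> (\<integral>\<omega>. X t \<omega> \<partial>M) = t * (\<integral>\<omega>. X 1 \<omega> \<partial>M)"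
proof (rule additive_nonneg_linear[of "\<lambda>t. \<integral>\<omega>. X t \<omega> \<partial>M"])
  fix s t :: real assume st: "0 \<le> s" "0 \<le> t"
  have "(\<integral>\<omega>. X (s + t) \<omega> \<partial>M) - (\<integral>\<omega>. X s \<omega> \<partial>M) = (\<integral>\<omega>. X (s + t) \<omega> - X s \<omega> \<partial>M)"
    using st by (simp add: integrable_X)
  also have "\<dots> = (\<integral>\<omega>. X t \<omega> \<partial>M)" using integral_increment[OF st, of "\<lambda>x. x"] by simp
  finally show "(\<integral>\<omega>. X (s + t) \<omega> \<partial>M) = (\<integral>\<omega>. X s \<omega> \<partial>M) + (\<integral>\<omega>. X t \<omega> \<partial>M)" by simp
qed (auto intro!: integral_nonneg_AE AE_I2 simp: X_nonneg)

lemma tendsto_scaled_exp: "(\<lambda>n. real n * (1 - exp (- (x / real n)))) \<longlonglongrightarrow> x"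
  by real_asymp

text \<open>The logarithm at time 1 does not respect the elementary bound exp (- \<alpha> x) - exp
  (- \<beta> x) \<le> (\<beta> - \<alpha>) x. At time 1 / n the bound compares the transforms exp (-
  \<eta> / n), and multiplying by n linearizes these in the limit.\<close>

lemma \<eta>_Lipschitz:
  assumes "0 \<le> \<alpha>" "\<alpha> \<le> \<beta>"
  shows "\<eta> \<beta> - \<eta> \<alpha> \<le> (\<integral>\<omega>. X 1 \<omega> \<partial>M) * (\<beta> - \<alpha>)"
proof -
  let ?e = "\<lambda>x n. real n * (1 - exp (- (x / real n)))"
  have "?e (\<eta> \<beta>) n - ?e (\<eta> \<alpha>) n \<le> (\<integral>\<omega>. X 1 \<omega> \<partial>M) * (\<beta> - \<alpha>)" if "n > 0" for n :: nat
  proof -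
    let ?t = "1 / real n"
    have t: "0 \<le> ?t" by simp
    have le: "exp (- \<alpha> * x) - exp (- \<beta> * x) \<le> (\<beta> - \<alpha>) * x" if "0 \<le> x" for x
    proof -
      have "exp (- \<alpha> * x) - exp (- \<beta> * x) = exp (- \<alpha> * x) * (1 - exp (- ((\<beta> - \<alpha>) * x)))"
        by (simp add: algebra_simps exp_add[symmetric])
      also have "\<dots> \<le> 1 * ((\<beta> - \<alpha>) * x)"
        using exp_ge_add_one_self[of "- ((\<beta> - \<alpha>) * x)"] assms that by (intro mult_mono) auto
      finally show ?thesis by simp
    qed
    have "exp (- (\<eta> \<alpha> / n)) - exp (- (\<eta> \<beta> / n)) = (\<integral>\<omega>. exp (- \<alpha> * X ?t \<omega>) - exp (- \<beta> * X ?t \<omega>) \<partial>M)"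
      using laplace_transform[OF _ t, of \<alpha>] laplace_transform[OF _ t, of \<beta>] integrable_exp[of \<alpha> ?t] integrable_exp[of \<beta> ?t] assms by simp
    also have "\<dots> \<le> (\<integral>\<omega>. (\<beta> - \<alpha>) * X ?t \<omega> \<partial>M)"
      using assms by (intro integral_mono Bochner_Integration.integrable_diff integrable_exp integrable_mult_right integrable_X le)
        (auto simp: X_nonneg)
    also have "\<dots> = (\<beta> - \<alpha>) * (\<integral>\<omega>. X 1 \<omega> \<partial>M) / n"
      using expectation_X[OF t] by simp
    finally show ?thesis using that by (simp add: field_simps)
  qed
  then have "eventually (\<lambda>n. ?e (\<eta> \<beta>) n - ?e (\<eta> \<alpha>) n \<le> (\<integral>\<omega>. X 1 \<omega> \<partial>M) * (\<beta> - \<alpha>)) sequentially"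
    using eventually_gt_at_top[of "0::nat"] by (rule eventually_mono[rotated])
  moreover have "(\<lambda>n. ?e (\<eta> \<beta>) n - ?e (\<eta> \<alpha>) n) \<longlonglongrightarrow> \<eta> \<beta> - \<eta> \<alpha>"
    by (intro tendsto_diff tendsto_scaled_exp)
  ultimately show ?thesis
    by (intro tendsto_upperbound[of _ _ sequentially]) auto
qed

text \<open>A squeeze: the Lipschitz bound from 0 gives the upper estimate, and ln x \<le> x - 1
  gives the lower one, (1 - \<open>L \<alpha> 1\<close>) / \<alpha>, which converges by dominated
  convergence with majorant \<open>X 1\<close>.\<close>

lemma \<eta>_derivative_0: "((\<lambda>\<alpha>. \<eta> \<alpha> / \<alpha>) \<longlongrightarrow> (\<integral>\<omega>. X 1 \<omega> \<partial>M)) (at_right 0)"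
proof -
  let ?\<rho> = "\<integral>\<omega>. X 1 \<omega> \<partial>M"
  have lb: "((\<lambda>\<alpha>. (1 - L \<alpha> 1) / \<alpha>) \<longlongrightarrow> ?\<rho>) (at_right 0)"
  proof (subst tendsto_at_iff_sequentially, intro allI impI)
    fix S :: "nat \<Rightarrow> real" assume S: "\<forall>i. S i \<in> {0<..} - {0}" "S \<longlonglongrightarrow> 0"
    then have pos: "S i > 0" for i by auto
    have f: "filterlim S (at 0) sequentially"
      using S(2) pos by (auto simp: filterlim_at intro!: always_eventually order.strict_implies_not_eq[symmetric] less_imp_neq[symmetric])
    have "(\<lambda>i. \<integral>\<omega>. (1 - exp (- S i * X 1 \<omega>)) / S i \<partial>M) \<longlonglongrightarrow> ?\<rho>"
    proof (rule integral_dominated_convergence[where w="X 1"])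
      show "AE \<omega> in M. (\<lambda>i. (1 - exp (- S i * X 1 \<omega>)) / S i) \<longlonglongrightarrow> X 1 \<omega>"
      proof (rule AE_I2)
        fix \<omega>
        have "((\<lambda>s. (1 - exp (- s * X 1 \<omega>)) / s) \<longlongrightarrow> X 1 \<omega>) (at 0)" by real_asymp
        from filterlim_compose[OF this f] show "(\<lambda>i. (1 - exp (- S i * X 1 \<omega>)) / S i) \<longlonglongrightarrow> X 1 \<omega>" .
      qed
      fix i
      show "AE \<omega> in M. norm ((1 - exp (- S i * X 1 \<omega>)) / S i) \<le> X 1 \<omega>"
      proof (rule AE_I2)
        fix \<omega> assume "\<omega> \<in> space M"
        then have "0 \<le> S i * X 1 \<omega>" using pos[of i] by (simp add: X_nonneg)
        then show "norm ((1 - exp (- S i * X 1 \<omega>)) / S i) \<le> X 1 \<omega>"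
          using exp_ge_add_one_self[of "- S i * X 1 \<omega>"] pos[of i] by (simp add: abs_of_nonneg divide_le_eq algebra_simps)
      qed
    qed (auto simp: integrable_X1)
    also have "(\<lambda>i. \<integral>\<omega>. (1 - exp (- S i * X 1 \<omega>)) / S i \<partial>M) = (\<lambda>i. (1 - L (S i) 1) / S i)"
    proof
      fix i show "(\<integral>\<omega>. (1 - exp (- S i * X 1 \<omega>)) / S i \<partial>M) = (1 - L (S i) 1) / S i"
        using integrable_exp[of "S i" 1] pos[of i] by (simp add: L_def prob_space)
    qed
    finally show "((\<lambda>\<alpha>. (1 - L \<alpha> 1) / \<alpha>) \<circ> S) \<longlonglongrightarrow> ?\<rho>" by (simp add: comp_def)
  qed
  show ?thesis
  proof (rule tendsto_sandwich[OF _ _ lb tendsto_const])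
    show "eventually (\<lambda>\<alpha>. (1 - L \<alpha> 1) / \<alpha> \<le> \<eta> \<alpha> / \<alpha>) (at_right 0)"
      using eventually_at_right_less[of 0]
    proof eventually_elim
      case (elim \<alpha>)
      have "1 - L \<alpha> 1 \<le> \<eta> \<alpha>"
        using ln_le_minus_one[OF L_pos[of \<alpha> 1]] elim by (simp add: laplace_exponent_def L_def)
      then show ?case using elim by (simp add: divide_right_mono)
    qed
    show "eventually (\<lambda>\<alpha>. \<eta> \<alpha> / \<alpha> \<le> ?\<rho>) (at_right 0)"
      using eventually_at_right_less[of 0]
    proof eventually_elim
      case (elim \<alpha>)
      then show ?case using \<eta>_Lipschitz[of 0 \<alpha>] \<eta>_0 by (simp add: field_simps)
    qed
  qed
qed

end
end

section \<open>Independence of increments\<close>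

context prob_space
begin

text \<open>Joins two levels of independence. All conditions on the increments of one process form a
  single event \<open>B i\<close> of its path, so a finite intersection factors first over the
  processes and then, within each of them, over the increments.\<close>

lemma indep_vars_sections:
  fixes X :: "'i \<Rightarrow> real \<Rightarrow> 'a \<Rightarrow> real"
  assumes X: "\<And>i. i \<in> I \<Longrightarrow> subordinator M (X i)"
    and ind: "indep_vars (\<lambda>_. path_space) (\<lambda>i. sample_path (X i)) I"
    and \<tau>: "\<And>i. i \<in> I \<Longrightarrow> 0 \<le> \<tau> i 0" "\<And>i. i \<in> I \<Longrightarrow> mono (\<tau> i)"
  shows "indep_vars (\<lambda>_. borel) (\<lambda>(i, k) \<omega>. X i (\<tau> i (Suc k)) \<omega> - X i (\<tau> i k) \<omega>) (I \<times> UNIV)"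
proof -
  define D where "D i k \<omega> = X i (\<tau> i (Suc k)) \<omega> - X i (\<tau> i k) \<omega>" for i k \<omega>
  have \<tau>0: "0 \<le> \<tau> i k" if "i \<in> I" for i k
    using \<tau>(1)[OF that] monoD[OF \<tau>(2)[OF that], of 0 k] by simp
  have indD: "indep_vars (\<lambda>_. borel) (D i) UNIV" if "i \<in> I" for i
  proof -
    interpret subordinator_process M "X i" by unfold_locales (rule X[OF that])
    show ?thesis unfolding D_def by (rule indep_increments[OF \<tau>[OF that]])
  qed
  have rv: "D i k \<in> borel_measurable M" if "i \<in> I" for i k
    using indD[OF that] by (auto simp: indep_vars_def)
  have factor: "prob (\<Inter>i\<in>H. \<Inter>k\<in>K i. D i k -` A (i, k) \<inter> space M)
      = (\<Prod>i\<in>H. \<Prod>k\<in>K i. prob (D i k -` A (i, k) \<inter> space M))"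
    if H: "finite H" "H \<subseteq> I" "H \<noteq> {}" "\<And>i. i \<in> H \<Longrightarrow> finite (K i)" "\<And>i. i \<in> H \<Longrightarrow> K i \<noteq> {}"
      and A: "\<And>i k. i \<in> H \<Longrightarrow> k \<in> K i \<Longrightarrow> A (i, k) \<in> sets borel" for H K and A :: "'i \<times> nat \<Rightarrow> real set"
  proof -
    define B where "B i = {p\<in>space path_space. \<forall>k\<in>K i. p (\<tau> i (Suc k)) - p (\<tau> i k) \<in> A (i, k)}" for i
    have B: "B i \<in> sets path_space" if "i \<in> H" for i
    proof -
      have [measurable]: "(\<lambda>p. p (\<tau> i k)) \<in> borel_measurable path_space" for k
        unfolding path_space_def using \<tau>0[of i k] that H by auto
      have "{p\<in>space path_space. p (\<tau> i (Suc k)) - p (\<tau> i k) \<in> A (i, k)} \<in> sets path_space" if "k \<in> K i" for k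
      proof -
        have "(\<lambda>p. p (\<tau> i (Suc k)) - p (\<tau> i k)) -` A (i, k) \<inter> space path_space \<in> sets path_space"
          by (rule measurable_sets[of _ _ borel]) (use A \<open>i \<in> H\<close> that in auto)
        also have "(\<lambda>p. p (\<tau> i (Suc k)) - p (\<tau> i k)) -` A (i, k) \<inter> space path_space
            = {p\<in>space path_space. p (\<tau> i (Suc k)) - p (\<tau> i k) \<in> A (i, k)}" by auto
        finally show ?thesis .
      qed
      then show ?thesis unfolding B_def
        using H that by (intro sets.sets_Collect_finite_All) auto
    qed
    have eq: "(\<Inter>k\<in>K i. D i k -` A (i, k) \<inter> space M) = sample_path (X i) -` B i \<inter> space M" if "i \<in> H" for i
    proof -
      have "sample_path (X i) \<omega> \<in> space path_space" for \<omega>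
        by (simp add: sample_path_def path_space_def space_PiM)
      moreover have "sample_path (X i) \<omega> (\<tau> i k) = X i (\<tau> i k) \<omega>" for \<omega> k
        using \<tau>0[of i k] that H(2) by (auto simp: sample_path_def)
      ultimately show ?thesis using H(5)[OF that] by (auto simp: D_def B_def)
    qed
    have "prob (\<Inter>i\<in>H. \<Inter>k\<in>K i. D i k -` A (i, k) \<inter> space M) = prob (\<Inter>i\<in>H. sample_path (X i) -` B i \<inter> space M)"
      by (intro arg_cong[of _ _ prob] INF_cong refl eq)
    also have "\<dots> = (\<Prod>i\<in>H. prob (sample_path (X i) -` B i \<inter> space M))"
      by (rule indep_varsD[OF ind]) (use H B in auto)
    also have "\<dots> = (\<Prod>i\<in>H. prob (\<Inter>k\<in>K i. D i k -` A (i, k) \<inter> space M))"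
      by (intro prod.cong refl arg_cong[of _ _ prob] eq[symmetric])
    also have "\<dots> = (\<Prod>i\<in>H. \<Prod>k\<in>K i. prob (D i k -` A (i, k) \<inter> space M))"
      by (intro prod.cong refl indep_varsD[OF indD]) (use H A in auto)
    finally show ?thesis .
  qed
  show ?thesis unfolding indep_vars_def2
  proof (intro conjI ballI indep_setsI)
    fix ik assume "ik \<in> I \<times> (UNIV :: nat set)"
    then show "random_variable borel (case ik of (i, k) \<Rightarrow> \<lambda>\<omega>. X i (\<tau> i (Suc k)) \<omega> - X i (\<tau> i k) \<omega>)"
      using rv by (auto simp: D_def[abs_def])
    then show "{(case ik of (i, k) \<Rightarrow> \<lambda>\<omega>. X i (\<tau> i (Suc k)) \<omega> - X i (\<tau> i k) \<omega>) -` A \<inter> space M |A. A \<in> sets borel} \<subseteq> events"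
      by (auto intro: measurable_sets)
  next
    fix E and G :: "('i \<times> nat) set"
    assume G: "G \<noteq> {}" "G \<subseteq> I \<times> UNIV" "finite G"
      and "\<forall>j\<in>G. E j \<in> {(case j of (i, k) \<Rightarrow> \<lambda>\<omega>. X i (\<tau> i (Suc k)) \<omega> - X i (\<tau> i k) \<omega>) -` A \<inter> space M |A. A \<in> sets borel}"
    then have "\<forall>j\<in>G. \<exists>A. A \<in> sets borel \<and> E j = D (fst j) (snd j) -` A \<inter> space M"
      by (fastforce simp: D_def[abs_def])
    then obtain A where A: "\<And>j. j \<in> G \<Longrightarrow> A j \<in> sets borel" "\<And>j. j \<in> G \<Longrightarrow> E j = D (fst j) (snd j) -` A j \<inter> space M"
      by metis
    define H where "H = fst ` G"
    define K where "K i = {k. (i, k) \<in> G}" for i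
    have GHK: "G = Sigma H K" by (force simp: H_def K_def)
    have fK: "finite (K i)" for i
      using finite_imageI[OF \<open>finite G\<close>, of snd] by (rule rev_finite_subset) (force simp: K_def)
    have "(\<Inter>j\<in>G. E j) = (\<Inter>i\<in>H. \<Inter>k\<in>K i. E (i, k))"
      by (auto simp: GHK)
    also have "\<dots> = (\<Inter>i\<in>H. \<Inter>k\<in>K i. D i k -` A (i, k) \<inter> space M)"
      by (intro INF_cong refl) (use A(2) GHK in auto)
    also have "prob \<dots> = (\<Prod>i\<in>H. \<Prod>k\<in>K i. prob (D i k -` A (i, k) \<inter> space M))"
      using G A(1) fK by (intro factor) (auto simp: H_def K_def)
    also have "\<dots> = (\<Prod>(i, k)\<in>G. prob (D i k -` A (i, k) \<inter> space M))"
      unfolding GHK using G fK by (intro prod.Sigma) (auto simp: H_def)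
    also have "\<dots> = (\<Prod>j\<in>G. prob (E j))"
      by (intro prod.cong) (auto simp: A(2))
    finally show "prob (\<Inter>j\<in>G. E j) = (\<Prod>j\<in>G. prob (E j))" .
  qed
qed

text \<open>Adjoins the initial content to the increments under the index \<open>None\<close>.
  Independence from \<open>V\<close> is given for a whole family \<open>S\<close> of events, which
  enters only through the finite intersections of events of \<open>Z\<close>.\<close>

lemma indep_vars_option:
  fixes V :: "'a \<Rightarrow> real" and Z :: "'k \<Rightarrow> 'a \<Rightarrow> real"
  assumes V: "V \<in> borel_measurable M" and Z: "indep_vars (\<lambda>_. borel) Z I"
    and VS: "indep_set (sets (vimage_algebra (space M) V borel)) S"
    and S: "\<And>G A. finite G \<Longrightarrow> G \<noteq> {} \<Longrightarrow> G \<subseteq> I \<Longrightarrow> (\<And>k. k \<in> G \<Longrightarrow> A k \<in> sets borel) \<Longrightarrow>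
        (\<Inter>k\<in>G. Z k -` A k \<inter> space M) \<in> S"
  shows "indep_vars (\<lambda>_. borel) (case_option V Z) (insert None (Some ` I))"
  unfolding indep_vars_def2
proof (intro conjI ballI indep_setsI)
  fix k assume k: "k \<in> insert None (Some ` I)"
  then show "random_variable borel (case_option V Z k)"
    using V Z by (auto simp: indep_vars_def)
  then show "{case_option V Z k -` A \<inter> space M |A. A \<in> sets borel} \<subseteq> events"
    by (auto intro: measurable_sets)
next
  fix E and G :: "'k option set"
  assume G: "G \<noteq> {}" "G \<subseteq> insert None (Some ` I)" "finite G"
    and "\<forall>j\<in>G. E j \<in> {case_option V Z j -` A \<inter> space M |A. A \<in> sets borel}"
  then have "\<forall>j\<in>G. \<exists>A. A \<in> sets borel \<and> E j = case_option V Z j -` A \<inter> space M" by auto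
  then obtain A where A: "\<And>j. j \<in> G \<Longrightarrow> A j \<in> sets borel" "\<And>j. j \<in> G \<Longrightarrow> E j = case_option V Z j -` A j \<inter> space M"
    by metis
  define H where "H = Some -` G"
  have H: "finite H" "H \<subseteq> I" using G by (auto simp: H_def intro: finite_vimageI)
  have indZ: "prob (\<Inter>k\<in>H. E (Some k)) = (\<Prod>k\<in>H. prob (E (Some k)))" if "H \<noteq> {}"
  proof -
    have "prob (\<Inter>k\<in>H. Z k -` A (Some k) \<inter> space M) = (\<Prod>k\<in>H. prob (Z k -` A (Some k) \<inter> space M))"
      by (rule indep_varsD[OF Z that]) (use H A(1) in \<open>auto simp: H_def\<close>)
    then show ?thesis using A(2) by (simp add: H_def)
  qed
  have inS: "(\<Inter>k\<in>H. E (Some k)) \<in> S" if "H \<noteq> {}"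
  proof -
    have "(\<Inter>k\<in>H. Z k -` A (Some k) \<inter> space M) \<in> S"
      by (rule S) (use H that A(1) in \<open>auto simp: H_def\<close>)
    then show ?thesis using A(2) by (simp add: H_def)
  qed
  show "prob (\<Inter>j\<in>G. E j) = (\<Prod>j\<in>G. prob (E j))"
  proof (cases "None \<in> G")
    case False
    then have "G = Some ` H" using G by (auto simp: H_def)
    then show ?thesis using indZ G by (simp add: prod.reindex)
  next
    case True
    then have GH: "G = insert None (Some ` H)" using G by (auto simp: H_def)
    show ?thesis
    proof (cases "H = {}")
      case True then show ?thesis using GH by simp
    next
      case False
      have "E None \<in> sets (vimage_algebra (space M) V borel)"
        using A[OF \<open>None \<in> G\<close>] by (auto intro: in_vimage_algebra)
      then have "prob (E None \<inter> (\<Inter>k\<in>H. E (Some k))) = prob (E None) * prob (\<Inter>k\<in>H. E (Some k))"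
        by (rule indep_setD[OF VS _ inS[OF False]])
      then show ?thesis using indZ[OF False] GH H by (simp add: prod.reindex)
    qed
  qed
qed

text \<open>The form in which independence is applied later: \<open>F\<close> depends on the past of
  the grid, \<open>G\<close> on the next increment, and \<open>f\<close>, \<open>g\<close> exhibit
  the dependence on disjoint blocks of indices.\<close>

lemma integral_mult_indep_blocks:
  fixes Z :: "'k \<Rightarrow> 'a \<Rightarrow> real" and f g :: "('k \<Rightarrow> real) \<Rightarrow> real"
  assumes Z: "indep_vars (\<lambda>_. borel) Z I" and AB: "A \<inter> B = {}" "A \<subseteq> I" "B \<subseteq> I"
    and f: "f \<in> borel_measurable (Pi\<^sub>M A (\<lambda>_. borel))" and g: "g \<in> borel_measurable (Pi\<^sub>M B (\<lambda>_. borel))"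
    and F: "\<And>\<omega>. \<omega> \<in> space M \<Longrightarrow> F \<omega> = f (\<lambda>k\<in>A. Z k \<omega>)"
    and G: "\<And>\<omega>. \<omega> \<in> space M \<Longrightarrow> G \<omega> = g (\<lambda>k\<in>B. Z k \<omega>)"
    and "integrable M F" "integrable M G"
  shows "(\<integral>\<omega>. F \<omega> * G \<omega> \<partial>M) = (\<integral>\<omega>. F \<omega> \<partial>M) * (\<integral>\<omega>. G \<omega> \<partial>M)" (is ?eq)
    and "integrable M (\<lambda>\<omega>. F \<omega> * G \<omega>)" (is ?int)
proof -
  let ?F = "\<lambda>\<omega>. f (\<lambda>k\<in>A. Z k \<omega>)" and ?G = "\<lambda>\<omega>. g (\<lambda>k\<in>B. Z k \<omega>)"
  have ind: "indep_var borel ?F borel ?G"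
    using indep_var_compose[OF indep_var_restrict[OF Z AB] f g] by (simp add: comp_def)
  have int: "integrable M ?F" "integrable M ?G"
    using assms(9,10) by (simp_all add: F G cong: Bochner_Integration.integrable_cong)
  show ?eq using indep_var_lebesgue_integral[OF ind int]
    by (simp add: F G cong: Bochner_Integration.integral_cong)
  show ?int using indep_var_integrable[OF ind int]
    by (simp add: F G cong: Bochner_Integration.integrable_cong)
qed

end

section \<open>The waiting time given the content in front\<close>

locale subordinator_family = prob_space M for M :: "'a measure" +
  fixes I :: "nat set" and X :: "nat \<Rightarrow> real \<Rightarrow> 'a \<Rightarrow> real"
  assumes finite_I: "finite I"
    and subordinator_X: "\<And>i. i \<in> I \<Longrightarrow> subordinator M (X i)"
    and indep_X: "indep_vars (\<lambda>_. path_space) (\<lambda>i. sample_path (X i)) I"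
begin

lemma subordinator_process: "i \<in> I \<Longrightarrow> subordinator_process M (X i)"
  by unfold_locales (rule subordinator_X)

text \<open>Serves twice: with the overtaking fractions as \<open>a\<close> it is the overtaking
  input, with the constant 1 the total input of the queue.\<close>

definition total :: "(nat \<Rightarrow> real) \<Rightarrow> real \<Rightarrow> 'a \<Rightarrow> real" where
  "total a t \<omega> = (\<Sum>i\<in>I. X i (a i * t) \<omega>)"

definition exponent :: "(nat \<Rightarrow> real) \<Rightarrow> real \<Rightarrow> real" where
  "exponent a \<beta> = (\<Sum>i\<in>I. a i * laplace_exponent M (X i) \<beta>)"

definition incr :: "(nat \<Rightarrow> real) \<Rightarrow> real \<Rightarrow> nat \<Rightarrow> nat \<Rightarrow> 'a \<Rightarrow> real" where
  "incr a h i k \<omega> = X i (a i * (real (Suc k) * h)) \<omega> - X i (a i * (real k * h)) \<omega>"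

definition total_incr :: "(nat \<Rightarrow> real) \<Rightarrow> real \<Rightarrow> nat \<Rightarrow> 'a \<Rightarrow> real" where
  "total_incr a h k \<omega> = (\<Sum>i\<in>I. incr a h i k \<omega>)"

context
  fixes a :: "nat \<Rightarrow> real" assumes a_nn: "\<forall>i\<in>I. 0 \<le> a i"
begin

lemmas a_ge_0 = bspec[OF a_nn]

lemma measurable_total [measurable (raw)]: "0 \<le> t \<Longrightarrow> total a t \<in> borel_measurable M"
  unfolding total_def[abs_def]
  by (intro borel_measurable_sum subordinator_process.measurable_X subordinator_process) (auto simp: a_ge_0)

lemma total_0: "\<omega> \<in> space M \<Longrightarrow> total a 0 \<omega> = 0"
  by (simp add: total_def subordinator_process.X_0[OF subordinator_process])

lemma total_mono: "\<omega> \<in> space M \<Longrightarrow> 0 \<le> s \<Longrightarrow> s \<le> t \<Longrightarrow> total a s \<omega> \<le> total a t \<omega>"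
  unfolding total_def
  by (rule sum_mono, rule subordinator_process.X_mono[OF subordinator_process]) (auto simp: a_ge_0 mult_left_mono)

lemma total_nonneg: "\<omega> \<in> space M \<Longrightarrow> 0 \<le> t \<Longrightarrow> 0 \<le> total a t \<omega>"
  using total_mono[of \<omega> 0 t] total_0[of \<omega>] by simp

lemma total_right_cont:
  assumes "\<omega> \<in> space M" "0 \<le> t"
  shows "((\<lambda>u. total a u \<omega>) \<longlongrightarrow> total a t \<omega>) (at_right t)"
  unfolding total_def
proof (rule tendsto_sum)
  fix i assume i: "i \<in> I"
  show "((\<lambda>u. X i (a i * u) \<omega>) \<longlongrightarrow> X i (a i * t) \<omega>) (at_right t)"
  \<comment> \<open>A clock of speed 0 stands still and does not approach its limit from the right,
    so it is treated separately.\<close>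
  proof (cases "a i = 0")
    case False
    then have "0 < a i" using a_ge_0[OF i] by simp
    then have "filterlim (\<lambda>u. a i * u) (at_right (a i * t)) (at_right t)"
      unfolding filterlim_at
      by (auto intro!: tendsto_eq_intros simp: eventually_at_filter)
    moreover have "((\<lambda>u. X i u \<omega>) \<longlongrightarrow> X i (a i * t) \<omega>) (at_right (a i * t))"
      using subordinator_process.X_right_cont[OF subordinator_process[OF i] assms(1)] a_ge_0[OF i] assms(2)
      by (simp add: continuous_within)
    ultimately show ?thesis by (rule filterlim_compose[rotated])
  qed simp
qed

lemma total_Suc: "total a (real (Suc k) * h) \<omega> = total a (real k * h) \<omega> + total_incr a h k \<omega>"
  by (simp add: total_def total_incr_def incr_def sum_subtractf)

lemma total_eq_sum:
  "\<omega> \<in> space M \<Longrightarrow> total a (real k * h) \<omega> = (\<Sum>j<k. total_incr a h j \<omega>)"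
  by (induction k) (use total_Suc in \<open>auto simp: total_0\<close>)

lemma indep_incr:
  assumes "0 \<le> h"
  shows "indep_vars (\<lambda>_. borel) (\<lambda>(i, k). incr a h i k) (I \<times> UNIV)"
  using indep_vars_sections[OF subordinator_X indep_X, of "\<lambda>i k. a i * (real k * h)"] a_ge_0 assms
  by (simp add: incr_def[abs_def] mono_def mult_left_mono mult_right_mono case_prod_beta')

lemma laplace_total_incr:
  assumes h: "0 \<le> h" and \<beta>: "0 \<le> \<beta>"
  shows "(\<integral>\<omega>. exp (- \<beta> * total_incr a h k \<omega>) \<partial>M) = exp (- h * exponent a \<beta>)"
    and "integrable M (\<lambda>\<omega>. exp (- \<beta> * total_incr a h k \<omega>))"
proof -
  let ?E = "\<lambda>i \<omega>. exp (- \<beta> * incr a h i k \<omega>)"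
  have "indep_vars (\<lambda>_. borel) (\<lambda>ik. case ik of (i, k) \<Rightarrow> incr a h i k) (I \<times> {k})"
    by (rule indep_vars_subset[OF indep_incr[OF h]]) auto
  then have "indep_vars (\<lambda>_. borel) (\<lambda>ik \<omega>. exp (- \<beta> * (case ik of (i, k) \<Rightarrow> incr a h i k) \<omega>)) (I \<times> {k})"
    by (rule indep_vars_compose2) simp
  then have ind: "indep_vars (\<lambda>_. borel) (\<lambda>ik. ?E (fst ik)) (I \<times> {k})"
    by (subst indep_vars_cong[OF refl _ refl]) (auto simp: fun_eq_iff)
  have one: "(\<integral>\<omega>. ?E i \<omega> \<partial>M) = exp (- h * (a i * laplace_exponent M (X i) \<beta>)) \<and> integrable M (?E i)" if i: "i \<in> I" for i
  proof -
    interpret subordinator_process M "X i" by (rule subordinator_process[OF i])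
    have nn: "0 \<le> a i * (real k * h)" "0 \<le> a i * h" using a_ge_0[OF i] h by auto
    have eq: "a i * (real (Suc k) * h) = a i * (real k * h) + a i * h" by (simp add: algebra_simps)
    show ?thesis
      using integral_increment[OF nn, of "\<lambda>x. exp (- \<beta> * x)"] integrable_increment[OF nn, of "\<lambda>x. exp (- \<beta> * x)"]
        laplace_transform[OF \<beta> nn(2)] integrable_exp[OF \<beta> nn(2)]
      unfolding incr_def eq by (simp add: mult_ac)
  qed
  have eq: "exp (- \<beta> * total_incr a h k \<omega>) = (\<Prod>ik\<in>I \<times> {k}. ?E (fst ik) \<omega>)" for \<omega>
  proof -
    have "exp (- \<beta> * total_incr a h k \<omega>) = (\<Prod>i\<in>I. ?E i \<omega>)"
      by (simp add: total_incr_def sum_distrib_left exp_sum finite_I sum_negf[symmetric])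
    also have "\<dots> = (\<Prod>ik\<in>I \<times> {k}. ?E (fst ik) \<omega>)"
      using prod.cartesian_product'[of "\<lambda>ik. ?E (fst ik) \<omega>" I "{k}"] by simp
    finally show ?thesis .
  qed
  have "(\<integral>\<omega>. (\<Prod>ik\<in>I \<times> {k}. ?E (fst ik) \<omega>) \<partial>M) = (\<Prod>ik\<in>I \<times> {k}. \<integral>\<omega>. ?E (fst ik) \<omega> \<partial>M)"
    by (rule indep_vars_lebesgue_integral) (use ind one finite_I in auto)
  also have "\<dots> = (\<Prod>i\<in>I. exp (- h * (a i * laplace_exponent M (X i) \<beta>)))"
    using prod.cartesian_product'[of "\<lambda>ik. \<integral>\<omega>. ?E (fst ik) \<omega> \<partial>M" I "{k}"] one by simp
  also have "\<dots> = exp (- h * exponent a \<beta>)"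
    by (simp add: exponent_def sum_distrib_left exp_sum finite_I sum_negf[symmetric])
  finally show "(\<integral>\<omega>. exp (- \<beta> * total_incr a h k \<omega>) \<partial>M) = exp (- h * exponent a \<beta>)"
    unfolding eq .
  show "integrable M (\<lambda>\<omega>. exp (- \<beta> * total_incr a h k \<omega>))"
    unfolding eq by (rule indep_vars_integrable) (use ind one finite_I in auto)
qed

lemma laplace_total:
  assumes "0 \<le> h" "0 \<le> \<beta>"
  shows "(\<integral>\<omega>. exp (- \<beta> * total a h \<omega>) \<partial>M) = exp (- h * exponent a \<beta>)"
proof -
  have "(\<integral>\<omega>. exp (- \<beta> * total a h \<omega>) \<partial>M) = (\<integral>\<omega>. exp (- \<beta> * total_incr a h 0 \<omega>) \<partial>M)"
    using total_Suc[of 0 h] by (intro Bochner_Integration.integral_cong) (auto simp: total_0)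
  then show ?thesis by (simp only: laplace_total_incr(1)[OF assms])
qed

end
end

text \<open>Holds because \<open>V\<close> is finite. It turns a lower bound by transforms with
  small parameter into a lower bound by the total mass.\<close>

lemma (in prob_space) integral_exp_tendsto_1:
  fixes V :: "'a \<Rightarrow> real"
  assumes [measurable]: "V \<in> borel_measurable M" and V: "\<And>\<omega>. \<omega> \<in> space M \<Longrightarrow> 0 \<le> V \<omega>"
  shows "(\<lambda>n. \<integral>\<omega>. exp (- (1 / real (Suc n)) * V \<omega>) \<partial>M) \<longlonglongrightarrow> 1"
proof -
  have "(\<lambda>n. \<integral>\<omega>. exp (- (1 / real (Suc n)) * V \<omega>) \<partial>M) \<longlonglongrightarrow> (\<integral>\<omega>. 1 \<partial>M)"
  proof (rule integral_dominated_convergence[where w="\<lambda>_. 1"])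
    show "AE \<omega> in M. (\<lambda>n. exp (- (1 / real (Suc n)) * V \<omega>)) \<longlonglongrightarrow> 1"
    proof (rule AE_I2)
      fix \<omega>
      have "(\<lambda>n. - (1 / real (Suc n)) * V \<omega>) \<longlonglongrightarrow> 0" by real_asymp
      from tendsto_exp[OF this] show "(\<lambda>n. exp (- (1 / real (Suc n)) * V \<omega>)) \<longlonglongrightarrow> 1" by simp
    qed
  qed (auto simp: V)
  then show ?thesis by (simp add: prob_space)
qed

text \<open>The assumption \<open>exponent_less\<close> says that \<open>\<phi>\<^sub>a\<close> is
  positive on the positive axis. It makes \<alpha> a genuine discount rate, so that paths not yet
  stopped contribute nothing in the limit.\<close>

locale tagged_particle = subordinator_family M I K
  for M :: "'a measure" and I :: "nat set" and K :: "nat \<Rightarrow> real \<Rightarrow> 'a \<Rightarrow> real" +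
  fixes a :: "nat \<Rightarrow> real" and V :: "'a \<Rightarrow> real"
  assumes a_nonneg: "\<forall>i\<in>I. 0 \<le> a i"
    and V_measurable [measurable]: "V \<in> borel_measurable M"
    and V_nonneg: "\<And>\<omega>. \<omega> \<in> space M \<Longrightarrow> 0 \<le> V \<omega>"
    and V_indep: "indep_set (sets (vimage_algebra (space M) V borel))
      (sets (vimage_algebra (space M) (\<lambda>\<omega>. \<lambda>i\<in>I. sample_path (K i) \<omega>) (Pi\<^sub>M I (\<lambda>_. path_space))))"
    and exponent_less: "\<And>\<beta>. 0 < \<beta> \<Longrightarrow> exponent a \<beta> < \<beta>"
begin

abbreviation A :: "real \<Rightarrow> 'a \<Rightarrow> real" where "A \<equiv> total a"
abbreviation D :: "real \<Rightarrow> nat \<Rightarrow> 'a \<Rightarrow> real" where "D \<equiv> total_incr a"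
text \<open>Index \<open>None\<close> carries the content, \<open>Some (i, k)\<close> the increment
  of process \<open>i\<close> in cell \<open>k\<close>; the state at a grid point is thus a function
  of one finite block.\<close>

abbreviation Z :: "real \<Rightarrow> (nat \<times> nat) option \<Rightarrow> 'a \<Rightarrow> real" where
  "Z h \<equiv> case_option V (\<lambda>(i, k). incr a h i k)"

lemmas [measurable (raw)] = measurable_total[OF a_nonneg]

lemma indep_Z:
  assumes h: "0 \<le> h"
  shows "indep_vars (\<lambda>_. borel) (Z h) (insert None (Some ` (I \<times> UNIV)))"
proof (rule indep_vars_option[OF V_measurable indep_incr[OF a_nonneg h] V_indep])
  let ?f = "\<lambda>\<omega>. \<lambda>i\<in>I. sample_path (K i) \<omega>"
  let ?P = "Pi\<^sub>M I (\<lambda>_. path_space)"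
  let ?Q = "vimage_algebra (space M) ?f ?P"
  fix G :: "(nat \<times> nat) set" and B :: "nat \<times> nat \<Rightarrow> real set"
  assume G: "finite G" "G \<noteq> {}" "G \<subseteq> I \<times> UNIV" and B: "\<And>k. k \<in> G \<Longrightarrow> B k \<in> sets borel"
  have f: "?f \<in> measurable ?Q ?P"
    by (rule measurable_vimage_algebra1) (auto simp: space_PiM path_space_def sample_path_def)
  show "(\<Inter>k\<in>G. (case k of (i, k) \<Rightarrow> incr a h i k) -` B k \<inter> space M) \<in> sets ?Q"
  proof (rule sets.finite_INT[OF \<open>finite G\<close> \<open>G \<noteq> {}\<close>])
    fix ik assume ik: "ik \<in> G"
    obtain i k where [simp]: "ik = (i, k)" by (cases ik)
    have i: "i \<in> I" using ik G by auto
    have ev: "(\<lambda>\<omega>. K i s \<omega>) \<in> borel_measurable ?Q" if "0 \<le> s" for s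
    proof -
      have "(\<lambda>p. p i s) \<in> borel_measurable ?P"
        by (rule measurable_compose[OF measurable_component_singleton[OF i]])
          (use that in \<open>auto simp: path_space_def\<close>)
      from measurable_compose[OF f this] show ?thesis using i that by (simp add: sample_path_def)
    qed
    have "incr a h i k \<in> borel_measurable ?Q"
      unfolding incr_def[abs_def] using bspec[OF a_nonneg i] h by (intro borel_measurable_diff ev) auto
    from measurable_sets[OF this B[OF ik]]
    show "(case ik of (i, k) \<Rightarrow> incr a h i k) -` B ik \<inter> space M \<in> sets ?Q" by simp
  qed
qed

section \<open>Stopping the exponential martingale at a grid point\<close>

abbreviation reached :: "('a \<Rightarrow> real) \<Rightarrow> real \<Rightarrow> nat \<Rightarrow> 'a \<Rightarrow> bool" where
  "reached v h k \<omega> \<equiv> v \<omega> + A (real k * h) \<omega> \<le> real k * h"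

definition alive :: "('a \<Rightarrow> real) \<Rightarrow> real \<Rightarrow> nat \<Rightarrow> 'a \<Rightarrow> bool" where
  "alive v h n \<omega> \<longleftrightarrow> (\<forall>j\<le>n. v \<omega> + A (real j * h) \<omega> > real j * h)"

definition hit :: "('a \<Rightarrow> real) \<Rightarrow> real \<Rightarrow> 'a \<Rightarrow> nat" where
  "hit v h \<omega> = (LEAST k. reached v h k \<omega>)"

text \<open>Cancelling \<beta> t in the exponent leaves - \<beta> (v + A t) + t
  \<open>exponent a \<beta>\<close>, which shows the martingale. The form chosen separates the
  discount exp (- \<alpha> t) from the distance of v + A t - t to its target 0.\<close>

definition expmart :: "('a \<Rightarrow> real) \<Rightarrow> real \<Rightarrow> real \<Rightarrow> nat \<Rightarrow> 'a \<Rightarrow> real" where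
  "expmart v h \<beta> n \<omega> = exp (- \<beta> * (v \<omega> + A (real n * h) \<omega> - real n * h) - (\<beta> - exponent a \<beta>) * (real n * h))"

lemma expmart_Suc: "expmart v h \<beta> (Suc n) \<omega> = expmart v h \<beta> n \<omega> * exp (- \<beta> * D h n \<omega>) * exp (h * exponent a \<beta>)"
  by (simp add: expmart_def total_Suc[OF a_nonneg] exp_add[symmetric] del: of_nat_Suc) (simp add: algebra_simps)

lemma not_alive_iff: "\<not> alive v h n \<omega> \<longleftrightarrow> (\<exists>j\<le>n. reached v h j \<omega>)"
  by (auto simp: alive_def not_less)

lemma hit_properties:
  assumes "reached v h k \<omega>"
  shows "v \<omega> + A (real (hit v h \<omega>) * h) \<omega> \<le> real (hit v h \<omega>) * h" "hit v h \<omega> \<le> k"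
    "j < hit v h \<omega> \<Longrightarrow> real j * h < v \<omega> + A (real j * h) \<omega>"
  using LeastI[of "\<lambda>k. reached v h k \<omega>", OF assms]
    Least_le[of "\<lambda>k. reached v h k \<omega>", OF assms]
    not_less_Least[of j "\<lambda>k. reached v h k \<omega>"]
  by (auto simp: hit_def)

abbreviation expalive :: "('a \<Rightarrow> real) \<Rightarrow> real \<Rightarrow> real \<Rightarrow> nat \<Rightarrow> 'a \<Rightarrow> real" where
  "expalive v h \<beta> n \<omega> \<equiv> if alive v h n \<omega> then expmart v h \<beta> n \<omega> else 0"

definition stopped :: "('a \<Rightarrow> real) \<Rightarrow> real \<Rightarrow> real \<Rightarrow> nat \<Rightarrow> 'a \<Rightarrow> real" where
  "stopped v h \<beta> n \<omega> = (if alive v h n \<omega> then expmart v h \<beta> n \<omega> else expmart v h \<beta> (hit v h \<omega>) \<omega>)"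

text \<open>The value 0 stands for the discount at an infinite hitting time; \<open>hit\<close> has
  no meaning on such paths.\<close>

definition killed :: "('a \<Rightarrow> real) \<Rightarrow> real \<Rightarrow> real \<Rightarrow> 'a \<Rightarrow> real" where
  "killed v h \<beta> \<omega> = (if \<exists>k. reached v h k \<omega>
    then exp (- (\<beta> - exponent a \<beta>) * (real (hit v h \<omega>) * h)) else 0)"

text \<open>Two instances of \<open>r\<close> occur later: the identity, for the lower bound on the
  transform of the waiting time, and the shift x \<mapsto> max (x - h) 0, for the upper bound. Being
  a function of \<open>V\<close>, the variable \<open>v\<close> stays in the block of index
  \<open>None\<close>.\<close>

context
  fixes h \<beta> :: real and r :: "real \<Rightarrow> real" and v :: "'a \<Rightarrow> real"
  assumes h: "0 < h" and \<beta>: "0 < \<beta>" and r [measurable]: "r \<in> borel_measurable borel"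
    and v_def: "v = (\<lambda>\<omega>. r (V \<omega>))" and v_nn: "\<forall>\<omega>\<in>space M. 0 \<le> v \<omega>"
begin

lemmas v_nonneg = bspec[OF v_nn]

lemma v_measurable [measurable]: "v \<in> borel_measurable M"
  by (simp add: v_def)

lemma measurable_A_grid [measurable]: "A (real n * h) \<in> borel_measurable M"
  using h by (intro measurable_total a_nonneg) auto

lemma measurable_alive [measurable]: "Measurable.pred M (alive v h n)"
  unfolding alive_def[abs_def] by measurable

lemma measurable_hit [measurable]: "hit v h \<in> measurable M (count_space UNIV)"
  unfolding hit_def[abs_def] by measurable

lemma measurable_expmart [measurable]: "expmart v h \<beta> n \<in> borel_measurable M"
  unfolding expmart_def[abs_def] by measurable

abbreviation "\<alpha> \<equiv> \<beta> - exponent a \<beta>"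

lemma \<alpha>_pos: "0 < \<alpha>" using exponent_less[OF \<beta>] by simp

lemma expmart_le_alive:
  assumes "alive v h n \<omega>"
  shows "expmart v h \<beta> n \<omega> \<le> exp (- \<alpha> * (real n * h))"
proof -
  have "0 \<le> \<beta> * (v \<omega> + A (real n * h) \<omega> - real n * h)"
    using assms \<beta> by (intro mult_nonneg_nonneg) (auto simp: alive_def less_imp_le)
  then show ?thesis unfolding expmart_def by (subst exp_le_cancel_iff) linarith
qed

text \<open>Survival up to \<open>n\<close> and the martingale at \<open>n\<close> are functions of
  the content and of the increments in cells before \<open>n\<close>; \<open>f\<close> rebuilds both
  from this block. The increment in cell \<open>n\<close> is independent of it.\<close>

lemma expectation_expmart_alive:
  "(\<integral>\<omega>. expalive v h \<beta> n \<omega> * exp (- \<beta> * D h n \<omega>) \<partial>M)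
    = (\<integral>\<omega>. expalive v h \<beta> n \<omega> \<partial>M) * exp (- h * exponent a \<beta>)" (is ?eq)
  "integrable M (\<lambda>\<omega>. expalive v h \<beta> n \<omega> * exp (- \<beta> * D h n \<omega>))" (is ?int)
  "integrable M (\<lambda>\<omega>. expalive v h \<beta> n \<omega>)" (is ?intA)
proof -
  define S where "S z j = (\<Sum>l<j. \<Sum>i\<in>I. z (Some (i, l)))" for z :: "(nat \<times> nat) option \<Rightarrow> real" and j
  define f where "f z = (if \<forall>j\<le>n. real j * h < r (z None) + S z j then
      exp (- \<beta> * (r (z None) + S z n - real n * h) - (\<beta> - exponent a \<beta>) * (real n * h)) else 0)"
    for z :: "(nat \<times> nat) option \<Rightarrow> real"
  define g where "g z = exp (- \<beta> * (\<Sum>i\<in>I. z (Some (i, n))))" for z :: "(nat \<times> nat) option \<Rightarrow> real"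
  let ?A = "insert None (Some ` (I \<times> {..<n}))" and ?B = "Some ` (I \<times> {n})"
  have A_eq: "A (real j * h) \<omega> = S (\<lambda>k\<in>?A. Z h k \<omega>) j" if "\<omega> \<in> space M" "j \<le> n" for \<omega> j
    unfolding total_eq_sum[OF a_nonneg that(1)] S_def total_incr_def
    using that by (intro sum.cong refl) auto
  have "(\<lambda>z. S z j) \<in> borel_measurable (Pi\<^sub>M ?A (\<lambda>_. borel))" if "j \<le> n" for j
    unfolding S_def by (intro borel_measurable_sum measurable_component_singleton) (use that in auto)
  note [measurable] = this
  have [measurable]: "(\<lambda>z. z None) \<in> borel_measurable (Pi\<^sub>M ?A (\<lambda>_. borel))"
    by (rule measurable_component_singleton) auto
  have f: "f \<in> borel_measurable (Pi\<^sub>M ?A (\<lambda>_. borel))"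
    unfolding f_def[abs_def] by measurable
  have g: "g \<in> borel_measurable (Pi\<^sub>M ?B (\<lambda>_. borel))"
    unfolding g_def[abs_def]
    by (intro borel_measurable_exp borel_measurable_times borel_measurable_const borel_measurable_sum
        measurable_component_singleton measurable_compose[OF _ borel_measurable_exp]) auto
  have "0 \<le> \<alpha> * (real n * h)" using \<alpha>_pos h by (intro mult_nonneg_nonneg) auto
  then have "exp (- \<alpha> * (real n * h)) \<le> 1" unfolding mult_minus_left by simp
  then have le1: "expmart v h \<beta> n \<omega> \<le> 1" if "alive v h n \<omega>" for \<omega>
    using expmart_le_alive[OF that] by (rule order_trans[rotated])
  have nn: "0 \<le> expmart v h \<beta> n \<omega>" for \<omega> by (simp add: expmart_def)
  show int0: ?intA
    by (rule integrable_const_bound[of _ 1]) (use le1 nn in auto)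
  note * = integral_mult_indep_blocks[OF indep_Z[OF less_imp_le[OF h]] _ _ _ f g _ _ int0
      laplace_total_incr(2)[OF a_nonneg less_imp_le[OF h] less_imp_le[OF \<beta>]]]
  have F: "expalive v h \<beta> n \<omega> = f (\<lambda>k\<in>?A. Z h k \<omega>)" if "\<omega> \<in> space M" for \<omega>
    using A_eq[OF that] by (simp add: f_def alive_def expmart_def v_def)
  have G: "exp (- \<beta> * D h n \<omega>) = g (\<lambda>k\<in>?B. Z h k \<omega>)" for \<omega>
    by (simp add: g_def total_incr_def)
  show ?eq using *(1)[OF _ _ _ F G] laplace_total_incr(1)[OF a_nonneg less_imp_le[OF h] less_imp_le[OF \<beta>]] by auto
  show ?int by (rule *(2)[OF _ _ _ F G]) auto
qed

lemma stopped_0: "\<omega> \<in> space M \<Longrightarrow> stopped v h \<beta> 0 \<omega> = exp (- \<beta> * v \<omega>)"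
  using hit_properties(2)[of v \<omega> 0 h]
  by (auto simp: stopped_def not_alive_iff expmart_def total_0[OF a_nonneg])

text \<open>The stopped process moves only on survival. A path alive at \<open>n\<close> but not at
  \<open>n + 1\<close> has hitting index exactly \<open>n + 1\<close>, so in both cases the new
  value is the martingale at \<open>n + 1\<close>.\<close>

lemma stopped_Suc:
  "stopped v h \<beta> (Suc n) \<omega> = stopped v h \<beta> n \<omega> +
    expalive v h \<beta> n \<omega> * exp (- \<beta> * D h n \<omega>) * exp (h * exponent a \<beta>) -
    expalive v h \<beta> n \<omega>"
proof (cases "alive v h n \<omega>")
  case False
  then have "\<not> alive v h (Suc n) \<omega>" unfolding alive_def using le_SucI by blast
  then show ?thesis using False by (simp add: stopped_def)
next
  case True
  have "stopped v h \<beta> (Suc n) \<omega> = expmart v h \<beta> (Suc n) \<omega>"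
  proof (cases "alive v h (Suc n) \<omega>")
    case False
    then obtain k where k: "k \<le> Suc n" "reached v h k \<omega>"
      by (auto simp: not_alive_iff)
    have "hit v h \<omega> \<le> Suc n" using hit_properties(2)[of v \<omega> k h, OF k(2)] k(1) by simp
    moreover have "\<not> hit v h \<omega> \<le> n"
      using hit_properties(1)[of v \<omega> k h, OF k(2)] True by (force simp: alive_def)
    ultimately have "hit v h \<omega> = Suc n" by simp
    then show ?thesis using False by (simp add: stopped_def)
  qed (simp add: stopped_def)
  then show ?thesis using True by (simp add: stopped_def expmart_Suc)
qed

lemma expectation_stopped:
  "integrable M (stopped v h \<beta> n) \<and> (\<integral>\<omega>. stopped v h \<beta> n \<omega> \<partial>M) = (\<integral>\<omega>. exp (- \<beta> * v \<omega>) \<partial>M)"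
proof (induction n)
  case 0
  have "integrable M (\<lambda>\<omega>. exp (- \<beta> * v \<omega>))"
    by (rule integrable_const_bound[of _ 1]) (use v_nonneg \<beta> in \<open>auto intro!: AE_I2\<close>)
  then show ?case
    by (simp add: stopped_0 cong: Bochner_Integration.integral_cong Bochner_Integration.integrable_cong)
next
  case (Suc n)
  note E = expectation_expmart_alive[of n]
  have "(\<integral>\<omega>. stopped v h \<beta> (Suc n) \<omega> \<partial>M) = (\<integral>\<omega>. stopped v h \<beta> n \<omega> \<partial>M) +
      (\<integral>\<omega>. expalive v h \<beta> n \<omega> * exp (- \<beta> * D h n \<omega>) \<partial>M) * exp (h * exponent a \<beta>) -
      (\<integral>\<omega>. expalive v h \<beta> n \<omega> \<partial>M)"
    unfolding stopped_Suc using E Suc by simp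
  \<comment> \<open>The compensating factor of \<open>expmart_Suc\<close> cancels the mean of the
    new increment, so the two added terms cancel each other.\<close>
  also have "\<dots> = (\<integral>\<omega>. exp (- \<beta> * v \<omega>) \<partial>M)"
    unfolding E(1) using Suc by (simp add: mult.assoc exp_add[symmetric])
  finally show ?case
    unfolding stopped_Suc[abs_def] using E Suc by simp
qed

lemma measurable_killed [measurable]: "killed v h \<beta> \<in> borel_measurable M"
  unfolding killed_def[abs_def] by measurable

lemma killed_le_1: "0 \<le> killed v h \<beta> \<omega>" "killed v h \<beta> \<omega> \<le> 1"
  using mult_nonneg_nonneg[OF less_imp_le[OF \<alpha>_pos], of "real (hit v h \<omega>) * h"] h
  by (auto simp: killed_def simp del: minus_diff_eq mult_minus_left)

lemma integrable_killed: "integrable M (killed v h \<beta>)"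
  by (rule integrable_const_bound[of _ 1]) (use killed_le_1 in auto)

text \<open>Over one cell v + A t - t falls by at most \<open>h\<close>, since \<open>A\<close> is
  nondecreasing. At the hitting point it therefore lies between - h and 0, and martingale and
  discount differ by a factor between 1 and exp (\<beta> h).\<close>

lemma expmart_hit_bounds:
  assumes \<omega>: "\<omega> \<in> space M" and dead: "\<not> alive v h n \<omega>"
  shows "killed v h \<beta> \<omega> \<le> expmart v h \<beta> (hit v h \<omega>) \<omega>"
    "expmart v h \<beta> (hit v h \<omega>) \<omega> \<le> exp (\<beta> * h) * killed v h \<beta> \<omega>"
proof -
  obtain k where k: "reached v h k \<omega>"
    using dead by (auto simp: not_alive_iff)
  define \<tau> where "\<tau> = hit v h \<omega>"
  define x where "x = v \<omega> + A (real \<tau> * h) \<omega> - real \<tau> * h"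
  have x0: "x \<le> 0" using hit_properties(1)[of v \<omega> k h, OF k] by (simp add: x_def \<tau>_def)
  have xh: "- h \<le> x"
  proof (cases \<tau>)
    case 0
    then show ?thesis using h v_nonneg[OF \<omega>] total_0[OF a_nonneg \<omega>] by (simp add: x_def)
  next
    case (Suc j)
    have "real j * h < v \<omega> + A (real j * h) \<omega>"
      using hit_properties(3)[of v \<omega> k h j, OF k] Suc by (simp add: \<tau>_def)
    also have "\<dots> \<le> v \<omega> + A (real \<tau> * h) \<omega>"
      using h Suc by (intro add_left_mono total_mono a_nonneg \<omega>) auto
    finally show ?thesis using Suc by (simp add: x_def algebra_simps)
  qed
  have kd: "killed v h \<beta> \<omega> = exp (- \<alpha> * (real \<tau> * h))" using k by (auto simp: killed_def \<tau>_def)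
  have U: "expmart v h \<beta> (hit v h \<omega>) \<omega> = exp (- \<beta> * x) * killed v h \<beta> \<omega>"
    unfolding expmart_def kd exp_add[symmetric] x_def \<tau>_def by (rule arg_cong[of _ _ exp]) (simp add: algebra_simps)
  have "0 \<le> - \<beta> * x" "- \<beta> * x \<le> \<beta> * h"
    using \<beta> x0 mult_left_mono[OF xh, of \<beta>] by (auto simp: mult_nonneg_nonpos)
  then show "killed v h \<beta> \<omega> \<le> expmart v h \<beta> (hit v h \<omega>) \<omega>"
    "expmart v h \<beta> (hit v h \<omega>) \<omega> \<le> exp (\<beta> * h) * killed v h \<beta> \<omega>"
    unfolding U using killed_le_1(1)[of \<omega>] mult_right_mono[of 1 "exp (- \<beta> * x)" "killed v h \<beta> \<omega>"]
    by (auto intro!: mult_right_mono)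
qed

text \<open>The mean of \<open>stopped\<close> is constant in \<open>n\<close>. On stopped paths it
  is compared with \<open>killed\<close> by \<open>expmart_hit_bounds\<close>; on surviving paths it
  is at most exp (- \<alpha> n h), which vanishes as \<open>n\<close> grows.\<close>

lemma expectation_killed:
  "(\<integral>\<omega>. killed v h \<beta> \<omega> \<partial>M) \<le> (\<integral>\<omega>. exp (- \<beta> * v \<omega>) \<partial>M)"
  "(\<integral>\<omega>. exp (- \<beta> * v \<omega>) \<partial>M) \<le> exp (\<beta> * h) * (\<integral>\<omega>. killed v h \<beta> \<omega> \<partial>M)"
proof -
  let ?Y = "\<lambda>n \<omega>. if alive v h n \<omega> then 0 else killed v h \<beta> \<omega>"
  have intY: "integrable M (?Y n)" for n
    by (rule integrable_const_bound[of _ 1]) (use killed_le_1 in auto)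
  have lim: "(\<lambda>n. \<integral>\<omega>. ?Y n \<omega> \<partial>M) \<longlonglongrightarrow> (\<integral>\<omega>. killed v h \<beta> \<omega> \<partial>M)"
  proof (rule integral_dominated_convergence[where w="\<lambda>_. 1"])
    show "AE \<omega> in M. (\<lambda>n. ?Y n \<omega>) \<longlonglongrightarrow> killed v h \<beta> \<omega>"
    proof (rule AE_I2)
      fix \<omega>
      show "(\<lambda>n. ?Y n \<omega>) \<longlonglongrightarrow> killed v h \<beta> \<omega>"
      proof (cases "\<exists>k. reached v h k \<omega>")
        case True
        then obtain k where "reached v h k \<omega>" by auto
        then have "?Y n \<omega> = killed v h \<beta> \<omega>" if "n \<ge> k" for n
          using that by (auto simp: alive_def not_less)
        then show ?thesis by (intro tendsto_eventually eventually_sequentiallyI[of k])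
      next
        case False
        then have "?Y n \<omega> = killed v h \<beta> \<omega>" for n by (auto simp: killed_def)
        then show ?thesis by simp
      qed
    qed
  qed (use killed_le_1 in auto)
  have st: "(\<integral>\<omega>. exp (- \<beta> * v \<omega>) \<partial>M) = (\<integral>\<omega>. stopped v h \<beta> n \<omega> \<partial>M)" "integrable M (stopped v h \<beta> n)" for n
    using expectation_stopped[of n] by auto
  have "(\<integral>\<omega>. ?Y n \<omega> \<partial>M) \<le> (\<integral>\<omega>. exp (- \<beta> * v \<omega>) \<partial>M)" for n
    unfolding st(1)[of n]
    by (rule integral_mono[OF intY st(2)]) (use expmart_hit_bounds(1) in \<open>auto simp: stopped_def expmart_def\<close>)
  then show "(\<integral>\<omega>. killed v h \<beta> \<omega> \<partial>M) \<le> (\<integral>\<omega>. exp (- \<beta> * v \<omega>) \<partial>M)"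
    by (intro tendsto_upperbound[OF lim]) auto
  have "(\<integral>\<omega>. exp (- \<beta> * v \<omega>) \<partial>M) \<le> exp (\<beta> * h) * (\<integral>\<omega>. ?Y n \<omega> \<partial>M) + exp (- \<alpha> * (real n * h))" for n
  proof -
    have "(\<integral>\<omega>. stopped v h \<beta> n \<omega> \<partial>M) \<le> (\<integral>\<omega>. exp (\<beta> * h) * ?Y n \<omega> + exp (- \<alpha> * (real n * h)) \<partial>M)"
      by (rule integral_mono[OF st(2)])
        (use intY expmart_hit_bounds(2) expmart_le_alive in \<open>auto simp: stopped_def intro: add_increasing2\<close>)
    also have "\<dots> = exp (\<beta> * h) * (\<integral>\<omega>. ?Y n \<omega> \<partial>M) + exp (- \<alpha> * (real n * h))"
      using intY by (simp add: prob_space)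
    finally show ?thesis unfolding st(1)[of n] .
  qed
  moreover have "(\<lambda>n. exp (\<beta> * h) * (\<integral>\<omega>. ?Y n \<omega> \<partial>M) + exp (- \<alpha> * (real n * h)))
      \<longlonglongrightarrow> exp (\<beta> * h) * (\<integral>\<omega>. killed v h \<beta> \<omega> \<partial>M) + 0"
  proof (intro tendsto_add tendsto_mult tendsto_const lim)
    show "(\<lambda>n. exp (- \<alpha> * (real n * h))) \<longlonglongrightarrow> 0"
    proof -
      have "(\<lambda>n. exp (- c * (real n * h))) \<longlonglongrightarrow> 0" if "0 < c" for c
        using that h by real_asymp
      then show ?thesis using \<alpha>_pos .
    qed
  qed
  ultimately show "(\<integral>\<omega>. exp (- \<beta> * v \<omega>) \<partial>M) \<le> exp (\<beta> * h) * (\<integral>\<omega>. killed v h \<beta> \<omega> \<partial>M)"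
    by (intro tendsto_lowerbound[where F=sequentially and f="\<lambda>n. exp (\<beta> * h) * (\<integral>\<omega>. ?Y n \<omega> \<partial>M) + exp (- \<alpha> * (real n * h))"]) auto
qed

end

section \<open>The waiting time as the limit of the fixed point iteration\<close>

context
  fixes w :: "nat \<Rightarrow> 'a \<Rightarrow> real"
  assumes w_0: "\<And>\<omega>. w 0 \<omega> = V \<omega>" and w_Suc: "\<And>n \<omega>. w (Suc n) \<omega> = V \<omega> + A (w n \<omega>) \<omega>"
begin

lemma w_nonneg: "\<omega> \<in> space M \<Longrightarrow> 0 \<le> w n \<omega>"
  by (induction n) (auto simp: w_0 w_Suc V_nonneg total_nonneg[OF a_nonneg] intro!: add_nonneg_nonneg)

lemma w_incseq: "\<omega> \<in> space M \<Longrightarrow> incseq (\<lambda>n. w n \<omega>)"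
proof (rule incseq_SucI)
  fix n assume \<omega>: "\<omega> \<in> space M"
  show "w n \<omega> \<le> w (Suc n) \<omega>"
  proof (induction n)
    case 0
    then show ?case using total_nonneg[OF a_nonneg \<omega> V_nonneg[OF \<omega>]] by (simp add: w_0 w_Suc)
  next
    case (Suc n)
    then show ?case using total_mono[OF a_nonneg \<omega> w_nonneg[OF \<omega>] Suc] by (simp add: w_Suc)
  qed
qed

text \<open>Monotonicity of \<open>A\<close> makes such a \<open>t\<close> a barrier for the
  iteration; in particular every reached grid point bounds the waiting time.\<close>

lemma w_le:
  assumes \<omega>: "\<omega> \<in> space M" and t: "0 \<le> t" "V \<omega> + A t \<omega> \<le> t"
  shows "w n \<omega> \<le> t"
proof (induction n)
  case 0
  then show ?case using t total_nonneg[OF a_nonneg \<omega> t(1)] by (simp add: w_0)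
next
  case (Suc n)
  then show ?case using total_mono[OF a_nonneg \<omega> w_nonneg[OF \<omega>] Suc] t(2) by (simp add: w_Suc)
qed

text \<open>As \<open>A\<close> may jump at \<open>T\<close>, the limit need not satisfy V + A T
  \<le> T. The largest grid point strictly below \<open>T\<close> is used instead: some iterate
  passes it, so V + A there is at most \<open>T\<close>, which exceeds the grid point by at most
  \<open>h\<close>. Lowering the content by \<open>h\<close> makes up for this.\<close>

lemma w_limit_hit:
  assumes \<omega>: "\<omega> \<in> space M" and lim: "(\<lambda>n. w n \<omega>) \<longlonglongrightarrow> T" and h: "0 < h"
  shows "\<exists>k. real k * h \<le> T \<and> max (V \<omega> - h) 0 + A (real k * h) \<omega> \<le> real k * h"
proof -
  have le: "w n \<omega> \<le> T" for n
    by (rule incseq_le[OF w_incseq[OF \<omega>] lim])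
  show ?thesis
  proof (cases "V \<omega> \<le> h")
    case True
    have "0 \<le> T" using le[of 0] V_nonneg[OF \<omega>] by (simp add: w_0)
    then show ?thesis using True total_0[OF a_nonneg \<omega>] by (intro exI[of _ 0]) simp
  next
    case False
    then have T: "0 < T" using le[of 0] h by (simp add: w_0)
    define k where "k = nat \<lceil>T / h\<rceil> - 1"
    have "0 < \<lceil>T / h\<rceil>" using T h by simp
    then have "real k = of_int \<lceil>T / h\<rceil> - 1" unfolding k_def by linarith
    then have "real k < T / h" "T / h \<le> real k + 1"
      using ceiling_correct[of "T / h"] by linarith+
    then have k: "real k * h < T" "T \<le> real k * h + h"
      using h by (simp_all add: field_simps)
    obtain n where n: "real k * h < w n \<omega>"
      using order_tendstoD(1)[OF lim k(1)] by (auto simp: eventually_sequentially)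
    have "V \<omega> + A (real k * h) \<omega> \<le> w (Suc n) \<omega>"
      unfolding w_Suc using n h by (intro add_left_mono total_mono a_nonneg \<omega>) auto
    also have "\<dots> \<le> real k * h + h" using le[of "Suc n"] k(2) by simp
    finally show ?thesis using k False by (intro exI[of _ k]) auto
  qed
qed

text \<open>By right continuity \<open>S\<close> may be approximated from above by times with
  countably many values. The added 1 in \<open>?q\<close> keeps them strictly above
  \<open>S\<close>, as the limit along \<open>at_right\<close> requires.\<close>

lemma measurable_A_random:
  assumes S [measurable]: "S \<in> borel_measurable M" and S_nonneg: "\<And>\<omega>. \<omega> \<in> space M \<Longrightarrow> 0 \<le> S \<omega>"
  shows "(\<lambda>\<omega>. A (S \<omega>) \<omega>) \<in> borel_measurable M"
proof (rule borel_measurable_LIMSEQ_real)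
  let ?q = "\<lambda>m \<omega>. real (nat (\<lfloor>S \<omega> * real (Suc m)\<rfloor> + 1)) / real (Suc m)"
  show "(\<lambda>m. A (?q m \<omega>) \<omega>) \<longlonglongrightarrow> A (S \<omega>) \<omega>" if \<omega>: "\<omega> \<in> space M" for \<omega>
  proof -
    have q: "S \<omega> < ?q m \<omega> \<and> ?q m \<omega> \<le> S \<omega> + 1 / real (Suc m)" for m
    proof -
      let ?z = "S \<omega> * real (Suc m)"
      have "0 \<le> ?z" using S_nonneg[OF \<omega>] by simp
      then have "real (nat (\<lfloor>?z\<rfloor> + 1)) = of_int \<lfloor>?z\<rfloor> + 1" by simp
      moreover have "?z < of_int \<lfloor>?z\<rfloor> + 1" "of_int \<lfloor>?z\<rfloor> + 1 \<le> ?z + 1" by linarith+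
      ultimately show ?thesis
        by (simp add: pos_less_divide_eq pos_divide_le_eq distrib_right del: of_nat_Suc)
    qed
    have lim: "(\<lambda>m. S \<omega> + 1 / real (Suc m)) \<longlonglongrightarrow> S \<omega>" by real_asymp
    have "(\<lambda>m. ?q m \<omega>) \<longlonglongrightarrow> S \<omega>"
      by (rule tendsto_sandwich[OF _ _ tendsto_const lim]) (use q in \<open>auto simp: less_imp_le\<close>)
    then have "filterlim (\<lambda>m. ?q m \<omega>) (at_right (S \<omega>)) sequentially"
      by (rule tendsto_imp_filterlim_at_right) (use q in auto)
    from filterlim_compose[OF total_right_cont[OF a_nonneg \<omega> S_nonneg[OF \<omega>]] this]
    show ?thesis .
  qed
  fix m
  show "(\<lambda>\<omega>. A (?q m \<omega>) \<omega>) \<in> borel_measurable M"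
  proof (rule measurable_compose_countable[where f="\<lambda>j. A (real j / real (Suc m))"])
    show "A (real j / real (Suc m)) \<in> borel_measurable M" for j
      by (intro measurable_total a_nonneg) simp
    show "(\<lambda>\<omega>. nat (\<lfloor>S \<omega> * real (Suc m)\<rfloor> + 1)) \<in> measurable M (count_space UNIV)"
      by measurable
  qed
qed

lemma measurable_w [measurable]: "w n \<in> borel_measurable M"
proof (induction n)
  case 0
  have "w 0 = V" by (simp add: w_0 fun_eq_iff)
  then show ?case by simp
next
  case (Suc n)
  have "w (Suc n) = (\<lambda>\<omega>. V \<omega> + A (w n \<omega>) \<omega>)" by (simp add: w_Suc fun_eq_iff)
  then show ?case using measurable_A_random[OF Suc w_nonneg] by simp
qed

abbreviation wait :: "'a \<Rightarrow> real" where
  "wait \<omega> \<equiv> lim (\<lambda>n. w n \<omega>)"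

lemma measurable_wait [measurable]: "wait \<in> borel_measurable M"
  by (rule borel_measurable_lim_metric) simp

lemma w_tendsto_wait:
  assumes \<omega>: "\<omega> \<in> space M" and t: "0 \<le> t" "V \<omega> + A t \<omega> \<le> t"
  shows "(\<lambda>n. w n \<omega>) \<longlonglongrightarrow> wait \<omega>" "wait \<omega> \<le> t" "0 \<le> wait \<omega>"
proof -
  obtain T where T: "(\<lambda>n. w n \<omega>) \<longlonglongrightarrow> T"
    using incseq_convergent[OF w_incseq[OF \<omega>], of t] w_le[OF \<omega> t] by blast
  then have "wait \<omega> = T" by (rule limI)
  then show lim: "(\<lambda>n. w n \<omega>) \<longlonglongrightarrow> wait \<omega>" using T by simp
  show "wait \<omega> \<le> t" by (rule LIMSEQ_le_const2[OF lim]) (use w_le[OF \<omega> t] in auto)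
  show "0 \<le> wait \<omega>" by (rule LIMSEQ_le_const[OF lim]) (use w_nonneg[OF \<omega>] in auto)
qed

context
  fixes h \<beta> :: real assumes h: "0 < h" and \<beta>: "0 < \<beta>"
begin

lemma shift_args:
  "(\<lambda>x. x) \<in> borel_measurable borel" "V = (\<lambda>\<omega>. (\<lambda>x. x) (V \<omega>))" "\<forall>\<omega>\<in>space M. 0 \<le> V \<omega>"
  "(\<lambda>x. max (x - h) 0) \<in> borel_measurable borel"
  "(\<lambda>\<omega>. max (V \<omega> - h) 0) = (\<lambda>\<omega>. (\<lambda>x. max (x - h) 0) (V \<omega>))" "\<forall>\<omega>\<in>space M. 0 \<le> max (V \<omega> - h) 0"
  by (auto simp: V_nonneg)

lemmas killed_V = killed_le_1[OF h \<beta> shift_args(1-3)] integrable_killed[OF h \<beta> shift_args(1-3)]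
  expectation_killed[OF h \<beta> shift_args(1-3)]
lemmas killed_shifted = integrable_killed[OF h \<beta> shift_args(4-6)] expectation_killed(1)[OF h \<beta> shift_args(4-6)]

end

text \<open>The hitting probability dominates the mean of \<open>killed\<close>, hence exp (-
  \<beta> h) times the transform of \<open>V\<close>, for every \<beta> > 0; as \<beta> tends to 0
  this tends to 1.\<close>

lemma AE_hit:
  assumes h: "0 < h"
  shows "AE \<omega> in M. \<exists>k. reached V h k \<omega>"
proof -
  have [measurable]: "A (real k * h) \<in> borel_measurable M" for k
    using h by (intro measurable_total a_nonneg) auto
  let ?E = "{\<omega>\<in>space M. \<exists>k. reached V h k \<omega>}"
  have [measurable]: "?E \<in> events" by measurable
  have le: "exp (- \<beta> * h) * (\<integral>\<omega>. exp (- \<beta> * V \<omega>) \<partial>M) \<le> prob ?E" if \<beta>: "0 < \<beta>" for \<beta>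
  proof -
    note kV = killed_V[OF h \<beta>]
    have "exp (- \<beta> * h) * (\<integral>\<omega>. exp (- \<beta> * V \<omega>) \<partial>M) \<le> (\<integral>\<omega>. killed V h \<beta> \<omega> \<partial>M)"
      using kV(5) by (simp add: exp_minus field_simps)
    also have "\<dots> \<le> (\<integral>\<omega>. indicator ?E \<omega> \<partial>M)"
    proof (rule integral_mono[OF kV(3)])
      fix \<omega> assume "\<omega> \<in> space M"
      then show "killed V h \<beta> \<omega> \<le> indicator ?E \<omega>"
        using kV(2)[of \<omega>] by (cases "\<omega> \<in> ?E") (simp_all add: killed_def)
    qed (simp add: emeasure_eq_measure)
    finally show ?thesis by simp
  qed
  have lim: "(\<lambda>n. exp (- (1 / real (Suc n)) * h) * (\<integral>\<omega>. exp (- (1 / real (Suc n)) * V \<omega>) \<partial>M)) \<longlonglongrightarrow> 1 * 1"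
  proof (rule tendsto_mult[OF _ integral_exp_tendsto_1])
    show "(\<lambda>n. exp (- (1 / real (Suc n)) * h)) \<longlonglongrightarrow> 1" by real_asymp
  qed (auto simp: V_nonneg)
  have "exp (- (1 / real (Suc n)) * h) * (\<integral>\<omega>. exp (- (1 / real (Suc n)) * V \<omega>) \<partial>M) \<le> prob ?E" for n
    by (rule le) simp
  then have "1 * 1 \<le> prob ?E"
    by (intro LIMSEQ_le_const2[OF lim]) blast
  then have "prob ?E = 1" using prob_le_1[of ?E] by simp
  then show ?thesis by (subst (asm) prob_Collect_eq_1) auto
qed

lemma laplace_wait:
  assumes \<beta>: "0 < \<beta>"
  shows "(\<integral>\<omega>. exp (- (\<beta> - exponent a \<beta>) * wait \<omega>) \<partial>M) = (\<integral>\<omega>. exp (- \<beta> * V \<omega>) \<partial>M)"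
proof -
  let ?\<alpha> = "\<beta> - exponent a \<beta>"
  define LT where "LT = (\<integral>\<omega>. exp (- ?\<alpha> * wait \<omega>) \<partial>M)"
  define LV where "LV = (\<integral>\<omega>. exp (- \<beta> * V \<omega>) \<partial>M)"
  have \<alpha>: "0 < ?\<alpha>" using exponent_less[OF \<beta>] by simp
  \<comment> \<open>Convergence of the iterates is known only on paths that hit; elsewhere the value
    of \<open>lim\<close> is unspecified.\<close>
  have wait_nonneg: "AE \<omega> in M. 0 \<le> wait \<omega>"
    using AE_hit[OF zero_less_one] AE_space by eventually_elim (use w_tendsto_wait(3)[OF _ of_nat_0_le_iff] in auto)
  have int_wait: "integrable M (\<lambda>\<omega>. exp (- ?\<alpha> * wait \<omega>))"
    by (rule integrable_const_bound[of _ 1])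
      (use wait_nonneg \<alpha> in \<open>auto elim!: eventually_mono intro: mult_nonpos_nonneg\<close>)
  have intV: "integrable M (\<lambda>\<omega>. exp (- \<beta> * V \<omega>))"
    by (rule integrable_const_bound[of _ 1]) (use V_nonneg \<beta> in \<open>auto intro!: AE_I2\<close>)
  have bounds: "exp (- \<beta> * h) * LV \<le> LT \<and> LT \<le> exp (\<beta> * h) * LV" if h: "0 < h" for h
  proof
    note kV = killed_V[OF h \<beta>]
    have "exp (- \<beta> * h) * LV \<le> (\<integral>\<omega>. killed V h \<beta> \<omega> \<partial>M)"
      using kV(5) by (simp add: LV_def exp_minus field_simps)
    also have "\<dots> \<le> LT" unfolding LT_def
    proof (rule integral_mono_AE[OF kV(3) int_wait])
      show "AE \<omega> in M. killed V h \<beta> \<omega> \<le> exp (- ?\<alpha> * wait \<omega>)"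
        using AE_hit[OF h] AE_space
      proof eventually_elim
        case (elim \<omega>)
        then obtain k where k: "reached V h k \<omega>" by auto
        have "wait \<omega> \<le> real (hit V h \<omega>) * h"
          using h by (intro w_tendsto_wait(2) elim(2) hit_properties(1)[of V \<omega> k h, OF k]) auto
        then have "?\<alpha> * wait \<omega> \<le> ?\<alpha> * (real (hit V h \<omega>) * h)"
          using \<alpha> by (intro mult_left_mono) auto
        then show ?case using elim(1) unfolding killed_def by (simp del: minus_diff_eq)
      qed
    qed
    finally show "exp (- \<beta> * h) * LV \<le> LT" .
    \<comment> \<open>The price of the lowered content is the factor exp (\<beta> h), because max (V
      - h) 0 \<ge> V - h.\<close>
    let ?v = "\<lambda>\<omega>. max (V \<omega> - h) 0"
    note kv = killed_shifted[OF h \<beta>]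
    have "LT \<le> (\<integral>\<omega>. killed ?v h \<beta> \<omega> \<partial>M)" unfolding LT_def
    proof (rule integral_mono_AE[OF int_wait kv(1)])
      show "AE \<omega> in M. exp (- ?\<alpha> * wait \<omega>) \<le> killed ?v h \<beta> \<omega>"
        using AE_hit[OF h] AE_space
      proof eventually_elim
        case (elim \<omega>)
        then obtain j where j: "reached V h j \<omega>" by auto
        have "(\<lambda>n. w n \<omega>) \<longlonglongrightarrow> wait \<omega>"
          using h by (intro w_tendsto_wait(1)[OF elim(2) _ j]) auto
        from w_limit_hit[OF elim(2) this h]
        obtain k where k: "real k * h \<le> wait \<omega>" "reached ?v h k \<omega>" by auto
        have "real (hit ?v h \<omega>) * h \<le> real k * h"
          using hit_properties(2)[of ?v \<omega> k h, OF k(2)] h by simp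
        then have "?\<alpha> * (real (hit ?v h \<omega>) * h) \<le> ?\<alpha> * wait \<omega>"
          using \<alpha> k(1) by (intro mult_left_mono) auto
        then show ?case using k(2) unfolding killed_def by (auto simp del: minus_diff_eq)
      qed
    qed
    also have "\<dots> \<le> (\<integral>\<omega>. exp (- \<beta> * ?v \<omega>) \<partial>M)" by (rule kv(2))
    also have "\<dots> \<le> (\<integral>\<omega>. exp (\<beta> * h) * exp (- \<beta> * V \<omega>) \<partial>M)"
    proof (rule integral_mono)
      show "integrable M (\<lambda>\<omega>. exp (- \<beta> * ?v \<omega>))"
        by (rule integrable_const_bound[of _ 1]) (use \<beta> in \<open>auto intro!: AE_I2\<close>)
      show "integrable M (\<lambda>\<omega>. exp (\<beta> * h) * exp (- \<beta> * V \<omega>))" using intV by simp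
      fix \<omega>
      have "\<beta> * (V \<omega> - h) \<le> \<beta> * ?v \<omega>" using \<beta> by (intro mult_left_mono) auto
      then show "exp (- \<beta> * ?v \<omega>) \<le> exp (\<beta> * h) * exp (- \<beta> * V \<omega>)"
        unfolding exp_add[symmetric] by (simp add: algebra_simps)
    qed
    also have "\<dots> = exp (\<beta> * h) * LV" by (simp add: LV_def)
    finally show "LT \<le> exp (\<beta> * h) * LV" .
  qed
  have bd: "exp (- \<beta> * (1 / real (Suc n))) * LV \<le> LT \<and> LT \<le> exp (\<beta> * (1 / real (Suc n))) * LV" for n
    by (rule bounds) simp
  have "(\<lambda>n. exp (- \<beta> * (1 / real (Suc n))) * LV) \<longlonglongrightarrow> LV" by real_asymp
  then have "LV \<le> LT" by (rule LIMSEQ_le_const2) (use bd in blast)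
  moreover have "(\<lambda>n. exp (\<beta> * (1 / real (Suc n))) * LV) \<longlonglongrightarrow> LV" by real_asymp
  then have "LT \<le> LV" by (rule LIMSEQ_le_const) (use bd in blast)
  ultimately show ?thesis by (simp add: LT_def LV_def)
qed

end
end

section \<open>Stieltjes sums and reflected paths\<close>

lemma mono_left_limit:
  fixes F :: "real \<Rightarrow> real"
  assumes mono: "\<And>s t. 0 \<le> s \<Longrightarrow> s \<le> t \<Longrightarrow> F s \<le> F t" and s: "0 < s"
  shows "(F \<longlongrightarrow> Lim (at_left s) F) (at_left s)"
proof -
  \<comment> \<open>\<open>F\<close> is monotone only on the nonnegative axis, so the limit is first
    taken within it; near \<open>s > 0\<close> the two filters agree.\<close>
  have "(F \<longlongrightarrow> Sup (F ` ({..<s} \<inter> {0..}))) (at s within ({..<s} \<inter> {0..}))"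
    by (rule Lim_left_bound[where K="F s"]) (use mono in auto)
  also have "at s within ({..<s} \<inter> {0..}) = at_left s"
    by (rule at_within_nhd[where S="{0<..}"]) (use s in auto)
  finally show ?thesis using tendsto_Lim[of "at_left s" F] by simp
qed

lemma at_within_atLeast: "at t within {t..} = at_right (t :: real)"
  unfolding at_within_def by (rule arg_cong[where f="\<lambda>A. inf (nhds t) (principal A)"]) auto

lemma tendsto_from_right:
  fixes F :: "real \<Rightarrow> real"
  assumes "(F \<longlongrightarrow> F t) (at_right t)" "x \<longlonglongrightarrow> t" "\<And>n. t \<le> x n"
  shows "(\<lambda>n. F (x n)) \<longlonglongrightarrow> F t"
proof -
  have "continuous (at t within {t..}) F"
    using assms(1) by (simp add: continuous_within at_within_atLeast)
  then show ?thesis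
    using assms(2,3) by (auto simp: continuous_within_sequentially comp_def)
qed

lemma grid_end: "real (n * Suc m) / real (Suc m) = real n"
  by (subst of_nat_mult, rule nonzero_mult_div_cancel_right) simp

text \<open>Instantiated twice: by the identity with Lebesgue measure, for time integrals, and by a
  path of \<open>J N\<close> with the measure that it induces, for sums over batches.\<close>

locale stieltjes =
  fixes F :: "real \<Rightarrow> real" and \<mu> :: "real measure"
  assumes F_mono: "\<And>s t. 0 \<le> s \<Longrightarrow> s \<le> t \<Longrightarrow> F s \<le> F t"
    and F_right: "\<And>t. 0 \<le> t \<Longrightarrow> (F \<longlongrightarrow> F t) (at_right t)"
    and sets_\<mu>: "sets \<mu> = sets borel"
    and \<mu>_Ioc: "\<And>a b. 0 \<le> a \<Longrightarrow> a \<le> b \<Longrightarrow> emeasure \<mu> {a<..b} = ennreal (F b - F a)"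
begin

abbreviation Fl :: "real \<Rightarrow> real" where "Fl s \<equiv> Lim (at_left s) F"

lemma [measurable_cong]: "sets \<mu> = sets borel" by (rule sets_\<mu>)

lemma space_\<mu>: "space \<mu> = UNIV"
  using sets_eq_imp_space_eq[OF sets_\<mu>] by simp

lemma F_left: "0 < s \<Longrightarrow> (F \<longlongrightarrow> Fl s) (at_left s)"
  by (rule mono_left_limit) (auto intro: F_mono)

lemma F_left_le: "0 < s \<Longrightarrow> Fl s \<le> F s"
proof -
  assume s: "0 < s"
  have "eventually (\<lambda>u. F u \<le> F s) (at_left s)"
    unfolding eventually_at_left[OF s] using s by (auto intro!: exI[of _ 0] F_mono)
  then show ?thesis using F_left[OF s] by (intro tendsto_upperbound[of F "Fl s" "at_left s"]) auto
qed

lemma \<mu>_singleton: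
  assumes s: "0 < s"
  shows "emeasure \<mu> {s} = ennreal (F s - Fl s)"
proof -
  define A where "A j = {s - s / real (Suc j)<..s}" for j
  have nn: "0 \<le> s - s / real (Suc j)" for j using s by (simp add: field_simps)
  have A: "emeasure \<mu> (A j) = ennreal (F s - F (s - s / real (Suc j)))" for j
    unfolding A_def using nn[of j] s by (intro \<mu>_Ioc) (auto simp: field_simps)
  have dec: "decseq A"
    unfolding A_def decseq_def using s
    by (auto intro!: divide_left_mono elim!: order.strict_trans1[rotated])
  have lim: "(\<lambda>j. s - s / real (Suc j)) \<longlonglongrightarrow> s" by real_asymp
  have "(\<lambda>j. F (s - s / real (Suc j))) \<longlonglongrightarrow> Fl s"
    by (rule filterlim_compose[OF F_left[OF s] tendsto_imp_filterlim_at_left[OF lim]]) (use s in auto)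
  then have "(\<lambda>j. emeasure \<mu> (A j)) \<longlonglongrightarrow> ennreal (F s - Fl s)"
    unfolding A by (intro tendsto_ennrealI tendsto_diff tendsto_const)
  moreover have "(\<lambda>j. emeasure \<mu> (A j)) \<longlonglongrightarrow> emeasure \<mu> (\<Inter>j. A j)"
    by (rule Lim_emeasure_decseq[OF _ dec]) (auto simp: A, auto simp: A_def sets_\<mu>)
  moreover have "(\<Inter>j. A j) = {s}"
  proof -
    have "s \<le> x" if "\<And>j. s - s / real (Suc j) < x" for x
      by (rule LIMSEQ_le_const2[OF lim]) (use that in \<open>auto intro: less_imp_le\<close>)
    then show ?thesis using s by (force simp: A_def)
  qed
  ultimately show ?thesis using LIMSEQ_unique by metis
qed

text \<open>Ceiling minus 1 rather than floor, because the cells are open on the left and closed on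
  the right, like the intervals in \<open>\<mu>_Ioc\<close>.\<close>

definition grid_index :: "nat \<Rightarrow> real \<Rightarrow> nat" where
  "grid_index m s = nat \<lceil>s * real (Suc m)\<rceil> - 1"

lemma grid_index:
  assumes "0 < s"
  shows "real k / real (Suc m) < s \<and> s \<le> real (Suc k) / real (Suc m) \<longleftrightarrow> k = grid_index m s"
proof -
  let ?z = "s * real (Suc m)"
  have "0 < ?z" using assms by simp
  have "real k / real (Suc m) < s \<and> s \<le> real (Suc k) / real (Suc m) \<longleftrightarrow> real k < ?z \<and> ?z \<le> real k + 1"
    by (simp add: pos_le_divide_eq pos_divide_less_eq add.commute del: of_nat_Suc) simp
  also have "\<dots> \<longleftrightarrow> k = grid_index m s"
    unfolding grid_index_def using \<open>0 < ?z\<close> by linarith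
  finally show ?thesis .
qed

lemma grid_index_tendsto:
  assumes s: "0 < s"
  shows "filterlim (\<lambda>m. real (grid_index m s) / real (Suc m)) (at_left s) sequentially"
    "(\<lambda>m. real (Suc (grid_index m s)) / real (Suc m)) \<longlonglongrightarrow> s"
proof -
  have b: "real (grid_index m s) / real (Suc m) < s" "s \<le> real (Suc (grid_index m s)) / real (Suc m)" for m
    using grid_index[OF s, of _ m] by blast+
  have eq: "real (Suc (grid_index m s)) / real (Suc m) = real (grid_index m s) / real (Suc m) + 1 / real (Suc m)" for m
    by (simp add: add_divide_distrib[symmetric])
  have l1: "(\<lambda>m. s - 1 / real (Suc m)) \<longlonglongrightarrow> s" and l2: "(\<lambda>m. s + 1 / real (Suc m)) \<longlonglongrightarrow> s" by real_asymp+
  have "(\<lambda>m. real (grid_index m s) / real (Suc m)) \<longlonglongrightarrow> s"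
  proof (rule tendsto_sandwich[OF _ _ l1 tendsto_const])
    show "\<forall>\<^sub>F m in sequentially. s - 1 / real (Suc m) \<le> real (grid_index m s) / real (Suc m)"
      using b(2) unfolding eq by (intro always_eventually allI) (simp add: diff_le_eq)
  qed (use b(1) in \<open>auto intro!: always_eventually less_imp_le\<close>)
  then show "filterlim (\<lambda>m. real (grid_index m s) / real (Suc m)) (at_left s) sequentially"
    by (rule tendsto_imp_filterlim_at_left) (use b(1) in auto)
  show "(\<lambda>m. real (Suc (grid_index m s)) / real (Suc m)) \<longlonglongrightarrow> s"
  proof (rule tendsto_sandwich[OF _ _ tendsto_const l2])
    show "\<forall>\<^sub>F m in sequentially. real (Suc (grid_index m s)) / real (Suc m) \<le> s + 1 / real (Suc m)"
      using b(1) unfolding eq by (intro always_eventually allI) (simp add: less_imp_le)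
  qed (use b(2) in auto)
qed

definition \<Delta> :: "nat \<Rightarrow> nat \<Rightarrow> real" where
  "\<Delta> m k = F (real (Suc k) / real (Suc m)) - F (real k / real (Suc m))"

lemma \<Delta>_nonneg: "0 \<le> \<Delta> m k"
  unfolding \<Delta>_def by (simp add: F_mono divide_right_mono)

lemma sum_\<Delta>: "(\<Sum>k<n * Suc m. \<Delta> m k) = F (real n) - F 0"
  unfolding \<Delta>_def by (subst sum_lessThan_telescope[where f="\<lambda>k. F (real k / real (Suc m))"])
    (simp only: grid_end, simp)

lemma finite_Ioc: "emeasure \<mu> {0<..real n} < \<infinity>"
  by (simp add: \<mu>_Ioc)

text \<open>The sum is the integral of a step function with respect to \<open>\<mu>\<close>, so that dominated convergence
  applies.\<close>

lemma stieltjes_limit: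
  assumes e_left: "\<And>s. 0 < s \<Longrightarrow> (e \<longlongrightarrow> el s) (at_left s)"
    and em_le: "\<And>m k. \<bar>em m k\<bar> \<le> 1"
    and em: "\<And>m k. \<bar>em m k - e (real k / real (Suc m))\<bar> \<le> C / real (Suc m)"
    and \<kappa>_cont: "continuous_on {0..} \<kappa>" and \<kappa>_le: "\<And>x. 0 \<le> x \<Longrightarrow> \<bar>\<kappa> x\<bar> \<le> 1"
  shows "(\<lambda>m. \<Sum>k<n * Suc m. em m k * (\<kappa> (\<Delta> m k) * \<Delta> m k)) \<longlonglongrightarrow>
      (\<integral>s. indicator {0<..real n} s * (el s * \<kappa> (F s - Fl s)) \<partial>\<mu>)" (is ?lim)
    and "(\<lambda>s. indicator {0<..real n} s * (el s * \<kappa> (F s - Fl s))) \<in> borel_measurable \<mu>" (is ?meas)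
proof -
  define I where "I m k = {real k / real (Suc m)<..real (Suc k) / real (Suc m)}" for m k
  define f where "f m s = (\<Sum>k<n * Suc m. em m k * \<kappa> (\<Delta> m k) * indicator (I m k) s)" for m s
  let ?g = "\<lambda>s. indicator {0<..real n} s * (el s * \<kappa> (F s - Fl s))"
  have I_fin: "emeasure \<mu> (I m k) = ennreal (\<Delta> m k)" for m k
    unfolding I_def \<Delta>_def by (intro \<mu>_Ioc) (auto simp: divide_right_mono)
  have f_eq: "f m s = (if s \<in> {0<..real n} then em m (grid_index m s) * \<kappa> (\<Delta> m (grid_index m s)) else 0)" for m s
  proof (cases "0 < s")
    case True
    have ind: "indicator (I m k) s = (if k = grid_index m s then 1 else 0 :: real)" for k
      using grid_index[OF True, of k m] by (auto simp: I_def indicator_def)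
    have "grid_index m s < n * Suc m \<longleftrightarrow> s \<le> real n"
    proof -
      let ?k = "grid_index m s"
      have k: "real ?k / real (Suc m) < s" "s \<le> real (Suc ?k) / real (Suc m)"
        using grid_index[OF True, of ?k m] by blast+
      have nm: "real (n * Suc m) / real (Suc m) = real n" by (rule grid_end)
      show ?thesis
      proof
        assume "?k < n * Suc m"
        then have "real (Suc ?k) / real (Suc m) \<le> real (n * Suc m) / real (Suc m)"
          by (intro divide_right_mono) (simp_all only: of_nat_le_iff Suc_le_eq of_nat_0_le_iff)
        then show "s \<le> real n" using k(2) unfolding nm by linarith
      next
        assume "s \<le> real n"
        then have "real ?k / real (Suc m) < real (n * Suc m) / real (Suc m)"
          using k(1) unfolding nm by linarith
        then have "real ?k < real (n * Suc m)" unfolding divide_less_cancel by linarith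
          then show "?k < n * Suc m" by (simp only: of_nat_less_iff)
      qed
    qed
    then show ?thesis using True by (simp add: f_def ind if_distrib[where f="\<lambda>x. c * x" for c] sum.delta cong: if_cong)
  next
    case False
    have "indicator (I m k) s = (0::real)" for k
      using False by (auto simp: I_def indicator_def not_less intro: order_trans divide_nonneg_nonneg)
    then show ?thesis using False by (simp add: f_def)
  qed
  have lim: "(\<lambda>m. f m s) \<longlonglongrightarrow> ?g s" for s
  proof (cases "s \<in> {0<..real n}")
    case True
    then have s: "0 < s" by simp
    note t = grid_index_tendsto[OF s]
    have le: "s \<le> real (Suc (grid_index m s)) / real (Suc m)" for m
      using grid_index[OF s, of _ m] by blast
    \<comment> \<open>The cell containing \<open>s\<close> has its left end strictly below
      \<open>s\<close> and its right end at or above \<open>s\<close>, so the increment over the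
      shrinking cells tends to the jump at \<open>s\<close>.\<close>
    have "(\<lambda>m. \<Delta> m (grid_index m s)) \<longlonglongrightarrow> F s - Fl s"
      unfolding \<Delta>_def
      by (intro tendsto_diff tendsto_from_right[OF F_right t(2) le] filterlim_compose[OF F_left[OF s] t(1)])
        (use s in auto)
    then have chi: "(\<lambda>m. \<kappa> (\<Delta> m (grid_index m s))) \<longlonglongrightarrow> \<kappa> (F s - Fl s)"
      using \<kappa>_cont F_left_le[OF s] \<Delta>_nonneg by (intro continuous_on_tendsto_compose[OF \<kappa>_cont]) auto
    have e: "(\<lambda>m. e (real (grid_index m s) / real (Suc m))) \<longlonglongrightarrow> el s"
      by (rule filterlim_compose[OF e_left[OF s] t(1)])
    have C0: "(\<lambda>m. C / real (Suc m)) \<longlonglongrightarrow> 0" by real_asymp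
    have "(\<lambda>m. em m (grid_index m s) - e (real (grid_index m s) / real (Suc m))) \<longlonglongrightarrow> 0"
      by (rule Lim_null_comparison[OF _ C0]) (use em in auto)
    from tendsto_add[OF this e] have "(\<lambda>m. em m (grid_index m s)) \<longlonglongrightarrow> el s" by simp
    from tendsto_mult[OF this chi] show ?thesis using True unfolding f_eq by simp
  next
    case False
    then have "f m s = 0" for m unfolding f_eq by (rule if_not_P)
    then show ?thesis using False by simp
  qed
  have f_meas: "f m \<in> borel_measurable \<mu>" for m
    unfolding f_def[abs_def] I_def by measurable
  show meas: ?meas
    by (rule borel_measurable_LIMSEQ_real[OF lim f_meas])
  have f_le: "norm (f m s) \<le> indicator {0<..real n} s" for m s
    using mult_mono[OF em_le[of m "grid_index m s"] \<kappa>_le[OF \<Delta>_nonneg[of m "grid_index m s"]]]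
    by (auto simp: f_eq abs_mult)
  have "(\<lambda>m. \<integral>s. f m s \<partial>\<mu>) \<longlonglongrightarrow> (\<integral>s. ?g s \<partial>\<mu>)"
  proof (rule integral_dominated_convergence[OF meas f_meas])
    show "integrable \<mu> (indicator {0<..real n} :: real \<Rightarrow> real)"
      using finite_Ioc by (simp add: integrable_indicator_iff)
  qed (use lim f_le in auto)
  also have "(\<lambda>m. \<integral>s. f m s \<partial>\<mu>) = (\<lambda>m. \<Sum>k<n * Suc m. em m k * (\<kappa> (\<Delta> m k) * \<Delta> m k))"
  proof
    fix m
    have int: "integrable \<mu> (indicator (I m k) :: real \<Rightarrow> real)" for k
      using I_fin by (simp add: integrable_indicator_iff) (simp add: I_def sets_\<mu>)
    have "measure \<mu> (I m k) = \<Delta> m k" for k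
      using I_fin \<Delta>_nonneg by (simp add: measure_def)
    then show "(\<integral>s. f m s \<partial>\<mu>) = (\<Sum>k<n * Suc m. em m k * (\<kappa> (\<Delta> m k) * \<Delta> m k))"
      unfolding f_def using int by (subst Bochner_Integration.integral_sum) (auto simp: space_\<mu> mult_ac)
  qed
  finally show ?lim .
qed

end

text \<open>The measure with density \<open>g\<close> lives on the countable set \<open>D\<close>
  and is therefore the sum of its atoms. The sum over the uncountable \<open>S\<close> sees only the
  points of \<open>D\<close>.\<close>

lemma integral_countable_support:
  fixes g p :: "real \<Rightarrow> real"
  assumes sets: "sets \<mu> = sets borel" and int: "integrable \<mu> g" and nn: "\<And>s. 0 \<le> g s"
    and D: "countable D" "D \<subseteq> S" "\<And>s. s \<notin> D \<Longrightarrow> g s = 0"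
    and p: "\<And>s. s \<in> D \<Longrightarrow> emeasure \<mu> {s} = ennreal (p s)" "\<And>s. s \<in> D \<Longrightarrow> 0 \<le> p s"
  shows "(\<Sum>\<^sub>\<infinity>s\<in>S. g s * p s) = (\<integral>s. g s \<partial>\<mu>)"
proof -
  have gm: "g \<in> borel_measurable \<mu>" using int by auto
  have single: "{s} \<in> sets \<mu>" for s by (simp add: sets)
  have Ds: "D \<in> sets \<mu>" using single D(1) by (rule sets.countable)
  have "ennreal (\<integral>s. g s \<partial>\<mu>) = (\<integral>\<^sup>+s. ennreal (g s) \<partial>\<mu>)"
    using int nn by (intro nn_integral_eq_integral[symmetric]) auto
  also have "\<dots> = (\<integral>\<^sup>+s. ennreal (g s) * indicator D s \<partial>\<mu>)"
    using D(3) by (intro nn_integral_cong) (auto simp: indicator_def)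
  also have "\<dots> = emeasure (density \<mu> (\<lambda>s. ennreal (g s))) D"
    using gm Ds by (intro emeasure_density[symmetric]) auto
  also have "\<dots> = (\<integral>\<^sup>+s. emeasure (density \<mu> (\<lambda>s. ennreal (g s))) {s} \<partial>count_space D)"
    using D(1) single by (intro emeasure_countable_singleton) auto
  also have "\<dots> = (\<integral>\<^sup>+s. ennreal (g s * p s) \<partial>count_space D)"
    using p gm single nn by (intro nn_integral_cong) (simp add: emeasure_density ennreal_mult)
  finally have eq: "(\<integral>\<^sup>+s. ennreal (g s * p s) \<partial>count_space D) = ennreal (\<integral>s. g s \<partial>\<mu>)" ..
  have nn2: "0 \<le> g s * p s" if "s \<in> D" for s using nn[of s] p(2)[OF that] by simp
  have "integrable (count_space D) (\<lambda>s. g s * p s)"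
    by (rule integrableI_nonneg) (use eq nn2 in \<open>auto simp: AE_count_space\<close>)
  then have abs: "Infinite_Set_Sum.abs_summable_on (\<lambda>s. g s * p s) D"
    by (simp add: Infinite_Set_Sum.abs_summable_on_def)
  have "ennreal (infsetsum (\<lambda>s. g s * p s) D) = ennreal (\<integral>s. g s \<partial>\<mu>)"
    using nn_integral_conv_infsetsum[OF abs nn2] eq by simp
  then have "infsetsum (\<lambda>s. g s * p s) D = (\<integral>s. g s \<partial>\<mu>)"
    using nn nn2 by (subst (asm) ennreal_inj) (auto intro: infsetsum_nonneg integral_nonneg_AE)
  moreover have "infsetsum (\<lambda>s. g s * p s) D = (\<Sum>\<^sub>\<infinity>s\<in>S. g s * p s)"
    unfolding infsetsum_infsum[OF abs] by (rule infsum_cong_neutral) (use D in auto)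
  ultimately show ?thesis by simp
qed

primrec lindley :: "(nat \<Rightarrow> real) \<Rightarrow> nat \<Rightarrow> real" where
  "lindley \<xi> 0 = 0"
| "lindley \<xi> (Suc k) = max (lindley \<xi> k + \<xi> k) 0"

lemma lindley_nonneg: "0 \<le> lindley \<xi> k"
  by (cases k) auto

lemma lindley_cong: "(\<And>j. j < k \<Longrightarrow> \<xi> j = \<xi>' j) \<Longrightarrow> lindley \<xi> k = lindley \<xi>' k"
  by (induction k) auto

locale reflected_path =
  fixes Y :: "real \<Rightarrow> real"
  assumes Y_mono: "\<And>s t. 0 \<le> s \<Longrightarrow> s \<le> t \<Longrightarrow> Y s \<le> Y t"
    and Y_right: "\<And>t. 0 \<le> t \<Longrightarrow> (Y \<longlongrightarrow> Y t) (at_right t)"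
    and Y_0: "Y 0 = 0"
begin

definition inf_X :: "real \<Rightarrow> real" where "inf_X t = (INF s\<in>{0..t}. Y s - s)"

definition W :: "real \<Rightarrow> real" where "W t = Y t - t - inf_X t"

lemma bdd: "bdd_below ((\<lambda>s. Y s - s) ` {0..t})"
proof (rule bdd_belowI2)
  fix s assume "s \<in> {0..t}"
  then show "- t \<le> Y s - s" using Y_mono[of 0 s] Y_0 by auto
qed

lemma inf_X_le: "0 \<le> s \<Longrightarrow> s \<le> t \<Longrightarrow> inf_X t \<le> Y s - s"
  unfolding inf_X_def by (rule cINF_lower[OF bdd]) simp

lemma inf_X_greatest: "0 \<le> t \<Longrightarrow> (\<And>s. 0 \<le> s \<Longrightarrow> s \<le> t \<Longrightarrow> c \<le> Y s - s) \<Longrightarrow> c \<le> inf_X t"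
  unfolding inf_X_def by (rule cINF_greatest) auto

lemma inf_X_antimono: "0 \<le> s \<Longrightarrow> s \<le> t \<Longrightarrow> inf_X t \<le> inf_X s"
  by (rule inf_X_greatest) (auto intro: inf_X_le)

text \<open>After time \<open>s\<close> the free path falls at rate at most 1, because
  \<open>Y\<close> is nondecreasing. It follows that the running infimum is Lipschitz, so
  \<open>W\<close> can jump only where \<open>Y\<close> does.\<close>

lemma inf_X_lower:
  assumes "0 \<le> s" "s \<le> t"
  shows "min (inf_X s) (Y s - s - (t - s)) \<le> inf_X t"
proof (rule inf_X_greatest)
  fix u assume u: "0 \<le> u" "u \<le> t"
  show "min (inf_X s) (Y s - s - (t - s)) \<le> Y u - u"
  proof (cases "u \<le> s")
    case True then show ?thesis using inf_X_le[OF u(1) True] by simp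
  next
    case False then show ?thesis using Y_mono[of s u] assms u by simp
  qed
qed (use assms in auto)

lemma inf_X_Lipschitz: "0 \<le> s \<Longrightarrow> s \<le> t \<Longrightarrow> inf_X s - (t - s) \<le> inf_X t"
  using inf_X_lower[of s t] inf_X_le[of s s] by simp

lemma inf_X_cont: "continuous_on {0..} inf_X"
proof (rule continuous_onI)
  fix x e :: real assume x: "x \<in> {0..}" and e: "0 < e"
  have "dist (inf_X y) (inf_X x) \<le> e" if y: "y \<in> {0..}" "dist y x < e" for y
    using inf_X_Lipschitz[of x y] inf_X_Lipschitz[of y x] inf_X_antimono[of x y] inf_X_antimono[of y x] x y
    by (cases "x \<le> y") (auto simp: dist_real_def)
  then show "\<exists>d>0. \<forall>y\<in>{0..}. dist y x < d \<longrightarrow> dist (inf_X y) (inf_X x) \<le> e" using e by blast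
qed

lemma isCont_inf_X: "0 < s \<Longrightarrow> isCont inf_X s"
  using continuous_on_interior[OF inf_X_cont] by (simp add: interior_real_atLeast)

lemma W_nonneg: "0 \<le> t \<Longrightarrow> 0 \<le> W t"
  unfolding W_def using inf_X_le[of t t] by simp

lemma W_left:
  assumes s: "0 < s"
  shows "(W \<longlongrightarrow> Lim (at_left s) W) (at_left s)"
proof -
  have "(inf_X \<longlongrightarrow> inf_X s) (at_left s)"
    using isCont_inf_X[OF s] by (auto simp: continuous_within intro: tendsto_mono[OF at_le])
  then have "(W \<longlongrightarrow> Lim (at_left s) Y - s - inf_X s) (at_left s)"
    unfolding W_def by (intro tendsto_diff tendsto_ident_at mono_left_limit s Y_mono)
  then show ?thesis using tendsto_Lim[of "at_left s" W] by simp
qed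

lemma W_left_nonneg: "0 < s \<Longrightarrow> 0 \<le> Lim (at_left s) W"
proof -
  assume s: "0 < s"
  have "eventually (\<lambda>u. 0 \<le> W u) (at_left s)"
    unfolding eventually_at_left[OF s] using s by (auto intro!: exI[of _ 0] W_nonneg)
  then show ?thesis using W_left[OF s] by (intro tendsto_lowerbound[of W _ "at_left s"]) auto
qed

lemma W_left_eq:
  assumes s: "0 < s" and "isCont Y s"
  shows "Lim (at_left s) W = W s"
proof -
  have "isCont W s" unfolding W_def using assms isCont_inf_X[OF s] by (intro continuous_intros)
  then have "(W \<longlongrightarrow> W s) (at_left s)"
    by (auto simp: continuous_within intro: tendsto_mono[OF at_le])
  then show ?thesis by (intro tendsto_Lim) auto
qed

lemma countable_discont: "countable {s. 0 < s \<and> \<not> isCont Y s}"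
  using mono_on_ctble_discont_open[of "{0<..}" Y] Y_mono by (simp add: mono_on_def)

text \<open>Within a cell the free path falls at most \<open>h\<close> below its value at the left
  end. This error is combined with the previous one by a maximum and not by a sum, so the total
  error stays below \<open>h\<close> for all \<open>k\<close>.\<close>

lemma lindley_approx:
  assumes h: "0 < h"
  defines "\<xi> \<equiv> \<lambda>k. Y (real (Suc k) * h) - Y (real k * h) - h"
  shows "lindley \<xi> k \<le> W (real k * h) \<and> W (real k * h) \<le> lindley \<xi> k + h"
proof (induction k)
  case 0
  have "inf_X 0 = 0" by (simp add: inf_X_def Y_0)
  then show ?case using h by (simp add: W_def Y_0)
next
  case (Suc k)
  let ?s = "real k * h" and ?t = "real (Suc k) * h"
  have st: "0 \<le> ?s" "?s \<le> ?t" "?t - ?s = h" using h by (auto simp: algebra_simps)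
  have "W ?t = \<xi> k + Y ?s - ?s - inf_X ?t" using st(3) by (simp add: W_def \<xi>_def)
  moreover have "inf_X ?t \<le> inf_X ?s" by (rule inf_X_antimono[OF st(1,2)])
  moreover have "min (inf_X ?s) (Y ?s - ?s - h) \<le> inf_X ?t" using inf_X_lower[OF st(1,2)] st(3) by simp
  moreover have "0 \<le> W ?t" using st by (intro W_nonneg) linarith
  moreover have "W ?s = Y ?s - ?s - inf_X ?s" by (simp add: W_def)
  ultimately show ?case
    using Suc lindley_nonneg[of \<xi> k] h unfolding lindley.simps by linarith
qed

end

section \<open>The discretized workload\<close>

context subordinator_family
begin

lemma exponent_bounds:
  assumes a: "\<forall>i\<in>I. 0 \<le> a i" and int: "\<forall>i\<in>I. integrable M (X i 1)" and \<alpha>\<beta>: "0 \<le> \<alpha>" "\<alpha> \<le> \<beta>"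
  shows "exponent a \<alpha> \<le> exponent a \<beta>"
    and "exponent a \<beta> - exponent a \<alpha> \<le> (\<Sum>i\<in>I. a i * (\<integral>\<omega>. X i 1 \<omega> \<partial>M)) * (\<beta> - \<alpha>)"
proof -
  note sp = subordinator_process
  show "exponent a \<alpha> \<le> exponent a \<beta>"
    unfolding exponent_def using a \<alpha>\<beta> by (intro sum_mono mult_left_mono subordinator_process.\<eta>_mono[OF sp]) auto
  have "exponent a \<beta> - exponent a \<alpha> = (\<Sum>i\<in>I. a i * (laplace_exponent M (X i) \<beta> - laplace_exponent M (X i) \<alpha>))"
    by (simp add: exponent_def sum_subtractf right_diff_distrib)
  also have "\<dots> \<le> (\<Sum>i\<in>I. a i * ((\<integral>\<omega>. X i 1 \<omega> \<partial>M) * (\<beta> - \<alpha>)))"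
    using a int \<alpha>\<beta> by (intro sum_mono mult_left_mono subordinator_process.\<eta>_Lipschitz[OF sp]) auto
  also have "\<dots> = (\<Sum>i\<in>I. a i * (\<integral>\<omega>. X i 1 \<omega> \<partial>M)) * (\<beta> - \<alpha>)"
    by (simp add: sum_distrib_left sum_distrib_right mult_ac)
  finally show "exponent a \<beta> - exponent a \<alpha> \<le> (\<Sum>i\<in>I. a i * (\<integral>\<omega>. X i 1 \<omega> \<partial>M)) * (\<beta> - \<alpha>)" .
qed

lemma exponent_0: "exponent a 0 = 0"
  by (simp add: exponent_def subordinator_process.\<eta>_0[OF subordinator_process])

lemma exponent_derivative_0:
  assumes int: "\<forall>i\<in>I. integrable M (X i 1)"
  shows "((\<lambda>\<alpha>. exponent a \<alpha> / \<alpha>) \<longlongrightarrow> (\<Sum>i\<in>I. a i * (\<integral>\<omega>. X i 1 \<omega> \<partial>M))) (at_right 0)"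
proof -
  have "((\<lambda>\<alpha>. \<Sum>i\<in>I. a i * (laplace_exponent M (X i) \<alpha> / \<alpha>)) \<longlongrightarrow> (\<Sum>i\<in>I. a i * (\<integral>\<omega>. X i 1 \<omega> \<partial>M))) (at_right 0)"
    using int by (intro tendsto_sum tendsto_mult tendsto_const subordinator_process.\<eta>_derivative_0[OF subordinator_process]) auto
  then show ?thesis by (simp add: exponent_def sum_divide_distrib)
qed

end

locale queue = subordinator_family M I J
  for M :: "'a measure" and I :: "nat set" and J :: "nat \<Rightarrow> real \<Rightarrow> 'a \<Rightarrow> real" +
  fixes N :: nat
  assumes N: "N \<in> I" and integrable_J1: "\<forall>i\<in>I. integrable M (J i 1)"
    and stable: "(\<Sum>i\<in>I. \<integral>\<omega>. J i 1 \<omega> \<partial>M) < 1"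
begin

abbreviation Y :: "real \<Rightarrow> 'a \<Rightarrow> real" where "Y \<equiv> total (\<lambda>_. 1)"

lemma one_nonneg: "\<forall>i\<in>I. 0 \<le> (1::real)" by simp

definition \<phi> :: "real \<Rightarrow> real" where "\<phi> \<beta> = \<beta> - exponent (\<lambda>_. 1) \<beta>"

text \<open>This is 1 - \<rho>; \<open>\<phi>_derivative_0\<close> identifies it with the slope of
  \<phi> at 0.\<close>

definition \<delta> :: real where "\<delta> = 1 - (\<Sum>i\<in>I. \<integral>\<omega>. J i 1 \<omega> \<partial>M)"

lemma \<delta>_pos: "0 < \<delta>" using stable by (simp add: \<delta>_def)

lemma \<phi>_ge: "0 \<le> \<beta> \<Longrightarrow> \<delta> * \<beta> \<le> \<phi> \<beta>"
  using exponent_bounds(2)[OF one_nonneg integrable_J1, of 0 \<beta>]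
  by (simp add: \<phi>_def \<delta>_def exponent_0 left_diff_distrib)

lemma \<phi>_pos: "0 < \<beta> \<Longrightarrow> 0 < \<phi> \<beta>"
  using \<phi>_ge[of \<beta>] \<delta>_pos mult_pos_pos[of \<delta> \<beta>] by linarith

lemma \<phi>_derivative_0: "((\<lambda>\<gamma>. \<phi> \<gamma> / \<gamma>) \<longlongrightarrow> \<delta>) (at_right 0)"
proof -
  have "((\<lambda>\<gamma>. 1 - exponent (\<lambda>_. 1) \<gamma> / \<gamma>) \<longlongrightarrow> \<delta>) (at_right 0)"
    unfolding \<delta>_def using exponent_derivative_0[OF integrable_J1, of "\<lambda>_. 1"]
    by (intro tendsto_diff tendsto_const) simp
  moreover have "eventually (\<lambda>\<gamma>. 1 - exponent (\<lambda>_. 1) \<gamma> / \<gamma> = \<phi> \<gamma> / \<gamma>) (at_right 0)"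
    using eventually_at_right_less[of "0::real"]
    by eventually_elim (simp add: \<phi>_def diff_divide_distrib)
  ultimately show ?thesis by (rule Lim_transform_eventually)
qed

abbreviation Inc :: "real \<Rightarrow> nat \<Rightarrow> nat \<Rightarrow> 'a \<Rightarrow> real" where "Inc \<equiv> incr (\<lambda>_. 1)"
abbreviation T :: "real \<Rightarrow> nat \<Rightarrow> 'a \<Rightarrow> real" where "T \<equiv> total_incr (\<lambda>_. 1)"

definition Wd :: "real \<Rightarrow> nat \<Rightarrow> 'a \<Rightarrow> real" where
  "Wd h k \<omega> = lindley (\<lambda>j. T h j \<omega> - h) k"

text \<open>The amount cut off by the reflection in step \<open>k\<close>, so that partial sums are
  the idle time of the sampled queue.\<close>

definition idle :: "real \<Rightarrow> nat \<Rightarrow> 'a \<Rightarrow> real" where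
  "idle h k \<omega> = max 0 (- (Wd h k \<omega> + T h k \<omega> - h))"

definition u :: "real \<Rightarrow> real \<Rightarrow> nat \<Rightarrow> real" where
  "u h \<beta> k = (\<integral>\<omega>. exp (- \<beta> * Wd h k \<omega>) \<partial>M)"

definition EL :: "real \<Rightarrow> nat \<Rightarrow> real" where "EL h K = (\<Sum>k<K. \<integral>\<omega>. idle h k \<omega> \<partial>M)"

lemma Wd_nonneg: "0 \<le> Wd h k \<omega>"
  unfolding Wd_def by (rule lindley_nonneg)

lemma Wd_Suc: "Wd h (Suc k) \<omega> = max (Wd h k \<omega> + (T h k \<omega> - h)) 0"
  by (simp add: Wd_def)

context
  fixes h :: real assumes h: "0 < h"
begin

lemma h_nonneg: "0 \<le> h" using h by simp

lemma Inc_measurable [measurable]: "i \<in> I \<Longrightarrow> Inc h i k \<in> borel_measurable M"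
  unfolding incr_def[abs_def] using h
  by (intro borel_measurable_diff subordinator_process.measurable_X[OF subordinator_process]) auto

lemma Inc_nonneg: "i \<in> I \<Longrightarrow> \<omega> \<in> space M \<Longrightarrow> 0 \<le> Inc h i k \<omega>"
  unfolding incr_def using h subordinator_process.X_mono[OF subordinator_process, of i \<omega> "real k * h" "real (Suc k) * h"]
  by (simp add: mult_right_mono)

lemma T_measurable [measurable]: "T h k \<in> borel_measurable M"
  unfolding total_incr_def[abs_def] by (intro borel_measurable_sum Inc_measurable)

lemma T_nonneg: "\<omega> \<in> space M \<Longrightarrow> 0 \<le> T h k \<omega>"
  unfolding total_incr_def by (intro sum_nonneg Inc_nonneg)

lemma Wd_measurable [measurable]: "Wd h k \<in> borel_measurable M"
proof (induction k)
  case 0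
  then show ?case by (simp add: Wd_def[abs_def])
next
  case (Suc k)
  then have [measurable]: "Wd h k \<in> borel_measurable M" .
  have "Wd h (Suc k) = (\<lambda>\<omega>. max (Wd h k \<omega> + (T h k \<omega> - h)) 0)"
    by (simp add: Wd_Suc fun_eq_iff)
  then show ?case by simp
qed

lemma idle_measurable [measurable]: "idle h k \<in> borel_measurable M"
  unfolding idle_def[abs_def] by measurable

lemma idle_bounds: "\<omega> \<in> space M \<Longrightarrow> 0 \<le> idle h k \<omega> \<and> idle h k \<omega> \<le> h"
  using Wd_nonneg[of h k \<omega>] T_nonneg[of \<omega> k] h by (auto simp: idle_def)

lemma sum_idle: "(\<Sum>k<K. idle h k \<omega>) = Wd h K \<omega> - (\<Sum>k<K. T h k \<omega> - h)"
proof (induction K)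
  case 0
  then show ?case by (simp add: Wd_def)
next
  case (Suc K)
  then show ?case unfolding sum.lessThan_Suc Wd_Suc idle_def by (auto simp: max_def)
qed

lemma integrable_idle: "integrable M (idle h k)"
  by (rule integrable_const_bound[of _ h]) (use idle_bounds in auto)

context
  fixes \<beta> :: real assumes \<beta>: "0 < \<beta>"
begin

lemma integrable_exp_Wd: "integrable M (\<lambda>\<omega>. exp (- \<beta> * Wd h k \<omega>))"
  by (rule integrable_const_bound[of _ 1]) (use \<beta> Wd_nonneg in auto)

lemma u_bounds: "0 \<le> u h \<beta> k" "u h \<beta> k \<le> 1"
proof -
  show "0 \<le> u h \<beta> k" unfolding u_def by (rule integral_nonneg_AE) auto
  show "u h \<beta> k \<le> 1" unfolding u_def
    by (rule integral_le_const[OF integrable_exp_Wd]) (use \<beta> Wd_nonneg in auto)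
qed

text \<open>The sampled workload at \<open>k\<close> is determined by the increments in cells before
  \<open>k\<close>. \<open>G\<close> may be any function of the increments of all classes in cell
  \<open>k\<close>: it is applied to the total increment and to that of class \<open>N\<close>
  alone.\<close>

lemma exp_Wd_indep:
  assumes g: "g \<in> borel_measurable (Pi\<^sub>M (I \<times> {k}) (\<lambda>_. borel))"
    and G: "\<And>\<omega>. \<omega> \<in> space M \<Longrightarrow> G \<omega> = g (\<lambda>ik\<in>I \<times> {k}. Inc h (fst ik) (snd ik) \<omega>)"
    and int: "integrable M G"
  shows "(\<integral>\<omega>. exp (- \<beta> * Wd h k \<omega>) * G \<omega> \<partial>M) = u h \<beta> k * (\<integral>\<omega>. G \<omega> \<partial>M)"
    "integrable M (\<lambda>\<omega>. exp (- \<beta> * Wd h k \<omega>) * G \<omega>)"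
proof -
  let ?A = "I \<times> {..<k}" and ?Z = "\<lambda>ik. Inc h (fst ik) (snd ik)"
  define \<xi> where "\<xi> z j = (\<Sum>i\<in>I. z (i, j)) - h" for z :: "nat \<times> nat \<Rightarrow> real" and j
  have ind: "indep_vars (\<lambda>_. borel) ?Z (I \<times> UNIV)"
    using indep_incr[OF one_nonneg h_nonneg] by (simp add: case_prod_beta')
  have "(\<lambda>z. lindley (\<xi> z) j) \<in> borel_measurable (Pi\<^sub>M ?A (\<lambda>_. borel))" if "j \<le> k" for j
    using that
  proof (induction j)
    case (Suc j)
    have "(\<lambda>z. \<xi> z j) \<in> borel_measurable (Pi\<^sub>M ?A (\<lambda>_. borel))"
      unfolding \<xi>_def
      by (intro borel_measurable_diff borel_measurable_sum measurable_component_singleton borel_measurable_const) (use Suc in auto)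
    then show ?case using Suc by simp
  qed simp
  then have f: "(\<lambda>z. exp (- \<beta> * lindley (\<xi> z) k)) \<in> borel_measurable (Pi\<^sub>M ?A (\<lambda>_. borel))"
    by simp
  have F: "exp (- \<beta> * Wd h k \<omega>) = exp (- \<beta> * lindley (\<xi> (\<lambda>ik\<in>?A. ?Z ik \<omega>)) k)" for \<omega>
    unfolding Wd_def
    by (intro arg_cong[where f="\<lambda>x. exp (- \<beta> * x)"] lindley_cong) (auto simp: \<xi>_def total_incr_def intro!: sum.cong)
  note * = integral_mult_indep_blocks[OF ind _ _ _ f g _ _ integrable_exp_Wd[of k] int, OF _ _ _ F G]
  show "(\<integral>\<omega>. exp (- \<beta> * Wd h k \<omega>) * G \<omega> \<partial>M) = u h \<beta> k * (\<integral>\<omega>. G \<omega> \<partial>M)"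
    unfolding u_def by (rule *(1)) auto
  show "integrable M (\<lambda>\<omega>. exp (- \<beta> * Wd h k \<omega>) * G \<omega>)"
    by (rule *(2)) auto
qed

text \<open>Rests on exp (- \<beta> max z 0) = exp (- \<beta> z) - (exp (\<beta> max 0 (- z)) - 1),
  where z is the workload before reflection and the bracket is the effect of idling. The independent
  increment contributes the factor exp (h \<open>\<phi> \<beta>\<close>).\<close>

lemma u_Suc:
  "u h \<beta> (Suc k) = exp (h * \<phi> \<beta>) * u h \<beta> k - (\<integral>\<omega>. exp (\<beta> * idle h k \<omega>) - 1 \<partial>M)"
proof -
  have G: "exp (- \<beta> * T h k \<omega>) = exp (- \<beta> * (\<Sum>i\<in>I. (\<lambda>ik\<in>I \<times> {k}. Inc h (fst ik) (snd ik) \<omega>) (i, k)))" for \<omega>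
    by (simp add: total_incr_def)
  have g: "(\<lambda>z. exp (- \<beta> * (\<Sum>i\<in>I. z (i, k)))) \<in> borel_measurable (Pi\<^sub>M (I \<times> {k}) (\<lambda>_. borel))"
    by (intro measurable_compose[OF _ borel_measurable_exp] borel_measurable_times borel_measurable_const
        borel_measurable_sum measurable_component_singleton) auto
  note LT = laplace_total_incr[OF one_nonneg h_nonneg less_imp_le[OF \<beta>], of k]
  note EG = exp_Wd_indep[OF g G LT(2)]
  have int: "integrable M (\<lambda>\<omega>. exp (\<beta> * idle h k \<omega>) - 1)"
  proof (rule integrable_const_bound[of _ "exp (\<beta> * h)"])
    have "exp (\<beta> * idle h k \<omega>) - 1 \<le> exp (\<beta> * h) \<and> 0 \<le> exp (\<beta> * idle h k \<omega>) - 1" if "\<omega> \<in> space M" for \<omega>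
    proof -
      have "exp (\<beta> * idle h k \<omega>) \<le> exp (\<beta> * h)" "1 \<le> exp (\<beta> * idle h k \<omega>)" using idle_bounds[OF that, of k] \<beta> by auto
      then show ?thesis by linarith
    qed
    then show "AE \<omega> in M. norm (exp (\<beta> * idle h k \<omega>) - 1) \<le> exp (\<beta> * h)"
      by (intro AE_I2) (simp only: real_norm_def abs_of_nonneg)
  qed simp
  have "u h \<beta> (Suc k) = (\<integral>\<omega>. exp (\<beta> * h) * (exp (- \<beta> * Wd h k \<omega>) * exp (- \<beta> * T h k \<omega>)) - (exp (\<beta> * idle h k \<omega>) - 1) \<partial>M)"
    unfolding u_def
  proof (rule Bochner_Integration.integral_cong[OF refl])
    fix \<omega>
    show "exp (- \<beta> * Wd h (Suc k) \<omega>) = exp (\<beta> * h) * (exp (- \<beta> * Wd h k \<omega>) * exp (- \<beta> * T h k \<omega>)) - (exp (\<beta> * idle h k \<omega>) - 1)"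
      unfolding Wd_Suc idle_def exp_add[symmetric] by (auto simp: max_def algebra_simps)
  qed
  also have "\<dots> = exp (\<beta> * h) * (u h \<beta> k * exp (- h * exponent (\<lambda>_. 1) \<beta>)) - (\<integral>\<omega>. exp (\<beta> * idle h k \<omega>) - 1 \<partial>M)"
    using EG int LT(1) by simp
  also have "exp (\<beta> * h) * (u h \<beta> k * exp (- h * exponent (\<lambda>_. 1) \<beta>)) = exp (h * \<phi> \<beta>) * u h \<beta> k"
    by (simp add: \<phi>_def exp_add[symmetric] right_diff_distrib exp_diff exp_minus field_simps)
  finally show ?thesis .
qed

lemma u_telescope: "u h \<beta> K - 1 = (exp (h * \<phi> \<beta>) - 1) * (\<Sum>k<K. u h \<beta> k) - (\<Sum>k<K. \<integral>\<omega>. exp (\<beta> * idle h k \<omega>) - 1 \<partial>M)"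
proof (induction K)
  case 0
  then show ?case by (simp add: u_def Wd_def prob_space)
next
  case (Suc K)
  then show ?case by (simp add: u_Suc algebra_simps)
qed

text \<open>Idle time per cell is at most \<open>h\<close>, so the exponential is linear up to a
  factor exp (\<beta> h), which tends to 1 with the mesh. In this way \<open>u\<close> is tied to
  \<open>EL\<close>, a quantity free of \<beta>, and bounds can be carried from one exponent to
  another.\<close>

lemma exp_idle_bounds:
  "\<beta> * (\<integral>\<omega>. idle h k \<omega> \<partial>M) \<le> (\<integral>\<omega>. exp (\<beta> * idle h k \<omega>) - 1 \<partial>M)"
  "(\<integral>\<omega>. exp (\<beta> * idle h k \<omega>) - 1 \<partial>M) \<le> exp (\<beta> * h) * \<beta> * (\<integral>\<omega>. idle h k \<omega> \<partial>M)"
proof -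
  have le: "\<beta> * idle h k \<omega> \<le> exp (\<beta> * idle h k \<omega>) - 1" "exp (\<beta> * idle h k \<omega>) - 1 \<le> exp (\<beta> * h) * \<beta> * idle h k \<omega>"
    if "\<omega> \<in> space M" for \<omega>
  proof -
    let ?x = "\<beta> * idle h k \<omega>"
    have x: "0 \<le> ?x" "?x \<le> \<beta> * h" using idle_bounds[OF that, of k] \<beta> by auto
    show "?x \<le> exp ?x - 1" using exp_ge_add_one_self[of ?x] by linarith
    have "exp ?x - 1 = exp ?x * (1 - exp (- ?x))" by (simp add: algebra_simps exp_minus)
    also have "\<dots> \<le> exp (\<beta> * h) * ?x"
      using exp_ge_add_one_self[of "- ?x"] x by (intro mult_mono) auto
    finally show "exp ?x - 1 \<le> exp (\<beta> * h) * \<beta> * idle h k \<omega>" by (simp add: mult_ac)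
  qed
  have int: "integrable M (\<lambda>\<omega>. exp (\<beta> * idle h k \<omega>) - 1)"
  proof (rule Bochner_Integration.integrable_bound)
    show "integrable M (\<lambda>\<omega>. exp (\<beta> * h) * \<beta> * idle h k \<omega>)" using integrable_idle by simp
    show "AE \<omega> in M. norm (exp (\<beta> * idle h k \<omega>) - 1) \<le> norm (exp (\<beta> * h) * \<beta> * idle h k \<omega>)"
      using le idle_bounds \<beta> by (intro AE_I2) (force simp: abs_of_nonneg)
  qed simp
  have "(\<integral>\<omega>. \<beta> * idle h k \<omega> \<partial>M) \<le> (\<integral>\<omega>. exp (\<beta> * idle h k \<omega>) - 1 \<partial>M)"
    by (rule integral_mono) (use integrable_idle int le in auto)
  then show "\<beta> * (\<integral>\<omega>. idle h k \<omega> \<partial>M) \<le> (\<integral>\<omega>. exp (\<beta> * idle h k \<omega>) - 1 \<partial>M)" by simp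
  have "(\<integral>\<omega>. exp (\<beta> * idle h k \<omega>) - 1 \<partial>M) \<le> (\<integral>\<omega>. exp (\<beta> * h) * \<beta> * idle h k \<omega> \<partial>M)"
    by (rule integral_mono) (use integrable_idle int le in auto)
  then show "(\<integral>\<omega>. exp (\<beta> * idle h k \<omega>) - 1 \<partial>M) \<le> exp (\<beta> * h) * \<beta> * (\<integral>\<omega>. idle h k \<omega> \<partial>M)" by simp
qed

lemma EL_bounds:
  "\<beta> * EL h K \<le> (exp (h * \<phi> \<beta>) - 1) * (\<Sum>k<K. u h \<beta> k) + 1 - u h \<beta> K"
  "(exp (h * \<phi> \<beta>) - 1) * (\<Sum>k<K. u h \<beta> k) + 1 - u h \<beta> K \<le> exp (\<beta> * h) * \<beta> * EL h K"
proof -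
  have eq: "(exp (h * \<phi> \<beta>) - 1) * (\<Sum>k<K. u h \<beta> k) + 1 - u h \<beta> K = (\<Sum>k<K. \<integral>\<omega>. exp (\<beta> * idle h k \<omega>) - 1 \<partial>M)"
    using u_telescope[of K] by linarith
  show "\<beta> * EL h K \<le> (exp (h * \<phi> \<beta>) - 1) * (\<Sum>k<K. u h \<beta> k) + 1 - u h \<beta> K"
    unfolding eq unfolding EL_def sum_distrib_left by (intro sum_mono exp_idle_bounds)
  show "(exp (h * \<phi> \<beta>) - 1) * (\<Sum>k<K. u h \<beta> k) + 1 - u h \<beta> K \<le> exp (\<beta> * h) * \<beta> * EL h K"
    unfolding eq unfolding EL_def sum_distrib_left by (intro sum_mono exp_idle_bounds)
qed

end

text \<open>The remaining workload is nonnegative, so total idle time is at least elapsed time minus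
  input; the mean of the latter difference is \<delta> per unit time.\<close>

lemma EL_ge: "\<delta> * (real K * h) \<le> EL h K"
proof -
  note sp = subordinator_process
  have intY: "integrable M (Y t)" "(\<integral>\<omega>. Y t \<omega> \<partial>M) = t * (1 - \<delta>)" if "0 \<le> t" for t
  proof -
    have *: "integrable M (J i t)" "(\<integral>\<omega>. J i t \<omega> \<partial>M) = t * (\<integral>\<omega>. J i 1 \<omega> \<partial>M)" if "i \<in> I" for i
      using subordinator_process.integrable_X[OF sp[OF that] _ \<open>0 \<le> t\<close>]
        subordinator_process.expectation_X[OF sp[OF that] _ \<open>0 \<le> t\<close>] integrable_J1 that by auto
    show "integrable M (Y t)" unfolding total_def[abs_def] using * by simp
    show "(\<integral>\<omega>. Y t \<omega> \<partial>M) = t * (1 - \<delta>)"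
      unfolding total_def using * by (simp add: \<delta>_def sum_distrib_left)
  qed
  have Kh: "0 \<le> real K * h" using h by simp
  have "\<delta> * (real K * h) = (\<integral>\<omega>. real K * h - Y (real K * h) \<omega> \<partial>M)"
    using intY[OF Kh] by (simp add: prob_space algebra_simps)
  also have "\<dots> \<le> (\<integral>\<omega>. (\<Sum>k<K. idle h k \<omega>) \<partial>M)"
  proof (rule integral_mono)
    show "integrable M (\<lambda>\<omega>. real K * h - Y (real K * h) \<omega>)" using intY[OF Kh] by simp
    show "integrable M (\<lambda>\<omega>. \<Sum>k<K. idle h k \<omega>)" using integrable_idle by simp
    fix \<omega> assume "\<omega> \<in> space M"
    then show "real K * h - Y (real K * h) \<omega> \<le> (\<Sum>k<K. idle h k \<omega>)"
      unfolding sum_idle using Wd_nonneg[of h K \<omega>] total_eq_sum[OF one_nonneg, of \<omega> K h]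
      by (simp add: sum_subtractf)
  qed
  also have "\<dots> = EL h K" unfolding EL_def by (rule Bochner_Integration.integral_sum) (rule integrable_idle)
  finally show ?thesis .
qed

text \<open>The boundary term \<open>1 - u h \<beta> K\<close> of the telescoped recursion lies in
  [0, 1]. It accounts for the - 1, which disappears on division by time.\<close>

lemma sum_u_lower:
  assumes \<beta>: "0 < \<beta>"
  shows "\<beta> * (\<delta> * (real K * h)) - 1 \<le> (exp (h * \<phi> \<beta>) - 1) * (\<Sum>k<K. u h \<beta> k)"
  using EL_bounds(1)[OF \<beta>, of K] mult_left_mono[OF EL_ge[of K], of \<beta>] \<beta> u_bounds(1)[OF \<beta>, of K]
  by linarith

lemma sum_u_upper:
  assumes \<beta>: "0 < \<beta>" and \<gamma>: "0 < \<gamma>"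
  shows "(exp (h * \<phi> \<beta>) - 1) * (\<Sum>k<K. u h \<beta> k) \<le>
    exp (\<beta> * h) * \<beta> * (((exp (h * \<phi> \<gamma>) - 1) * real K + 1) / \<gamma>)"
proof -
  have "(\<Sum>k<K. u h \<gamma> k) \<le> real K"
    using sum_mono[of "{..<K}" "u h \<gamma>" "\<lambda>_. 1"] u_bounds(2)[OF \<gamma>] by simp
  then have "(exp (h * \<phi> \<gamma>) - 1) * (\<Sum>k<K. u h \<gamma> k) \<le> (exp (h * \<phi> \<gamma>) - 1) * real K"
    using h \<phi>_pos[OF \<gamma>] by (intro mult_left_mono) auto
  then have "\<gamma> * EL h K \<le> (exp (h * \<phi> \<gamma>) - 1) * real K + 1"
    using EL_bounds(1)[OF \<gamma>, of K] u_bounds(1)[OF \<gamma>, of K] by linarith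
  then have EL: "EL h K \<le> ((exp (h * \<phi> \<gamma>) - 1) * real K + 1) / \<gamma>"
    using \<gamma> by (simp add: pos_le_divide_eq mult.commute)
  have "(exp (h * \<phi> \<beta>) - 1) * (\<Sum>k<K. u h \<beta> k) \<le> exp (\<beta> * h) * \<beta> * EL h K"
    using EL_bounds(2)[OF \<beta>, of K] u_bounds(2)[OF \<beta>, of K] by linarith
  also have "\<dots> \<le> exp (\<beta> * h) * \<beta> * (((exp (h * \<phi> \<gamma>) - 1) * real K + 1) / \<gamma>)"
    using \<beta> EL by (intro mult_left_mono) auto
  finally show ?thesis .
qed

end
end

section \<open>Time averages of the workload\<close>

text \<open>For \<beta> > 0 and x \<ge> 0 this is the integral of exp (- \<beta> y) over y in
  [0, x], the contribution of a batch of size x that finds no workload.\<close>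

definition eps :: "real \<Rightarrow> real \<Rightarrow> real" where
  "eps \<beta> x = (1 - exp (- \<beta> * x)) / \<beta>"

lemma eps_bounds: "0 < \<beta> \<Longrightarrow> 0 \<le> x \<Longrightarrow> 0 \<le> eps \<beta> x \<and> eps \<beta> x \<le> x"
  using exp_ge_add_one_self[of "- \<beta> * x"] by (auto simp: eps_def divide_le_eq mult.commute)

lemma eps_div_bounds: "0 < \<beta> \<Longrightarrow> 0 \<le> x \<Longrightarrow> 0 \<le> eps \<beta> x / x \<and> eps \<beta> x / x \<le> 1"
  using eps_bounds[of \<beta> x] by (auto simp: divide_le_eq)

lemma eps_div_tendsto: "0 < \<beta> \<Longrightarrow> ((\<lambda>x. eps \<beta> x / x) \<longlongrightarrow> 1) (at_right 0)"
  unfolding eps_def by real_asymp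

lemma eps_Suc_tendsto: "(\<lambda>j. eps (real (Suc j)) x) \<longlonglongrightarrow> 0" if "0 \<le> x" for x
proof (rule Lim_null_comparison)
  show "\<forall>\<^sub>F j in sequentially. norm (eps (real (Suc j)) x) \<le> 1 / real (Suc j)"
  proof (intro always_eventually allI)
    fix j
    have "0 \<le> real (Suc j) * x" using that by simp
    then have "exp (- real (Suc j) * x) \<le> 1" unfolding mult_minus_left by simp
    then have "\<bar>1 - exp (- real (Suc j) * x)\<bar> \<le> 1" by (simp add: abs_le_iff del: of_nat_Suc)
    then show "norm (eps (real (Suc j)) x) \<le> 1 / real (Suc j)"
      unfolding eps_def real_norm_def abs_divide by (intro frac_le) auto
  qed
  show "(\<lambda>j. 1 / real (Suc j)) \<longlonglongrightarrow> 0" by real_asymp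
qed

text \<open>Division by zero gives the value 0 at 0, and this agrees with the limit 1 - 1 of the two
  quotients. A single quotient would be discontinuous there, which is why only differences enter
  \<open>stieltjes_limit\<close>.\<close>

lemma eps_diff_cont:
  assumes "0 < \<beta>" "0 < \<gamma>"
  shows "continuous_on {0..} (\<lambda>x. (eps \<beta> x - eps \<gamma> x) / x)"
  unfolding continuous_on_eq_continuous_within
proof
  fix x :: real assume x: "x \<in> {0..}"
  show "continuous (at x within {0..}) (\<lambda>x. (eps \<beta> x - eps \<gamma> x) / x)"
  proof (cases "x = 0")
    case True
    have "((\<lambda>x. eps \<beta> x / x - eps \<gamma> x / x) \<longlongrightarrow> 1 - 1) (at_right 0)"
      by (intro tendsto_diff eps_div_tendsto assms)
    then show ?thesis using True by (simp add: continuous_within at_within_atLeast diff_divide_distrib)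
  next
    case False
    then show ?thesis unfolding eps_def using assms by (intro continuous_intros) auto
  qed
qed

lemma eps_diff_le:
  assumes "0 < \<beta>" "0 < \<gamma>" "0 \<le> x"
  shows "\<bar>(eps \<beta> x - eps \<gamma> x) / x\<bar> \<le> 1"
  using eps_div_bounds[OF assms(1,3)] eps_div_bounds[OF assms(2,3)] by (simp add: diff_divide_distrib abs_le_iff)

lemma exp_neg_Lipschitz:
  fixes x y :: real assumes "0 \<le> x" "0 \<le> y" shows "\<bar>exp (- x) - exp (- y)\<bar> \<le> \<bar>x - y\<bar>"
proof -
  have *: "exp (- a) - exp (- b) \<le> b - a" if "0 \<le> a" "a \<le> b" for a b :: real
  proof -
    have "exp (- a) - exp (- b) = exp (- a) * (1 - exp (- (b - a)))" by (simp add: algebra_simps exp_add[symmetric])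
    also have "\<dots> \<le> 1 * (b - a)"
    proof (rule mult_mono)
      show "1 - exp (- (b - a)) \<le> b - a" using exp_ge_add_one_self[of "- (b - a)"] by linarith
    qed (use that in auto)
    finally show ?thesis by simp
  qed
  show ?thesis using *[of x y] *[of y x] assms by (cases "x \<le> y") auto
qed

lemma tendsto_from_left_exp:
  fixes W :: "real \<Rightarrow> real"
  assumes "(W \<longlongrightarrow> l) (at_left s)" shows "((\<lambda>t. exp (- \<beta> * W t)) \<longlongrightarrow> exp (- \<beta> * l)) (at_left (s::real))"
  by (intro tendsto_exp tendsto_mult tendsto_const assms)

context queue
begin

abbreviation step :: "nat \<Rightarrow> real" where "step m \<equiv> 1 / real (Suc m)"

abbreviation Wp :: "'a \<Rightarrow> real \<Rightarrow> real" where "Wp \<omega> \<equiv> reflected_path.W (\<lambda>t. Y t \<omega>)"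

abbreviation Wl :: "'a \<Rightarrow> real \<Rightarrow> real" where "Wl \<omega> s \<equiv> Lim (at_left s) (Wp \<omega>)"

abbreviation JN :: "'a \<Rightarrow> real \<Rightarrow> real" where "JN \<omega> t \<equiv> J N t \<omega>"

abbreviation JNl :: "'a \<Rightarrow> real \<Rightarrow> real" where "JNl \<omega> s \<equiv> Lim (at_left s) (JN \<omega>)"

abbreviation dJ :: "'a \<Rightarrow> real \<Rightarrow> real" where "dJ \<omega> s \<equiv> JN \<omega> s - JNl \<omega> s"

text \<open>The maximum with 0 extends the path to a nondecreasing right-continuous function on the
  whole line, as \<open>interval_measure\<close> requires.\<close>

definition \<mu>N :: "'a \<Rightarrow> real measure" where "\<mu>N \<omega> = interval_measure (\<lambda>t. JN \<omega> (max 0 t))"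

sublocale N: subordinator_process M "J N"
  by (rule subordinator_process[OF N])

lemma integrable_JN: "integrable M (J N (real n))"
  by (rule N.integrable_X[OF bspec[OF integrable_J1 N]]) simp

lemma reflected_path: "\<omega> \<in> space M \<Longrightarrow> reflected_path (\<lambda>t. Y t \<omega>)"
  by unfold_locales (auto intro: total_mono[OF one_nonneg] total_right_cont[OF one_nonneg] simp: total_0[OF one_nonneg])

lemma stieltjes_N: "\<omega> \<in> space M \<Longrightarrow> stieltjes (JN \<omega>) (\<mu>N \<omega>)"
proof unfold_locales
  assume \<omega>: "\<omega> \<in> space M"
  let ?G = "\<lambda>t. JN \<omega> (max 0 t)"
  have right: "(JN \<omega> \<longlongrightarrow> JN \<omega> t) (at_right t)" if "0 \<le> t" for t
    using N.X_right_cont[OF \<omega> that] by (simp add: continuous_within)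
  then show "(JN \<omega> \<longlongrightarrow> JN \<omega> t) (at_right t)" if "0 \<le> t" for t using that .
  show "JN \<omega> s \<le> JN \<omega> t" if "0 \<le> s" "s \<le> t" for s t using N.X_mono[OF \<omega> that] .
  show "sets (\<mu>N \<omega>) = sets borel" by (simp add: \<mu>N_def)
  have mono: "?G x \<le> ?G y" if "x \<le> y" for x y
    using that by (intro N.X_mono[OF \<omega>]) auto
  have cont: "continuous (at_right a) ?G" for a
  proof (cases "0 \<le> a")
    case True
    have "eventually (\<lambda>t. JN \<omega> t = ?G t) (at_right a)"
      using eventually_at_right_less[of a] by eventually_elim (use True in auto)
    then show ?thesis using right[OF True] True unfolding continuous_within
      by (simp add: Lim_transform_eventually)
  next
    case False
    then have "eventually (\<lambda>t. ?G a = ?G t) (at_right a)"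
      unfolding eventually_at_right_field by (intro exI[of _ 0]) auto
    then show ?thesis unfolding continuous_within by (rule Lim_transform_eventually[OF tendsto_const])
  qed
  show "emeasure (\<mu>N \<omega>) {a<..b} = ennreal (JN \<omega> b - JN \<omega> a)" if "0 \<le> a" "a \<le> b" for a b
    unfolding \<mu>N_def using emeasure_interval_measure_Ioc[of a b ?G] mono cont that by simp
qed

lemma stieltjes_id: "stieltjes (\<lambda>t. t) lborel"
  by unfold_locales (auto intro: tendsto_ident_at)

context
  fixes \<beta> :: real assumes \<beta>: "0 < \<beta>"
begin

lemma step_pos: "0 < step m" by simp

definition em :: "'a \<Rightarrow> nat \<Rightarrow> nat \<Rightarrow> real" where "em \<omega> m k = exp (- \<beta> * Wd (step m) k \<omega>)"

lemma em_le: "\<bar>em \<omega> m k\<bar> \<le> 1"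
  unfolding em_def using \<beta> Wd_nonneg[of "step m" k \<omega>] by simp

lemma em_approx:
  assumes \<omega>: "\<omega> \<in> space M"
  shows "\<bar>em \<omega> m k - exp (- \<beta> * Wp \<omega> (real k / real (Suc m)))\<bar> \<le> \<beta> / real (Suc m)"
proof -
  interpret reflected_path "\<lambda>t. Y t \<omega>" by (rule reflected_path[OF \<omega>])
  have T: "Y (real (Suc k) * step m) \<omega> - Y (real k * step m) \<omega> - step m = total_incr (\<lambda>_. 1) (step m) k \<omega> - step m" for k
    using total_Suc[of "\<lambda>_. 1" k "step m" \<omega>] by simp
  have le: "Wd (step m) k \<omega> \<le> Wp \<omega> (real k * step m) \<and> Wp \<omega> (real k * step m) \<le> Wd (step m) k \<omega> + step m"
    using lindley_approx[of "step m" k] unfolding T Wd_def by simp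
  have "\<bar>exp (- (\<beta> * Wd (step m) k \<omega>)) - exp (- (\<beta> * Wp \<omega> (real k * step m)))\<bar>
      \<le> \<bar>\<beta> * Wd (step m) k \<omega> - \<beta> * Wp \<omega> (real k * step m)\<bar>"
    using \<beta> Wd_nonneg[of "step m" k \<omega>] le by (intro exp_neg_Lipschitz) (auto intro!: mult_nonneg_nonneg)
  also have "\<dots> = \<beta> * (Wp \<omega> (real k * step m) - Wd (step m) k \<omega>)"
    using le \<beta> by (simp add: abs_mult abs_le_iff right_diff_distrib[symmetric])
  also have "\<dots> \<le> \<beta> * step m" using le \<beta> by (intro mult_left_mono) auto
  finally show ?thesis by (simp add: em_def)
qed

lemma exp_W_left:
  assumes \<omega>: "\<omega> \<in> space M" and s: "0 < s"
  shows "((\<lambda>t. exp (- \<beta> * Wp \<omega> t)) \<longlongrightarrow> exp (- \<beta> * Wl \<omega> s)) (at_left s)"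
  by (rule tendsto_from_left_exp[OF reflected_path.W_left[OF reflected_path[OF \<omega>] s]])

text \<open>Left limits arise because grid values are taken at the left ends of the cells; they
  differ from the workload only on a Lebesgue null set.\<close>

definition occ :: "nat \<Rightarrow> 'a \<Rightarrow> real" where
  "occ n \<omega> = (\<integral>s. indicator {0<..real n} s * exp (- \<beta> * Wl \<omega> s) \<partial>lborel)"

lemma occ_limit:
  assumes \<omega>: "\<omega> \<in> space M"
  shows "(\<lambda>m. \<Sum>k<n * Suc m. em \<omega> m k * step m) \<longlonglongrightarrow> occ n \<omega>"
    and "(\<lambda>s. indicator {0<..real n} s * exp (- \<beta> * Wl \<omega> s)) \<in> borel_measurable lborel"
proof -
  interpret stieltjes "\<lambda>t. t" lborel by (rule stieltjes_id)
  note * = stieltjes_limit[OF exp_W_left[OF \<omega>] em_le em_approx[OF \<omega>], of "\<lambda>_. 1" n]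
  have "\<Delta> m k = step m" for m k by (simp add: \<Delta>_def diff_divide_distrib[symmetric])
  then show "(\<lambda>m. \<Sum>k<n * Suc m. em \<omega> m k * step m) \<longlonglongrightarrow> occ n \<omega>"
    unfolding occ_def using *(1) by simp
  show "(\<lambda>s. indicator {0<..real n} s * exp (- \<beta> * Wl \<omega> s)) \<in> borel_measurable lborel"
    using *(2) by simp
qed

lemma em_measurable [measurable]: "(\<lambda>\<omega>. em \<omega> m k) \<in> borel_measurable M"
  unfolding em_def using Wd_measurable[OF step_pos] by measurable

lemma occ_measurable [measurable]: "occ n \<in> borel_measurable M"
  by (rule borel_measurable_LIMSEQ_real[OF occ_limit(1)]) measurable

lemma sum_em_bounds: "0 \<le> (\<Sum>k<n * Suc m. em \<omega> m k * step m)" "(\<Sum>k<n * Suc m. em \<omega> m k * step m) \<le> real n"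
proof -
  show "0 \<le> (\<Sum>k<n * Suc m. em \<omega> m k * step m)" by (intro sum_nonneg) (simp add: em_def)
  have "(\<Sum>k<n * Suc m. em \<omega> m k * step m) \<le> (\<Sum>k<n * Suc m. 1 * step m)"
    using em_le by (intro sum_mono mult_right_mono) (auto simp: abs_le_iff)
  also have "\<dots> = real n" using grid_end[of n m] by simp
  finally show "(\<Sum>k<n * Suc m. em \<omega> m k * step m) \<le> real n" .
qed

lemma occ_bounds: "\<omega> \<in> space M \<Longrightarrow> 0 \<le> occ n \<omega> \<and> occ n \<omega> \<le> real n"
  using LIMSEQ_le_const[OF occ_limit(1)] LIMSEQ_le_const2[OF occ_limit(1)] sum_em_bounds by blast

lemma integrable_occ: "integrable M (occ n)"
  by (rule integrable_const_bound[of _ "real n"]) (use occ_bounds in auto)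

lemma sum_u_limit: "(\<lambda>m. (\<Sum>k<n * Suc m. u (step m) \<beta> k) * step m) \<longlonglongrightarrow> (\<integral>\<omega>. occ n \<omega> \<partial>M)"
proof -
  have "(\<lambda>m. \<integral>\<omega>. (\<Sum>k<n * Suc m. em \<omega> m k * step m) \<partial>M) \<longlonglongrightarrow> (\<integral>\<omega>. occ n \<omega> \<partial>M)"
  proof (rule integral_dominated_convergence[where w="\<lambda>_. real n"])
    show "AE \<omega> in M. (\<lambda>m. \<Sum>k<n * Suc m. em \<omega> m k * step m) \<longlonglongrightarrow> occ n \<omega>"
      using occ_limit by (intro AE_I2)
    show "AE \<omega> in M. norm (\<Sum>k<n * Suc m. em \<omega> m k * step m) \<le> real n" for m
      using sum_em_bounds[where m=m and n=n] by (intro AE_I2) (simp only: real_norm_def abs_of_nonneg)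
  qed auto
  also have "(\<lambda>m. \<integral>\<omega>. (\<Sum>k<n * Suc m. em \<omega> m k * step m) \<partial>M) = (\<lambda>m. (\<Sum>k<n * Suc m. u (step m) \<beta> k) * step m)"
  proof
    fix m
    have "integrable M (\<lambda>\<omega>. em \<omega> m k)" for k
      unfolding em_def by (rule integrable_exp_Wd[OF step_pos \<beta>])
    then show "(\<integral>\<omega>. (\<Sum>k<n * Suc m. em \<omega> m k * step m) \<partial>M) = (\<Sum>k<n * Suc m. u (step m) \<beta> k) * step m"
      by (simp add: u_def em_def sum_divide_distrib del: mult_Suc_right)
  qed
  finally show ?thesis .
qed

lemma tendsto_scaled_exp': "(\<lambda>m. (exp (step m * x) - 1) * real (Suc m)) \<longlonglongrightarrow> x"
  by real_asymp

lemma occ_lower: "\<beta> * \<delta> * real n - 1 \<le> \<phi> \<beta> * (\<integral>\<omega>. occ n \<omega> \<partial>M)"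
proof -
  have lim: "(\<lambda>m. ((exp (step m * \<phi> \<beta>) - 1) * real (Suc m)) * ((\<Sum>k<n * Suc m. u (step m) \<beta> k) * step m))
      \<longlonglongrightarrow> \<phi> \<beta> * (\<integral>\<omega>. occ n \<omega> \<partial>M)"
    by (intro tendsto_mult tendsto_scaled_exp' sum_u_limit)
  have "\<beta> * \<delta> * real n - 1 \<le> ((exp (step m * \<phi> \<beta>) - 1) * real (Suc m)) * ((\<Sum>k<n * Suc m. u (step m) \<beta> k) * step m)" for m
  proof -
    have "real (n * Suc m) * step m = real n" using grid_end[of n m] by simp
    then show ?thesis using sum_u_lower[OF step_pos[of m] \<beta>, of "n * Suc m"] by (simp add: mult_ac)
  qed
  then show ?thesis by (intro LIMSEQ_le_const[OF lim]) blast
qed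

lemma occ_upper:
  assumes \<gamma>: "0 < \<gamma>"
  shows "\<phi> \<beta> * (\<integral>\<omega>. occ n \<omega> \<partial>M) \<le> \<beta> * ((\<phi> \<gamma> * real n + 1) / \<gamma>)"
proof -
  have lim: "(\<lambda>m. ((exp (step m * \<phi> \<beta>) - 1) * real (Suc m)) * ((\<Sum>k<n * Suc m. u (step m) \<beta> k) * step m))
      \<longlonglongrightarrow> \<phi> \<beta> * (\<integral>\<omega>. occ n \<omega> \<partial>M)"
    by (intro tendsto_mult tendsto_scaled_exp' sum_u_limit)
  have lim2: "(\<lambda>m. exp (\<beta> * step m) * \<beta> * ((((exp (step m * \<phi> \<gamma>) - 1) * real (Suc m)) * real n + 1) / \<gamma>))
      \<longlonglongrightarrow> 1 * \<beta> * ((\<phi> \<gamma> * real n + 1) / \<gamma>)"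
  proof (intro tendsto_mult tendsto_divide tendsto_add tendsto_const tendsto_scaled_exp')
    show "(\<lambda>m. exp (\<beta> * step m)) \<longlonglongrightarrow> 1" by real_asymp
  qed (use \<gamma> in auto)
  have "((exp (step m * \<phi> \<beta>) - 1) * real (Suc m)) * ((\<Sum>k<n * Suc m. u (step m) \<beta> k) * step m)
      \<le> exp (\<beta> * step m) * \<beta> * ((((exp (step m * \<phi> \<gamma>) - 1) * real (Suc m)) * real n + 1) / \<gamma>)" for m
    using sum_u_upper[OF step_pos[of m] \<beta> \<gamma>, of "n * Suc m"] unfolding of_nat_mult by (simp add: mult_ac del: of_nat_Suc)
  then show ?thesis using LIMSEQ_le[OF lim lim2] by simp
qed

lemma occ_mean_limit: "(\<lambda>n. (\<integral>\<omega>. occ n \<omega> \<partial>M) / real n) \<longlonglongrightarrow> \<beta> * \<delta> / \<phi> \<beta>"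
proof -
  let ?G = "\<lambda>n. \<integral>\<omega>. occ n \<omega> \<partial>M"
  have "(\<lambda>n. \<phi> \<beta> * ?G n / real n) \<longlonglongrightarrow> \<beta> * \<delta>"
  proof (rule LIMSEQ_I)
    fix e :: real assume e: "0 < e"
    have "((\<lambda>\<gamma>. \<beta> * (\<phi> \<gamma> / \<gamma>)) \<longlongrightarrow> \<beta> * \<delta>) (at_right 0)" by (intro tendsto_mult tendsto_const \<phi>_derivative_0)
    then have "eventually (\<lambda>\<gamma>. \<beta> * (\<phi> \<gamma> / \<gamma>) < \<beta> * \<delta> + e / 2) (at_right 0)"
      using e by (intro order_tendstoD) auto
    then have "eventually (\<lambda>\<gamma>. \<beta> * (\<phi> \<gamma> / \<gamma>) < \<beta> * \<delta> + e / 2 \<and> 0 < \<gamma>) (at_right 0)"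
      using eventually_at_right_less[of "0::real"] by eventually_elim auto
    \<comment> \<open>\<gamma> is fixed before n: it brings
      \<open>\<phi> \<gamma> / \<gamma>\<close> close to \<delta>, and the remaining error \<beta> /
      (\<gamma> n) is small for large n.\<close>
    then obtain \<gamma> where \<gamma>: "\<beta> * (\<phi> \<gamma> / \<gamma>) < \<beta> * \<delta> + e / 2" "0 < \<gamma>"
      using eventually_happens'[OF trivial_limit_at_right_real] by blast
    have l1: "(\<lambda>n. (\<beta> / \<gamma>) * (1 / real n)) \<longlonglongrightarrow> 0" by real_asymp
    have l2: "(\<lambda>n. 1 / real n) \<longlonglongrightarrow> 0" by real_asymp
    have "eventually (\<lambda>n. (\<beta> / \<gamma>) * (1 / real n) < e / 2 \<and> 1 / real n < e \<and> 0 < n) sequentially"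
      using e by (intro eventually_conj order_tendstoD(2)[OF l1] order_tendstoD(2)[OF l2] eventually_gt_at_top) auto
    then have "eventually (\<lambda>n. norm (\<phi> \<beta> * ?G n / real n - \<beta> * \<delta>) < e) sequentially"
    proof eventually_elim
      case (elim n)
      then have n: "0 < real n" by simp
      have "\<beta> * \<delta> - 1 / real n = (\<beta> * \<delta> * real n - 1) / real n" using n by (simp add: field_simps)
      also have "\<dots> \<le> \<phi> \<beta> * ?G n / real n" using occ_lower[of n] n by (intro divide_right_mono) auto
      finally have 1: "\<beta> * \<delta> - 1 / real n \<le> \<phi> \<beta> * ?G n / real n" .
      have "\<phi> \<beta> * ?G n / real n \<le> \<beta> * ((\<phi> \<gamma> * real n + 1) / \<gamma>) / real n"
        using occ_upper[OF \<gamma>(2), of n] n by (intro divide_right_mono) auto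
      also have "\<dots> = \<beta> * (\<phi> \<gamma> / \<gamma>) + (\<beta> / \<gamma>) * (1 / real n)" using n \<gamma>(2) by (simp add: field_simps)
      finally show ?case using 1 elim \<gamma>(1) unfolding real_norm_def abs_less_iff by linarith
    qed
    then show "\<exists>no. \<forall>n\<ge>no. norm (\<phi> \<beta> * ?G n / real n - \<beta> * \<delta>) < e" unfolding eventually_sequentially .
  qed
  from tendsto_divide[OF this tendsto_const[of "\<phi> \<beta>"]] \<phi>_pos[OF \<beta>] show ?thesis by simp
qed

text \<open>Division by the jump size is undone on integration, since \<open>\<mu>N\<close> has an
  atom of exactly that mass. At times without a jump the quotient is 0 / 0 = 0, so the continuous
  part of \<open>\<mu>N\<close> contributes nothing.\<close>

abbreviation batch_weight :: "real \<Rightarrow> nat \<Rightarrow> 'a \<Rightarrow> real \<Rightarrow> real" where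
  "batch_weight \<gamma> n \<omega> s \<equiv> indicator {0<..real n} s *
     (exp (- \<beta> * Wl \<omega> s) * ((eps \<beta> (dJ \<omega> s) - eps \<gamma> (dJ \<omega> s)) / dJ \<omega> s))"

abbreviation batch_inf_weight :: "nat \<Rightarrow> 'a \<Rightarrow> real \<Rightarrow> real" where
  "batch_inf_weight n \<omega> s \<equiv> indicator {0<..real n} s *
     (exp (- \<beta> * Wl \<omega> s) * (eps \<beta> (dJ \<omega> s) / dJ \<omega> s))"

definition batch_sum :: "real \<Rightarrow> nat \<Rightarrow> nat \<Rightarrow> 'a \<Rightarrow> real" where
  "batch_sum \<gamma> n m \<omega> = (\<Sum>k<n * Suc m. em \<omega> m k *
     (eps \<beta> (Inc (step m) N k \<omega>) - eps \<gamma> (Inc (step m) N k \<omega>)))"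

definition batch :: "real \<Rightarrow> nat \<Rightarrow> 'a \<Rightarrow> real" where
  "batch \<gamma> n \<omega> = (\<integral>s. batch_weight \<gamma> n \<omega> s \<partial>\<mu>N \<omega>)"

lemma batch_limit:
  assumes \<omega>: "\<omega> \<in> space M" and \<gamma>: "0 < \<gamma>"
  shows "(\<lambda>m. batch_sum \<gamma> n m \<omega>) \<longlonglongrightarrow> batch \<gamma> n \<omega>"
    and "(batch_weight \<gamma> n \<omega>) \<in> borel_measurable (\<mu>N \<omega>)"
proof -
  interpret stieltjes "JN \<omega>" "\<mu>N \<omega>" by (rule stieltjes_N[OF \<omega>])
  note * = stieltjes_limit[OF exp_W_left[OF \<omega>] em_le em_approx[OF \<omega>] eps_diff_cont[OF \<beta> \<gamma>] eps_diff_le[OF \<beta> \<gamma>], of n]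
  have \<Delta>: "\<Delta> m k = Inc (step m) N k \<omega>" for m k by (simp add: \<Delta>_def incr_def)
  have "(eps \<beta> x - eps \<gamma> x) / x * x = eps \<beta> x - eps \<gamma> x" for x by (simp add: eps_def)
  then show "(\<lambda>m. batch_sum \<gamma> n m \<omega>) \<longlonglongrightarrow> batch \<gamma> n \<omega>"
    using *(1) unfolding batch_sum_def batch_def \<Delta> by simp
  show "(batch_weight \<gamma> n \<omega>) \<in> borel_measurable (\<mu>N \<omega>)"
    by (rule *(2))
qed

lemma sum_Inc: "\<omega> \<in> space M \<Longrightarrow> (\<Sum>k<n * Suc m. Inc (step m) N k \<omega>) = J N (real n) \<omega>"
proof -
  assume \<omega>: "\<omega> \<in> space M"
  interpret stieltjes "JN \<omega>" "\<mu>N \<omega>" by (rule stieltjes_N[OF \<omega>])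
  have "\<Delta> m k = Inc (step m) N k \<omega>" for k by (simp add: \<Delta>_def incr_def)
  then show ?thesis using sum_\<Delta>[where n=n and m=m] N.X_0[OF \<omega>] by simp
qed

lemma batch_sum_le:
  assumes \<omega>: "\<omega> \<in> space M" and \<gamma>: "0 < \<gamma>"
  shows "\<bar>batch_sum \<gamma> n m \<omega>\<bar> \<le> J N (real n) \<omega>"
proof -
  have "\<bar>em \<omega> m k * (eps \<beta> (Inc (step m) N k \<omega>) - eps \<gamma> (Inc (step m) N k \<omega>))\<bar> \<le> 1 * Inc (step m) N k \<omega>" for k
  proof -
    have "0 \<le> Inc (step m) N k \<omega>" by (rule Inc_nonneg[OF step_pos N \<omega>])
    from eps_bounds[OF \<beta> this] eps_bounds[OF \<gamma> this] show ?thesis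
      unfolding abs_mult by (intro mult_mono em_le) auto
  qed
  then have "(\<Sum>k<n * Suc m. \<bar>em \<omega> m k * (eps \<beta> (Inc (step m) N k \<omega>) - eps \<gamma> (Inc (step m) N k \<omega>))\<bar>)
      \<le> (\<Sum>k<n * Suc m. Inc (step m) N k \<omega>)" by (intro sum_mono) simp
  also have "\<dots> = J N (real n) \<omega>" by (rule sum_Inc[OF \<omega>])
  finally show ?thesis unfolding batch_sum_def by (rule order_trans[OF sum_abs])
qed

lemma batch_measurable: "0 < \<gamma> \<Longrightarrow> batch \<gamma> n \<in> borel_measurable M"
proof (rule borel_measurable_LIMSEQ_real[OF batch_limit(1)])
  fix m
  have "Inc (step m) N k \<in> borel_measurable M" for k by (rule Inc_measurable[OF step_pos N])
  note [measurable] = this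
  show "batch_sum \<gamma> n m \<in> borel_measurable M"
    unfolding batch_sum_def[abs_def] eps_def by measurable
qed

lemma batch_le: "\<omega> \<in> space M \<Longrightarrow> 0 < \<gamma> \<Longrightarrow> \<bar>batch \<gamma> n \<omega>\<bar> \<le> J N (real n) \<omega>"
  by (rule LIMSEQ_le_const2[OF tendsto_rabs[OF batch_limit(1)]]) (use batch_sum_le in blast)+

lemma expectation_eps_Inc:
  assumes \<gamma>: "0 < \<gamma>"
  shows "(\<integral>\<omega>. eps \<gamma> (Inc (step m) N k \<omega>) \<partial>M) = (1 - exp (- (N.\<eta> \<gamma> / real (Suc m)))) / \<gamma>"
    "integrable M (\<lambda>\<omega>. eps \<gamma> (Inc (step m) N k \<omega>))"
proof -
  have nn: "0 \<le> real k * step m" "0 \<le> step m" by auto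
  have eq: "Inc (step m) N k \<omega> = J N (real k * step m + step m) \<omega> - J N (real k * step m) \<omega>" for \<omega>
    by (simp add: incr_def algebra_simps add_divide_distrib)
  have "integrable M (\<lambda>\<omega>. exp (- \<gamma> * Inc (step m) N k \<omega>))" "(\<integral>\<omega>. exp (- \<gamma> * Inc (step m) N k \<omega>) \<partial>M) = exp (- (N.\<eta> \<gamma> / real (Suc m)))"
    unfolding eq using N.integrable_increment[OF nn, of "\<lambda>x. exp (- \<gamma> * x)"] N.integral_increment[OF nn, of "\<lambda>x. exp (- \<gamma> * x)"]
      N.integrable_exp[of \<gamma> "step m"] N.laplace_transform[of \<gamma> "step m"] \<gamma> by auto
  then show "(\<integral>\<omega>. eps \<gamma> (Inc (step m) N k \<omega>) \<partial>M) = (1 - exp (- (N.\<eta> \<gamma> / real (Suc m)))) / \<gamma>"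
    "integrable M (\<lambda>\<omega>. eps \<gamma> (Inc (step m) N k \<omega>))"
    unfolding eps_def by (simp_all add: prob_space)
qed

text \<open>In each cell the workload factor is independent of the class \<open>N\<close> increment,
  and the mean of \<open>eps \<gamma>\<close> over a cell of length h is (1 - exp (- h
  \<open>N.\<eta> \<gamma>\<close>)) / \<gamma>, asymptotically h \<open>N.\<eta> \<gamma>\<close> /
  \<gamma>. The remaining sum of \<open>u\<close> gives the occupation integral;
  \<open>J N n\<close> dominates the sums.\<close>

lemma expectation_batch:
  assumes \<gamma>: "0 < \<gamma>"
  shows "(\<integral>\<omega>. batch \<gamma> n \<omega> \<partial>M) = (N.\<eta> \<beta> / \<beta> - N.\<eta> \<gamma> / \<gamma>) * (\<integral>\<omega>. occ n \<omega> \<partial>M)"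
proof -
  let ?e = "\<lambda>\<gamma> m. (real (Suc m) * (1 - exp (- (N.\<eta> \<gamma> / real (Suc m))))) / \<gamma>"
  have "Inc (step m) N k \<in> borel_measurable M" for m k by (rule Inc_measurable[OF step_pos N])
  note [measurable] = this batch_measurable[OF \<gamma>]
  have "(\<lambda>m. \<integral>\<omega>. batch_sum \<gamma> n m \<omega> \<partial>M) \<longlonglongrightarrow> (\<integral>\<omega>. batch \<gamma> n \<omega> \<partial>M)"
  proof (rule integral_dominated_convergence[where w="J N (real n)"])
    show "batch_sum \<gamma> n m \<in> borel_measurable M" for m unfolding batch_sum_def[abs_def] eps_def by measurable
    show "AE \<omega> in M. (\<lambda>m. batch_sum \<gamma> n m \<omega>) \<longlonglongrightarrow> batch \<gamma> n \<omega>" using batch_limit(1)[OF _ \<gamma>] by (intro AE_I2)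
    show "AE \<omega> in M. norm (batch_sum \<gamma> n m \<omega>) \<le> J N (real n) \<omega>" for m
      unfolding real_norm_def using batch_sum_le[OF _ \<gamma>] by (intro AE_I2)
  qed (use integrable_JN in auto)
  also have "(\<lambda>m. \<integral>\<omega>. batch_sum \<gamma> n m \<omega> \<partial>M) = (\<lambda>m. ((\<Sum>k<n * Suc m. u (step m) \<beta> k) * step m) * (?e \<beta> m - ?e \<gamma> m))"
  proof
    fix m
    have one: "integrable M (\<lambda>\<omega>. em \<omega> m k * (eps \<beta> (Inc (step m) N k \<omega>) - eps \<gamma> (Inc (step m) N k \<omega>))) \<and>
        (\<integral>\<omega>. em \<omega> m k * (eps \<beta> (Inc (step m) N k \<omega>) - eps \<gamma> (Inc (step m) N k \<omega>)) \<partial>M)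
        = u (step m) \<beta> k * (step m * (?e \<beta> m - ?e \<gamma> m))" for k
    proof -
      have g: "(\<lambda>z. eps \<beta> (z (N, k)) - eps \<gamma> (z (N, k))) \<in> borel_measurable (Pi\<^sub>M (I \<times> {k}) (\<lambda>_. borel))"
      proof -
        have [measurable]: "(\<lambda>z. z (N, k)) \<in> borel_measurable (Pi\<^sub>M (I \<times> {k}) (\<lambda>_. borel :: real measure))"
          by (rule measurable_component_singleton) (use N in auto)
        show ?thesis unfolding eps_def by measurable
      qed
      have G: "eps \<beta> (Inc (step m) N k \<omega>) - eps \<gamma> (Inc (step m) N k \<omega>) =
          eps \<beta> ((\<lambda>ik\<in>I \<times> {k}. Inc (step m) (fst ik) (snd ik) \<omega>) (N, k)) -
          eps \<gamma> ((\<lambda>ik\<in>I \<times> {k}. Inc (step m) (fst ik) (snd ik) \<omega>) (N, k))" for \<omega>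
        using N by simp
      have int: "integrable M (\<lambda>\<omega>. eps \<beta> (Inc (step m) N k \<omega>) - eps \<gamma> (Inc (step m) N k \<omega>))"
        using expectation_eps_Inc(2)[OF \<beta>] expectation_eps_Inc(2)[OF \<gamma>] by simp
      have "(\<integral>\<omega>. eps \<beta> (Inc (step m) N k \<omega>) - eps \<gamma> (Inc (step m) N k \<omega>) \<partial>M) = step m * (?e \<beta> m - ?e \<gamma> m)"
        using expectation_eps_Inc[OF \<beta>] expectation_eps_Inc[OF \<gamma>] by (simp add: right_diff_distrib del: of_nat_Suc)
      then show ?thesis
        using exp_Wd_indep[OF step_pos \<beta> g G int] unfolding em_def by simp
    qed
    then have "(\<integral>\<omega>. batch_sum \<gamma> n m \<omega> \<partial>M) = (\<Sum>k<n * Suc m. u (step m) \<beta> k * (step m * (?e \<beta> m - ?e \<gamma> m)))"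
      unfolding batch_sum_def by (subst Bochner_Integration.integral_sum) auto
    then show "(\<integral>\<omega>. batch_sum \<gamma> n m \<omega> \<partial>M) = ((\<Sum>k<n * Suc m. u (step m) \<beta> k) * step m) * (?e \<beta> m - ?e \<gamma> m)"
      by (simp only: sum_distrib_right mult.assoc)
  qed
  finally have 1: "(\<lambda>m. ((\<Sum>k<n * Suc m. u (step m) \<beta> k) * step m) * (?e \<beta> m - ?e \<gamma> m)) \<longlonglongrightarrow> (\<integral>\<omega>. batch \<gamma> n \<omega> \<partial>M)" .
  have e: "?e x \<longlonglongrightarrow> N.\<eta> x / x" if "0 < x" for x
  proof -
    have "(\<lambda>m. real (Suc m) * (1 - exp (- (y / real (Suc m))))) \<longlonglongrightarrow> y" for y
      by real_asymp
    from tendsto_divide[OF this tendsto_const] show ?thesis using that by auto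
  qed
  have "(\<lambda>m. ((\<Sum>k<n * Suc m. u (step m) \<beta> k) * step m) * (?e \<beta> m - ?e \<gamma> m)) \<longlonglongrightarrow> (\<integral>\<omega>. occ n \<omega> \<partial>M) * (N.\<eta> \<beta> / \<beta> - N.\<eta> \<gamma> / \<gamma>)"
    by (intro tendsto_mult sum_u_limit tendsto_diff e \<beta> \<gamma>)
  from LIMSEQ_unique[OF 1 this] show ?thesis by (simp add: mult.commute)
qed

definition batch_inf :: "nat \<Rightarrow> 'a \<Rightarrow> real" where
  "batch_inf n \<omega> = (\<integral>s. batch_inf_weight n \<omega> s \<partial>\<mu>N \<omega>)"

text \<open>The quotients are bounded by 1 by \<open>eps_diff_le\<close>, and so are the workload
  exponentials; the indicator of (0, n] is thus an integrable majorant, uniformly in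
  \<gamma>.\<close>

lemma batch_inf_limit:
  assumes \<omega>: "\<omega> \<in> space M"
  shows "(\<lambda>j. batch (real (Suc j)) n \<omega>) \<longlonglongrightarrow> batch_inf n \<omega>"
    and "(batch_inf_weight n \<omega>) \<in> borel_measurable (\<mu>N \<omega>)" (is ?meas)
    and "integrable (\<mu>N \<omega>) (batch_inf_weight n \<omega>)" (is ?integ)
proof -
  interpret stieltjes "JN \<omega>" "\<mu>N \<omega>" by (rule stieltjes_N[OF \<omega>])
  let ?f = "\<lambda>j. batch_weight (real (Suc j)) n \<omega>"
  let ?g = "batch_inf_weight n \<omega>"
  have lim: "(\<lambda>j. ?f j s) \<longlonglongrightarrow> ?g s" for s
  proof (cases "s \<in> {0<..real n}")
    case True
    then have "0 \<le> dJ \<omega> s" using F_left_le[of s] by simp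
    from tendsto_diff[OF tendsto_const tendsto_divide_zero[OF eps_Suc_tendsto[OF this]]]
    show ?thesis by (intro tendsto_mult tendsto_const) (simp add: diff_divide_distrib)
  qed simp
  have fm: "?f j \<in> borel_measurable (\<mu>N \<omega>)" for j by (rule batch_limit(2)[OF \<omega>]) simp
  show gm: ?meas by (rule borel_measurable_LIMSEQ_real[OF lim fm])
  have el: "\<bar>exp (- \<beta> * Wl \<omega> s)\<bar> \<le> 1" if "0 < s" for s
    using reflected_path.W_left_nonneg[OF reflected_path[OF \<omega>] that] \<beta> by simp
  have bound: "\<bar>?f j s\<bar> \<le> indicator {0<..real n} s" for j s
  proof (cases "s \<in> {0<..real n}")
    case True
    then have s: "0 < s" "0 \<le> dJ \<omega> s" using F_left_le[of s] by simp_all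
    show ?thesis using True mult_mono[OF el[OF s(1)] eps_diff_le[OF \<beta> _ s(2), of "real (Suc j)"]]
      by (simp add: abs_mult)
  qed simp
  have bound': "\<bar>?g s\<bar> \<le> indicator {0<..real n} s" for s
    by (rule LIMSEQ_le_const2[OF tendsto_rabs[OF lim]]) (use bound in blast)
  have ind: "integrable (\<mu>N \<omega>) (indicator {0<..real n} :: real \<Rightarrow> real)"
    using finite_Ioc sets_\<mu> by (simp add: integrable_indicator_iff)
  show "(\<lambda>j. batch (real (Suc j)) n \<omega>) \<longlonglongrightarrow> batch_inf n \<omega>"
    unfolding batch_def batch_inf_def
    by (rule integral_dominated_convergence[OF gm fm ind]) (use lim bound in auto)
  show ?integ
    by (rule Bochner_Integration.integrable_bound[OF ind gm]) (use bound' in auto)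
qed

lemma batch_inf_measurable [measurable]: "batch_inf n \<in> borel_measurable M"
  by (rule borel_measurable_LIMSEQ_real[OF batch_inf_limit(1) batch_measurable]) auto

lemma batch_inf_bounds:
  assumes \<omega>: "\<omega> \<in> space M"
  shows "0 \<le> batch_inf n \<omega>" "batch_inf n \<omega> \<le> J N (real n) \<omega>"
proof -
  interpret stieltjes "JN \<omega>" "\<mu>N \<omega>" by (rule stieltjes_N[OF \<omega>])
  have "0 \<le> eps \<beta> (dJ \<omega> s) / (dJ \<omega> s)" if "s \<in> {0<..real n}" for s
    using eps_div_bounds[OF \<beta>, of "dJ \<omega> s"] F_left_le[of s] that by simp
  then have "0 \<le> batch_inf_weight n \<omega> s" for s
    by (cases "s \<in> {0<..real n}")
      (simp_all only: indicator_simps(1) mult_1 mult_nonneg_nonneg exp_ge_zero, simp)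
  then show "0 \<le> batch_inf n \<omega>" unfolding batch_inf_def
    by (intro integral_nonneg_AE AE_I2)
  have "\<bar>batch_inf n \<omega>\<bar> \<le> J N (real n) \<omega>"
    by (rule LIMSEQ_le_const2[OF tendsto_rabs[OF batch_inf_limit(1)[OF \<omega>]]]) (use batch_le[OF \<omega>] in auto)
  then show "batch_inf n \<omega> \<le> J N (real n) \<omega>" by simp
qed

text \<open>The \<gamma>-term vanishes pathwise as \<gamma> grows, but not in the mean of
  \<open>batch\<close>: \<open>N.\<eta> \<gamma> / \<gamma>\<close> tends to \<open>c\<close>. The
  missing multiple of \<open>occ\<close> is the share of the particles that arrive
  continuously.\<close>

lemma expectation_batch_inf:
  assumes c: "(\<lambda>j. N.\<eta> (real (Suc j)) / real (Suc j)) \<longlonglongrightarrow> c"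
  shows "(\<integral>\<omega>. batch_inf n \<omega> \<partial>M) = (N.\<eta> \<beta> / \<beta> - c) * (\<integral>\<omega>. occ n \<omega> \<partial>M)"
proof -
  have "(\<lambda>j. \<integral>\<omega>. batch (real (Suc j)) n \<omega> \<partial>M) \<longlonglongrightarrow> (\<integral>\<omega>. batch_inf n \<omega> \<partial>M)"
  proof (rule integral_dominated_convergence[where w="J N (real n)"])
    show "batch (real (Suc j)) n \<in> borel_measurable M" for j by (rule batch_measurable) simp
    show "AE \<omega> in M. (\<lambda>j. batch (real (Suc j)) n \<omega>) \<longlonglongrightarrow> batch_inf n \<omega>" using batch_inf_limit(1) by (intro AE_I2)
    show "AE \<omega> in M. norm (batch (real (Suc j)) n \<omega>) \<le> J N (real n) \<omega>" for j
      unfolding real_norm_def by (intro AE_I2 batch_le) auto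
  qed (use integrable_JN in auto)
  moreover have "(\<lambda>j. \<integral>\<omega>. batch (real (Suc j)) n \<omega> \<partial>M) = (\<lambda>j. (N.\<eta> \<beta> / \<beta> - N.\<eta> (real (Suc j)) / real (Suc j)) * (\<integral>\<omega>. occ n \<omega> \<partial>M))"
    using expectation_batch[of "real (Suc _)"] by (simp del: of_nat_Suc)
  moreover have "(\<lambda>j. (N.\<eta> \<beta> / \<beta> - N.\<eta> (real (Suc j)) / real (Suc j)) * (\<integral>\<omega>. occ n \<omega> \<partial>M)) \<longlonglongrightarrow> (N.\<eta> \<beta> / \<beta> - c) * (\<integral>\<omega>. occ n \<omega> \<partial>M)"
    by (intro tendsto_mult tendsto_diff tendsto_const c)
  ultimately show ?thesis using LIMSEQ_unique by metis
qed

end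
end

section \<open>The law of the content in front\<close>

lemma exp_integral:
  fixes \<beta> w d :: real assumes "0 < \<beta>" "0 \<le> d"
  shows "(LINT x:{0..d}|lborel. exp (- \<beta> * (w + x))) = exp (- \<beta> * w) * eps \<beta> d"
proof -
  have "(\<integral>x. exp (- \<beta> * (w + x)) * indicator {0..d} x \<partial>lborel)
      = - exp (- \<beta> * (w + d)) / \<beta> - - exp (- \<beta> * (w + 0)) / \<beta>"
    using assms by (intro integral_FTC_Icc_real) (auto intro!: derivative_eq_intros continuous_intros simp: field_simps)
  also have "\<dots> = exp (- \<beta> * w) * eps \<beta> d"
  proof -
    have "exp (- \<beta> * (w + d)) = exp (- \<beta> * w) * exp (- \<beta> * d)"
      unfolding exp_add[symmetric] by (simp add: algebra_simps)
    then show ?thesis using assms by (simp add: eps_def field_simps)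
  qed
  finally show ?thesis by (simp add: set_lebesgue_integral_def mult.commute)
qed

context queue
begin

context
  fixes \<beta> :: real assumes \<beta>: "0 < \<beta>"
begin

text \<open>Integrating over the positions in a batch produces \<open>eps \<beta>\<close> of the
  jump size, and the sum over jump times becomes an integral against \<open>\<mu>N\<close>, whose
  atoms supply the jump sizes.\<close>

lemma content_average_eq:
  assumes I: "I = {1..N}" and \<omega>: "\<omega> \<in> space M"
  shows "content_average N J c (\<lambda>v. exp (- \<beta> * max v 0)) (real n) \<omega> =
    (c * occ \<beta> n \<omega> + batch_inf \<beta> n \<omega>) / J N (real n) \<omega>"
proof -
  interpret reflected_path "\<lambda>t. Y t \<omega>" by (rule reflected_path[OF \<omega>])
  interpret S: stieltjes "JN \<omega>" "\<mu>N \<omega>" by (rule stieltjes_N[OF \<omega>])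
  have wl: "workload N J t \<omega> = Wp \<omega> t" for t
    unfolding workload_def net_input_def I[symmetric] W_def inf_X_def unfolding total_def by simp
  have left_wl: "left_lim (workload N J) s \<omega> = Wl \<omega> s" for s
    by (simp add: left_lim_def wl)
  let ?d = "dJ \<omega>"
  have jump: "jump (J N) s \<omega> = ?d s" for s
    by (simp add: jump_def left_lim_def)
  have d: "0 \<le> ?d s" if "0 < s" for s using S.F_left_le[OF that] by simp
  \<comment> \<open>The times where the workload may differ from its left limit, together with the
    endpoint 0, which only the first of the two integrals includes.\<close>
  let ?X = "insert 0 {s. 0 < s \<and> \<not> isCont (\<lambda>t. Y t \<omega>) s}"
  have "(LINT s:{0..real n}|lborel. exp (- \<beta> * max (workload N J s \<omega>) 0)) = occ \<beta> n \<omega>"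
    unfolding set_lebesgue_integral_def occ_def[OF \<beta>]
  proof (rule integral_discrete_difference[where X="?X"])
    show "countable ?X" using countable_discont by simp
    fix s assume s: "s \<notin> ?X"
    show "indicat_real {0..real n} s *\<^sub>R exp (- \<beta> * max (workload N J s \<omega>) 0) =
        indicat_real {0<..real n} s * exp (- \<beta> * Wl \<omega> s)"
    proof (cases "0 < s")
      case True
      then show ?thesis using s W_left_eq[of s] W_nonneg[of s] by (simp add: indicator_def wl)
    next
      case False
      then show ?thesis using s by (auto simp: indicator_def)
    qed
  qed auto
  moreover let ?b = "\<lambda>s. LINT x:{0..jump (J N) s \<omega>}|lborel. exp (- \<beta> * max (left_lim (workload N J) s \<omega> + x) 0)"
  have "(\<Sum>\<^sub>\<infinity>s\<in>{0<..real n}. ?b s)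
      = batch_inf \<beta> n \<omega>"
  proof -
    let ?g = "\<lambda>s. indicator {0<..real n} s * (exp (- \<beta> * Wl \<omega> s) * (eps \<beta> (?d s) / ?d s))"
    have "(\<Sum>\<^sub>\<infinity>s\<in>{0<..real n}. ?b s)
        = (\<Sum>\<^sub>\<infinity>s\<in>{0<..real n}. ?g s * ?d s)"
    proof (rule infsum_cong)
      fix s assume s: "s \<in> {0<..real n}"
      then have s0: "0 < s" by simp
      have "?b s
          = (LINT x:{0..?d s}|lborel. exp (- \<beta> * (Wl \<omega> s + x)))"
        unfolding jump left_wl using W_left_nonneg[OF s0]
        by (intro set_lebesgue_integral_cong) auto
      also have "\<dots> = exp (- \<beta> * Wl \<omega> s) * eps \<beta> (?d s)" by (rule exp_integral[OF \<beta> d[OF s0]])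
      also have "\<dots> = ?g s * ?d s" using s by (simp add: eps_def)
      finally show "?b s = ?g s * ?d s" .
    qed
    also have "\<dots> = (\<integral>s. ?g s \<partial>\<mu>N \<omega>)"
    proof (rule integral_countable_support[OF S.sets_\<mu> batch_inf_limit(3)[OF \<beta> \<omega>]])
      show "0 \<le> ?g s" for s
        using eps_div_bounds[OF \<beta> d[of s]] by (cases "s \<in> {0<..real n}")
          (simp_all only: indicator_simps(1) mult_1 mult_nonneg_nonneg exp_ge_zero greaterThanAtMost_iff, simp)
      let ?D = "{s\<in>{0<..real n}. ?d s \<noteq> 0}"
      have "?D \<subseteq> {s\<in>{0<..}. \<not> isCont (JN \<omega>) s}"
      proof safe
        fix s assume s: "s \<in> {0<..real n}" "?d s \<noteq> 0" and "isCont (JN \<omega>) s"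
        then have "(JN \<omega> \<longlongrightarrow> JN \<omega> s) (at_left s)"
          by (auto simp: continuous_within intro: tendsto_mono[OF at_le])
        then have "JNl \<omega> s = JN \<omega> s" by (intro tendsto_Lim) auto
        with s(2) show False by simp
      qed auto
      moreover have "countable {s\<in>{0<..}. \<not> isCont (JN \<omega>) s}"
        by (rule mono_on_ctble_discont_open) (auto simp: mono_on_def S.F_mono)
      ultimately show "countable ?D" by (rule countable_subset)
      show "?D \<subseteq> {0<..real n}" by auto
      show "?g s = 0" if "s \<notin> ?D" for s using that by (auto simp: indicator_def)
      show "emeasure (\<mu>N \<omega>) {s} = ennreal (?d s)" if "s \<in> ?D" for s using that S.\<mu>_singleton by auto
      show "0 \<le> ?d s" if "s \<in> ?D" for s using that d by auto
    qed
    also have "\<dots> = batch_inf \<beta> n \<omega>" by (simp add: batch_inf_def[OF \<beta>])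
    finally show ?thesis .
  qed
  ultimately show ?thesis by (simp add: content_average_def)
qed

section \<open>Uniform integrability of the class N input per unit time\<close>

definition excess :: "real \<Rightarrow> real" where
  "excess K = (\<integral>\<omega>. max (J N 1 \<omega> - K) 0 \<partial>M)"

lemma integrable_JN1: "integrable M (J N 1)"
  using integrable_J1 N by simp

lemma excess_tendsto: "(\<lambda>k. excess (real k)) \<longlonglongrightarrow> 0"
proof -
  have "(\<lambda>k. \<integral>\<omega>. max (J N 1 \<omega> - real k) 0 \<partial>M) \<longlonglongrightarrow> (\<integral>\<omega>. 0 \<partial>M)"
  proof (rule integral_dominated_convergence[where w="J N 1"])
    show "AE \<omega> in M. (\<lambda>k. max (J N 1 \<omega> - real k) 0) \<longlonglongrightarrow> 0"
    proof (rule AE_I2)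
      fix \<omega>
      obtain k0 where "J N 1 \<omega> \<le> real k0" using real_arch_simple by blast
      then have "max (J N 1 \<omega> - real k) 0 = 0" if "k \<ge> k0" for k using that by (simp add: max_def)
      then show "(\<lambda>k. max (J N 1 \<omega> - real k) 0) \<longlonglongrightarrow> 0"
        by (intro tendsto_eventually eventually_sequentiallyI[of k0])
    qed
    show "AE \<omega> in M. norm (max (J N 1 \<omega> - real k) 0) \<le> J N 1 \<omega>" for k
      using N.X_nonneg[of _ 1] by (intro AE_I2) (auto simp: max_def)
  qed (use integrable_JN1 in auto)
  then show ?thesis by (simp add: excess_def)
qed

text \<open>Cutting each unit-time increment at \<open>K\<close> bounds \<open>J N n / n\<close> by
  \<open>K\<close> plus this average. By stationarity its mean is \<open>excess K\<close> for every
  \<open>n\<close>, and \<open>excess_tendsto\<close> makes that small.\<close>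

definition excess_average :: "real \<Rightarrow> nat \<Rightarrow> 'a \<Rightarrow> real" where
  "excess_average K n \<omega> = (\<Sum>k<n. max (J N (real k + 1) \<omega> - J N (real k) \<omega> - K) 0) / real n"

lemma excess_average:
  assumes "0 \<le> K" "0 < n"
  shows "integrable M (excess_average K n)" "(\<integral>\<omega>. excess_average K n \<omega> \<partial>M) = excess K"
    "0 \<le> excess_average K n \<omega>"
    "\<omega> \<in> space M \<Longrightarrow> J N (real n) \<omega> / real n \<le> K + excess_average K n \<omega>"
proof -
  have i1: "integrable M (\<lambda>\<omega>. max (J N 1 \<omega> - K) 0)"
    using integrable_JN1 by (intro integrable_max) auto
  have one: "integrable M (\<lambda>\<omega>. max (J N (real k + 1) \<omega> - J N (real k) \<omega> - K) 0)"
    "(\<integral>\<omega>. max (J N (real k + 1) \<omega> - J N (real k) \<omega> - K) 0 \<partial>M) = excess K" for k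
    using N.integrable_increment[of "real k" 1 "\<lambda>x. max (x - K) 0"] N.integral_increment[of "real k" 1 "\<lambda>x. max (x - K) 0"] i1
    by (auto simp: excess_def)
  show "integrable M (excess_average K n)"
    unfolding excess_average_def[abs_def] using one by simp
  show "(\<integral>\<omega>. excess_average K n \<omega> \<partial>M) = excess K"
    unfolding excess_average_def using one assms by simp
  show "0 \<le> excess_average K n \<omega>"
    unfolding excess_average_def by (intro divide_nonneg_nonneg sum_nonneg) auto
  assume \<omega>: "\<omega> \<in> space M"
  have "J N (real n) \<omega> = (\<Sum>k<n. J N (real (Suc k)) \<omega> - J N (real k) \<omega>)"
    by (subst sum_lessThan_telescope[where f="\<lambda>k. J N (real k) \<omega>"]) (simp add: N.X_0[OF \<omega>])
  also have "\<dots> \<le> (\<Sum>k<n. K + max (J N (real k + 1) \<omega> - J N (real k) \<omega> - K) 0)"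
    by (intro sum_mono) (simp add: add.commute)
  also have "\<dots> = real n * K + real n * excess_average K n \<omega>"
    using assms by (simp add: sum.distrib excess_average_def)
  finally show "J N (real n) \<omega> / real n \<le> K + excess_average K n \<omega>"
    using assms by (simp add: field_simps)
qed

text \<open>The summand \<open>exp (- j)\<close> covers \<open>j = 0\<close>, where the quotient \<open>A / j\<close> is 0 by convention.\<close>

lemma deviation_bound:
  fixes A j y c K R m :: real and n :: nat
  assumes n: "0 < n" and A: "0 \<le> A" "A \<le> c * real n + j" and j: "0 \<le> j" "j / real n \<le> K + R"
    and c: "0 \<le> c" "0 \<le> K" "0 \<le> R" and m: "0 \<le> m" "m \<le> 1"
  shows "\<bar>A - m * j\<bar> / real n \<le> (c + K) * (min \<bar>A / j - m\<bar> 1 + exp (- j)) + R"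
proof -
  let ?e = "\<bar>A / j - m\<bar>"
  have n0: "0 < real n" using n by simp
  have ck: "0 \<le> c + K" using c by simp
  show ?thesis
  proof (cases "j = 0")
    case True
    have "\<bar>A - m * j\<bar> / real n \<le> c" using True A n0 by (simp add: divide_le_eq)
    also have "c \<le> (c + K) * (min ?e 1 + exp (- j)) + R"
      using True c ck mult_left_mono[of 1 "min ?e 1 + exp (- j)" "c + K"] by simp
    finally show ?thesis .
  next
    case False
    then have j0: "0 < j" using j by simp
    have Z: "\<bar>A - m * j\<bar> / real n = (j / real n) * ?e"
    proof -
      have "A - m * j = j * (A / j - m)" using j0 by (simp add: field_simps)
      then show ?thesis using j0 by (simp add: abs_mult)
    qed
    have exp0: "0 \<le> (c + K) * exp (- j)" using ck by simp
    show ?thesis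
    \<comment> \<open>For \<open>?e\<close> at most 1 the remainder \<open>R\<close> is multiplied
      by at most 1. Otherwise the minimum equals 1, and the crude bound c + j / n on the left side
      is enough.\<close>
    proof (cases "?e \<le> 1")
      case True
      have "(j / real n) * ?e \<le> (K + R) * ?e" using j by (intro mult_right_mono) auto
      also have "\<dots> \<le> (c + K) * ?e + R"
        using mult_left_mono[OF True c(3)] mult_nonneg_nonneg[OF c(1), of ?e] by (simp add: distrib_right)
      finally show ?thesis unfolding Z using True exp0 by (simp add: distrib_left)
    next
      case False
      have "m * j \<le> 1 * j" "0 \<le> m * j" using mult_right_mono[OF m(2) j(1)] mult_nonneg_nonneg[OF m(1) j(1)] by simp_all
      moreover have "0 \<le> c * real n" using c n0 by simp
      ultimately have "\<bar>A - m * j\<bar> \<le> c * real n + j" using A by linarith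
      then have "\<bar>A - m * j\<bar> / real n \<le> c + j / real n" using n0 by (simp add: field_simps)
      then have "\<bar>A - m * j\<bar> / real n \<le> c + K + R" using j by simp
      then show ?thesis using False exp0 by (simp add: min_def distrib_left)
    qed
  qed
qed

text \<open>The mean of the numerator per unit time is computed in two ways: exactly, through
  \<open>occ_mean_limit\<close>, and as \<open>m\<close> times the class \<open>N\<close> rate,
  because numerator and \<open>m\<close> times denominator differ little in mean. For the latter the
  almost sure limit is used through the bounded deviation \<open>e\<close>, and the excess controls
  the tail.\<close>

lemma content_law_mean:
  assumes \<rho>N: "0 < (\<integral>\<omega>. J N 1 \<omega> \<partial>M)" and c: "0 \<le> c"
    and c_lim: "(\<lambda>j. N.\<eta> (real (Suc j)) / real (Suc j)) \<longlonglongrightarrow> c" and m: "0 \<le> m" "m \<le> 1"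
    and lim: "AE \<omega> in M. (\<lambda>n. (c * occ \<beta> n \<omega> + batch_inf \<beta> n \<omega>) / J N (real n) \<omega>) \<longlonglongrightarrow> m"
  shows "m * (\<integral>\<omega>. J N 1 \<omega> \<partial>M) = N.\<eta> \<beta> * \<delta> / \<phi> \<beta>"
proof -
  let ?\<rho> = "\<integral>\<omega>. J N 1 \<omega> \<partial>M"
  define A where "A n \<omega> = c * occ \<beta> n \<omega> + batch_inf \<beta> n \<omega>" for n \<omega>
  define e where "e n \<omega> = min \<bar>A n \<omega> / J N (real n) \<omega> - m\<bar> 1" for n \<omega>
  have [measurable]: "J N (real n) \<in> borel_measurable M" for n by simp
  have [measurable]: "A n \<in> borel_measurable M" for n
    unfolding A_def[abs_def] using occ_measurable[OF \<beta>] batch_inf_measurable[OF \<beta>] by measurable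
  have int_batch: "integrable M (batch_inf \<beta> n)" for n
  proof (rule Bochner_Integration.integrable_bound[OF integrable_JN batch_inf_measurable[OF \<beta>]])
    show "AE \<omega> in M. norm (batch_inf \<beta> n \<omega>) \<le> norm (J N (real n) \<omega>)"
    proof (rule AE_I2)
      fix \<omega> assume "\<omega> \<in> space M"
      from batch_inf_bounds[OF \<beta> this, of n] show "norm (batch_inf \<beta> n \<omega>) \<le> norm (J N (real n) \<omega>)" by simp
    qed
  qed
  have intA: "integrable M (A n)" for n
    unfolding A_def[abs_def] using integrable_occ[OF \<beta>] int_batch by simp
  \<comment> \<open>The drift cancels here: \<open>c\<close> from the continuous arrivals against
    \<open>- c\<close> from \<open>expectation_batch_inf\<close>.\<close>
  have EA: "(\<integral>\<omega>. A n \<omega> \<partial>M) = N.\<eta> \<beta> / \<beta> * (\<integral>\<omega>. occ \<beta> n \<omega> \<partial>M)" for n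
    unfolding A_def using integrable_occ[OF \<beta>, of n] int_batch[of n] expectation_batch_inf[OF \<beta> c_lim, of n]
    by (simp add: left_diff_distrib)
  have "(\<lambda>n. N.\<eta> \<beta> / \<beta> * ((\<integral>\<omega>. occ \<beta> n \<omega> \<partial>M) / real n)) \<longlonglongrightarrow> N.\<eta> \<beta> / \<beta> * (\<beta> * \<delta> / \<phi> \<beta>)"
    by (intro tendsto_mult tendsto_const occ_mean_limit[OF \<beta>])
  then have limEA: "(\<lambda>n. (\<integral>\<omega>. A n \<omega> \<partial>M) / real n) \<longlonglongrightarrow> N.\<eta> \<beta> * \<delta> / \<phi> \<beta>"
    using \<beta> by (simp add: EA)
  \<comment> \<open>If it vanished, the exponent would be zero on [0, 1] by monotonicity, and its
    slope at 0, the mean of \<open>J N 1\<close>, would be zero. Positivity makes the mean of exp (-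
    \<open>J N n\<close>) tend to 0, so a zero denominator becomes negligible.\<close>
  have \<eta>1: "0 < N.\<eta> 1"
  proof (rule ccontr)
    assume "\<not> 0 < N.\<eta> 1"
    then have z: "N.\<eta> \<gamma> = 0" if "0 \<le> \<gamma>" "\<gamma> \<le> 1" for \<gamma>
      using N.\<eta>_mono[OF that] N.\<eta>_nonneg[OF that(1)] by simp
    have "eventually (\<lambda>\<gamma>::real. \<gamma> < 1) (at_right 0)"
      by (rule order_tendstoD(2)[OF tendsto_ident_at]) simp
    then have "eventually (\<lambda>\<gamma>. 0 = N.\<eta> \<gamma> / \<gamma>) (at_right 0)"
      using eventually_at_right_less[of "0::real"] by eventually_elim (simp add: z)
    then have "((\<lambda>\<gamma>. N.\<eta> \<gamma> / \<gamma>) \<longlongrightarrow> 0) (at_right 0)"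
      by (rule Lim_transform_eventually[OF tendsto_const])
    with N.\<eta>_derivative_0[OF integrable_JN1] have "?\<rho> = 0"
      by (rule tendsto_unique[OF trivial_limit_at_right_real])
    with \<rho>N show False by simp
  qed
  have exp_le: "exp (- J N (real n) \<omega>) \<le> 1" if "\<omega> \<in> space M" for n \<omega>
    using N.X_nonneg[OF that, of "real n"] by simp
  have e_bounds: "0 \<le> e n \<omega>" "e n \<omega> \<le> 1" for n \<omega> by (auto simp: e_def)
  have [measurable]: "e n \<in> borel_measurable M" for n unfolding e_def[abs_def] by measurable
  have int_e: "integrable M (e n)" for n
    by (rule integrable_const_bound[of _ 1]) (use e_bounds in auto)
  have int_exp: "integrable M (\<lambda>\<omega>. exp (- J N (real n) \<omega>))" for n
    using N.integrable_exp[of 1 "real n"] by simp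
  have lim_e: "(\<lambda>n. \<integral>\<omega>. e n \<omega> \<partial>M) \<longlonglongrightarrow> (\<integral>\<omega>. 0 \<partial>M)"
  proof (rule integral_dominated_convergence[where w="\<lambda>_. 1"])
    show "AE \<omega> in M. (\<lambda>n. e n \<omega>) \<longlonglongrightarrow> 0"
      using lim
    proof eventually_elim
      case (elim \<omega>)
      then have "(\<lambda>n. \<bar>A n \<omega> / J N (real n) \<omega> - m\<bar>) \<longlonglongrightarrow> \<bar>m - m\<bar>"
        unfolding A_def by (intro tendsto_rabs tendsto_diff tendsto_const)
      from tendsto_min[OF this tendsto_const[of 1]] show ?case by (simp add: e_def)
    qed
  qed (use e_bounds in auto)
  have lim_exp: "(\<lambda>n. \<integral>\<omega>. exp (- J N (real n) \<omega>) \<partial>M) \<longlonglongrightarrow> 0"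
  proof -
    have "(\<lambda>n. exp (- real n * x)) \<longlonglongrightarrow> 0" if "0 < x" for x :: real using that by real_asymp
    moreover have "(\<integral>\<omega>. exp (- J N (real n) \<omega>) \<partial>M) = exp (- real n * N.\<eta> 1)" for n
      using N.laplace_transform[of 1 "real n"] by simp
    ultimately show ?thesis using \<eta>1 by simp
  qed
  have dev: "\<bar>(\<integral>\<omega>. A n \<omega> \<partial>M) / real n - m * ?\<rho>\<bar> \<le>
      (c + K) * ((\<integral>\<omega>. e n \<omega> \<partial>M) + (\<integral>\<omega>. exp (- J N (real n) \<omega>) \<partial>M)) + excess K" if n: "0 < n" and K: "0 \<le> K" for n K
  proof -
    note ex = excess_average[OF K n]
    have EJ: "(\<integral>\<omega>. J N (real n) \<omega> \<partial>M) = real n * ?\<rho>"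
      by (rule N.expectation_X[OF integrable_JN1]) simp
    have intZ: "integrable M (\<lambda>\<omega>. A n \<omega> - m * J N (real n) \<omega>)" using intA integrable_JN by simp
    have "\<bar>(\<integral>\<omega>. A n \<omega> \<partial>M) / real n - m * ?\<rho>\<bar> = \<bar>(\<integral>\<omega>. A n \<omega> - m * J N (real n) \<omega> \<partial>M)\<bar> / real n"
    proof -
      have "(\<integral>\<omega>. A n \<omega> \<partial>M) / real n - m * ?\<rho> = (\<integral>\<omega>. A n \<omega> - m * J N (real n) \<omega> \<partial>M) / real n"
        using intA integrable_JN n by (simp add: EJ diff_divide_distrib)
      then show ?thesis by simp
    qed
    also have "\<dots> \<le> (\<integral>\<omega>. \<bar>A n \<omega> - m * J N (real n) \<omega>\<bar> \<partial>M) / real n"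
      by (intro divide_right_mono integral_abs_bound) simp
    also have "\<dots> = (\<integral>\<omega>. \<bar>A n \<omega> - m * J N (real n) \<omega>\<bar> / real n \<partial>M)" by simp
    also have "\<dots> \<le> (\<integral>\<omega>. (c + K) * (e n \<omega> + exp (- J N (real n) \<omega>)) + excess_average K n \<omega> \<partial>M)"
    proof (rule integral_mono)
      show "integrable M (\<lambda>\<omega>. \<bar>A n \<omega> - m * J N (real n) \<omega>\<bar> / real n)" using intZ by simp
      show "integrable M (\<lambda>\<omega>. (c + K) * (e n \<omega> + exp (- J N (real n) \<omega>)) + excess_average K n \<omega>)"
        using int_e int_exp ex(1) by simp
      fix \<omega> assume \<omega>: "\<omega> \<in> space M"
      have "0 \<le> A n \<omega>" "A n \<omega> \<le> c * real n + J N (real n) \<omega>"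
        unfolding A_def using occ_bounds[OF \<beta> \<omega>, of n] batch_inf_bounds[OF \<beta> \<omega>, of n] c
        by (auto intro!: add_mono mult_left_mono)
      then show "\<bar>A n \<omega> - m * J N (real n) \<omega>\<bar> / real n \<le> (c + K) * (e n \<omega> + exp (- J N (real n) \<omega>)) + excess_average K n \<omega>"
        unfolding e_def using n ex(3,4) \<omega> c K m N.X_nonneg[OF \<omega>, of "real n"] by (intro deviation_bound) auto
    qed
    also have "\<dots> = (c + K) * ((\<integral>\<omega>. e n \<omega> \<partial>M) + (\<integral>\<omega>. exp (- J N (real n) \<omega>) \<partial>M)) + excess K"
      using int_e int_exp ex(1,2) by simp
    finally show ?thesis .
  qed
  have "(\<lambda>n. (\<integral>\<omega>. A n \<omega> \<partial>M) / real n) \<longlonglongrightarrow> m * ?\<rho>"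
  proof (rule LIMSEQ_I)
    fix r :: real assume r: "0 < r"
    \<comment> \<open>The cut level is chosen first; only then does \<open>n\<close> grow, with a
      fixed factor \<open>c + k\<close> in front of terms that tend to 0.\<close>
    obtain k where k: "excess (real k) < r / 2"
      using order_tendstoD(2)[OF excess_tendsto, of "r / 2"] r by (auto simp: eventually_sequentially)
    have "(\<lambda>n. (c + real k) * ((\<integral>\<omega>. e n \<omega> \<partial>M) + (\<integral>\<omega>. exp (- J N (real n) \<omega>) \<partial>M))) \<longlonglongrightarrow> (c + real k) * ((\<integral>\<omega>. 0 \<partial>M) + 0)"
      by (intro tendsto_mult tendsto_const tendsto_add lim_e lim_exp)
    then have l: "(\<lambda>n. (c + real k) * ((\<integral>\<omega>. e n \<omega> \<partial>M) + (\<integral>\<omega>. exp (- J N (real n) \<omega>) \<partial>M))) \<longlonglongrightarrow> 0" by simp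
    have "eventually (\<lambda>n. (c + real k) * ((\<integral>\<omega>. e n \<omega> \<partial>M) + (\<integral>\<omega>. exp (- J N (real n) \<omega>) \<partial>M)) < r / 2 \<and> 0 < n) sequentially"
      using r by (intro eventually_conj order_tendstoD(2)[OF l] eventually_gt_at_top) auto
    then have "eventually (\<lambda>n. norm ((\<integral>\<omega>. A n \<omega> \<partial>M) / real n - m * ?\<rho>) < r) sequentially"
    proof eventually_elim
      case (elim n)
      then show ?case using dev[of n "real k"] k unfolding real_norm_def by simp
    qed
    then show "\<exists>no. \<forall>n\<ge>no. norm ((\<integral>\<omega>. A n \<omega> \<partial>M) / real n - m * ?\<rho>) < r" unfolding eventually_sequentially .
  qed
  from LIMSEQ_unique[OF this limEA] show ?thesis .
qed

end
end

text \<open>Dividing the formula by its argument leaves \<open>c\<close> plus the integral of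
  \<open>eps\<close> against \<nu>. For arguments at least 1 the integrand is below min 1 x, the
  integrable majorant of a Levy measure.\<close>

lemma levy_khintchine_drift:
  assumes "levy_khintchine \<eta> c \<nu>"
  shows "(\<lambda>j. \<eta> (real (Suc j)) / real (Suc j)) \<longlonglongrightarrow> c"
proof -
  have sets [measurable_cong]: "sets \<nu> = sets borel" and null: "emeasure \<nu> {..0} = 0"
    and int: "integrable \<nu> (\<lambda>x. min 1 x)"
    using assms by (auto simp: levy_khintchine_def)
  have \<eta>: "\<eta> \<alpha> = c * \<alpha> + (\<integral>x. 1 - exp (- \<alpha> * x) \<partial>\<nu>)" if "0 \<le> \<alpha>" for \<alpha>
    using assms that by (simp add: levy_khintchine_def)
  have pos: "AE x in \<nu>. 0 < x"
    by (rule AE_I[of _ _ "{..0}"]) (use null sets in auto)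
  have "(\<lambda>j. \<integral>x. eps (real (Suc j)) x \<partial>\<nu>) \<longlonglongrightarrow> (\<integral>x. 0 \<partial>\<nu>)"
  proof (rule integral_dominated_convergence[OF _ _ int])
    show "AE x in \<nu>. (\<lambda>j. eps (real (Suc j)) x) \<longlonglongrightarrow> 0"
      using pos by eventually_elim (intro eps_Suc_tendsto, simp)
    show "eps (real (Suc j)) \<in> borel_measurable \<nu>" for j unfolding eps_def[abs_def] by measurable
    show "AE x in \<nu>. norm (eps (real (Suc j)) x) \<le> min 1 x" for j
      using pos
    proof eventually_elim
      case (elim x)
      have "eps (real (Suc j)) x \<le> 1 / real (Suc j)" unfolding eps_def by (intro divide_right_mono) auto
      also have "\<dots> \<le> 1" by simp
      finally show ?case using eps_bounds[of "real (Suc j)" x] elim by simp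
    qed
  qed simp
  then have "(\<lambda>j. c + (\<integral>x. eps (real (Suc j)) x \<partial>\<nu>)) \<longlonglongrightarrow> c + 0" by (intro tendsto_add tendsto_const) simp
  moreover have "c + (\<integral>x. eps (real (Suc j)) x \<partial>\<nu>) = \<eta> (real (Suc j)) / real (Suc j)" for j
    unfolding eps_def \<eta>[OF of_nat_0_le_iff] by (simp add: add_divide_distrib del: of_nat_Suc)
  ultimately show ?thesis by simp
qed

text \<open>The lower slope gives injectivity and, at z / d, a value of at least z; the upper slope
  gives continuity, so the intermediate value theorem provides surjectivity.\<close>

lemma bij_betw_slopes:
  fixes \<psi> :: "real \<Rightarrow> real"
  assumes \<psi>0: "\<psi> 0 = 0" and d: "0 < d"
    and lower: "\<And>x y. 0 \<le> x \<Longrightarrow> x \<le> y \<Longrightarrow> d * (y - x) \<le> \<psi> y - \<psi> x"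
    and upper: "\<And>x y. 0 \<le> x \<Longrightarrow> x \<le> y \<Longrightarrow> \<psi> y - \<psi> x \<le> y - x"
  shows "bij_betw \<psi> {0..} {0..}"
proof -
  have mono: "\<psi> x < \<psi> y" if "0 \<le> x" "x < y" for x y
    using lower[of x y] that mult_pos_pos[OF d, of "y - x"] by simp
  have cont: "continuous_on {0..} \<psi>"
  proof (rule continuous_onI)
    fix x e :: real assume x: "x \<in> {0..}" and e: "0 < e"
    have "dist (\<psi> y) (\<psi> x) \<le> e" if y: "y \<in> {0..}" "dist y x < e" for y
      using upper[of x y] upper[of y x] mono[of x y] mono[of y x] x y
      by (cases x y rule: linorder_cases) (auto simp: dist_real_def)
    then show "\<exists>\<delta>>0. \<forall>y\<in>{0..}. dist y x < \<delta> \<longrightarrow> dist (\<psi> y) (\<psi> x) \<le> e" using e by blast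
  qed
  show ?thesis
    unfolding bij_betw_def
  proof
    show "inj_on \<psi> {0..}"
      by (rule linorder_inj_onI) (use mono in \<open>auto simp: less_imp_neq\<close>)
    have "\<psi> x \<in> {0..}" if "0 \<le> x" for x
      using mono[of 0 x] \<psi>0 that by (cases "x = 0") auto
    moreover have "z \<in> \<psi> ` {0..}" if z: "0 \<le> z" for z
    proof -
      have "z \<le> \<psi> (z / d)" using lower[of 0 "z / d"] z d \<psi>0 by simp
      moreover have "0 \<le> z / d" using z d by simp
      ultimately obtain x where "0 \<le> x" "x \<le> z / d" "\<psi> x = z"
        using IVT'[of \<psi> 0 z "z / d"] z \<psi>0 continuous_on_subset[OF cont, of "{0..z / d}"] by auto
      then show ?thesis by auto
    qed
    ultimately show "\<psi> ` {0..} = {0..}" by auto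
  qed
qed

theorem theorem4:
  fixes M :: "'a measure" and M' :: "'b measure"
    and N :: nat
    and J :: "nat \<Rightarrow> real \<Rightarrow> 'a \<Rightarrow> real"
    and K :: "nat \<Rightarrow> real \<Rightarrow> 'b \<Rightarrow> real"
    and V :: "'b \<Rightarrow> real"
    and b a \<rho> :: "nat \<Rightarrow> real"
    and \<eta> :: "nat \<Rightarrow> real \<Rightarrow> real"
    and \<phi> \<phi>\<^sub>a :: "real \<Rightarrow> real"
    and c :: real and \<nu> :: "real measure"
  assumes "prob_space M" and "N \<ge> 2"
    and "\<forall>i\<in>{1..N}. subordinator M (J i)"
    and "prob_space.indep_vars M (\<lambda>_. path_space) (\<lambda>i. sample_path (J i)) {1..N}"
    and "\<forall>i\<in>{1..N}. integrable M (J i 1)"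
    and "\<rho> = (\<lambda>i. \<integral>\<omega>. J i 1 \<omega> \<partial>M)" and "\<rho> N > 0" and "(\<Sum>i\<in>{1..N}. \<rho> i) < 1"
    and "\<eta> = (\<lambda>i. laplace_exponent M (J i))"
    and "levy_khintchine (\<eta> N) c \<nu>"
    and "\<forall>i\<in>{1..N}. \<forall>j\<in>{1..N}. i < j \<longrightarrow> b j < b i" and "b N > 0"
    and "a = (\<lambda>i. 1 - b N / b i)"
    and "\<phi> = (\<lambda>\<alpha>. \<alpha> - (\<Sum>i\<in>{1..N}. \<eta> i \<alpha>))"
    and "\<phi>\<^sub>a = (\<lambda>\<alpha>. ln (\<integral>\<omega>. exp (- \<alpha> * (overtaking_input N a J 1 \<omega> - 1)) \<partial>M))"
    \<comment> \<open>\<open>V\<close> is the steady state content, \<open>K\<close> the class inputs after the tagged arrival\<close>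
    and "prob_space M'"
    and "V \<in> borel_measurable M'" and "\<forall>\<omega>\<in>space M'. V \<omega> \<ge> 0"
    and "steady_state_content_law M N J c (distr M' borel V)"
    and "\<forall>i\<in>{1..<N}. subordinator M' (K i)"
    and "\<forall>i\<in>{1..<N}. distr M' path_space (sample_path (K i)) = distr M path_space (sample_path (J i))"
    and "prob_space.indep_vars M' (\<lambda>_. path_space) (\<lambda>i. sample_path (K i)) {1..<N}"
    and "prob_space.indep_set M'
           (sets (vimage_algebra (space M') V borel))
           (sets (vimage_algebra (space M') (\<lambda>\<omega>. \<lambda>i\<in>{1..<N}. sample_path (K i) \<omega>)
              (Pi\<^sub>M {1..<N} (\<lambda>_. path_space))))"
  shows "(\<forall>\<alpha>\<ge>0. \<phi>\<^sub>a \<alpha> = \<alpha> - (\<Sum>i\<in>{1..<N}. a i * \<eta> i \<alpha>)) \<and>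
    bij_betw \<phi>\<^sub>a {0..} {0..} \<and>
    (\<forall>\<alpha>>0. (\<integral>\<omega>. exp (- \<alpha> * waiting_time N a K V \<omega>) \<partial>M') =
       vector_derivative \<phi> (at 0 within {0..}) * \<eta> N (the_inv_into {0..} \<phi>\<^sub>a \<alpha>) /
       (\<rho> N * \<phi> (the_inv_into {0..} \<phi>\<^sub>a \<alpha>)))"
proof -
  interpret M: prob_space M by fact
  interpret M': prob_space M' by fact
  have N: "2 \<le> N" by fact
  have sub_J: "\<And>i. i \<in> {1..N} \<Longrightarrow> subordinator M (J i)" using assms(3) by blast
  interpret Q: queue M "{1..N}" J N
    by unfold_locales (use assms in auto)
  have sub: "{1..<N} \<subseteq> {1..N}" by auto
  interpret F: subordinator_family M "{1..<N}" J
    by unfold_locales (use sub_J M.indep_vars_subset[OF assms(4) sub] in auto)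
  have a_bounds: "0 \<le> a i \<and> a i \<le> 1" if "i \<in> {1..<N}" for i
  proof -
    have "b N < b i" "0 < b N" using assms(11,12) that by auto
    then show ?thesis by (simp add: assms(13))
  qed
  then have a_nonneg: "\<forall>i\<in>{1..<N}. 0 \<le> a i" by blast
  have int_F: "\<forall>i\<in>{1..<N}. integrable M (J i 1)" using assms(5) by auto
  have \<rho>_nonneg: "0 \<le> \<rho> i" if "i \<in> {1..N}" for i
  proof -
    interpret subordinator_process M "J i" by unfold_locales (rule sub_J[OF that])
    show ?thesis unfolding assms(6) by (intro integral_nonneg_AE AE_I2) (simp add: X_nonneg)
  qed
  \<comment> \<open>A lower bound for all slopes of \<open>\<phi>\<^sub>a\<close>, and its slope at
    0. It is positive because the fractions are at most 1 and the total load is below 1.\<close>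
  define d where "d = 1 - (\<Sum>i\<in>{1..<N}. a i * \<rho> i)"
  have d: "0 < d"
  proof -
    have "(\<Sum>i\<in>{1..<N}. a i * \<rho> i) \<le> (\<Sum>i\<in>{1..<N}. 1 * \<rho> i)"
      using a_bounds \<rho>_nonneg by (intro sum_mono mult_right_mono) auto
    also have "\<dots> \<le> (\<Sum>i\<in>{1..N}. \<rho> i)"
      using \<rho>_nonneg by (simp, intro sum_mono2) auto
    finally show ?thesis using assms(8) by (simp add: d_def)
  qed
  have exp_eq: "F.exponent a \<alpha> = (\<Sum>i\<in>{1..<N}. a i * \<eta> i \<alpha>)" for \<alpha>
    by (simp only: F.exponent_def assms(9))
  have total_eq: "overtaking_input N a J t \<omega> = F.total a t \<omega>" for t \<omega>
    by (simp only: overtaking_input_def F.total_def)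
  have \<phi>a: "\<phi>\<^sub>a \<alpha> = \<alpha> - F.exponent a \<alpha>" if "0 \<le> \<alpha>" for \<alpha>
  proof -
    have "(\<integral>\<omega>. exp (- \<alpha> * (overtaking_input N a J 1 \<omega> - 1)) \<partial>M) = (\<integral>\<omega>. exp \<alpha> * exp (- \<alpha> * F.total a 1 \<omega>) \<partial>M)"
      unfolding total_eq exp_add[symmetric] by (simp add: algebra_simps)
    also have "\<dots> = exp \<alpha> * (\<integral>\<omega>. exp (- \<alpha> * F.total a 1 \<omega>) \<partial>M)"
      by (rule Bochner_Integration.integral_mult_right_zero)
    also have "\<dots> = exp (\<alpha> - F.exponent a \<alpha>)"
      unfolding F.laplace_total[OF a_nonneg zero_le_one that] exp_add[symmetric] by simp
    finally show ?thesis by (simp add: assms(15))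
  qed
  have slopes: "d * (y - x) \<le> \<phi>\<^sub>a y - \<phi>\<^sub>a x" "\<phi>\<^sub>a y - \<phi>\<^sub>a x \<le> y - x" if "0 \<le> x" "x \<le> y" for x y
  proof -
    have "F.exponent a y - F.exponent a x \<le> (1 - d) * (y - x)" "F.exponent a x \<le> F.exponent a y"
      using F.exponent_bounds[OF a_nonneg int_F that] by (simp_all add: d_def assms(6))
    then show "d * (y - x) \<le> \<phi>\<^sub>a y - \<phi>\<^sub>a x" "\<phi>\<^sub>a y - \<phi>\<^sub>a x \<le> y - x"
      using that by (simp_all add: \<phi>a algebra_simps)
  qed
  have \<phi>a0: "\<phi>\<^sub>a 0 = 0" by (simp only: \<phi>a[OF order_refl] F.exponent_0 diff_zero)
  have bij: "bij_betw \<phi>\<^sub>a {0..} {0..}"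
    by (rule bij_betw_slopes[OF \<phi>a0 d slopes])
  have \<phi>_eq: "\<phi> = Q.\<phi>"
    by (rule ext) (simp only: assms(14,9) Q.\<phi>_def Q.exponent_def mult_1)
  \<comment> \<open>One-sided, since the exponents are controlled only for nonnegative
    arguments.\<close>
  have deriv: "vector_derivative \<phi> (at 0 within {0..}) = Q.\<delta>"
  proof (rule vector_derivative_within)
    show "at 0 within {0..} \<noteq> (bot :: real filter)" by (simp add: at_within_atLeast)
    have "Q.\<phi> 0 = 0" unfolding Q.\<phi>_def Q.exponent_0 by (rule diff_zero)
    then have "(\<phi> has_field_derivative Q.\<delta>) (at 0 within {0..})"
      unfolding has_field_derivative_iff at_within_atLeast \<phi>_eq using Q.\<phi>_derivative_0 by simp
    then show "(\<phi> has_vector_derivative Q.\<delta>) (at 0 within {0..})"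
      by (simp add: has_real_derivative_iff_has_vector_derivative)
  qed
  \<comment> \<open>The exponent depends only on the law of the value at time 1, a measurable
    function of the path, so equality of path laws transfers it.\<close>
  have expo': "laplace_exponent M' (K i) \<alpha> = laplace_exponent M (J i) \<alpha>" if i: "i \<in> {1..<N}" for i \<alpha>
  proof -
    interpret JJ: subordinator_process M "J i" by unfold_locales (rule sub_J, use i in auto)
    interpret KK: subordinator_process M' "K i" by unfold_locales (use assms(20) i in auto)
    have ev: "(\<lambda>p. exp (- \<alpha> * p 1)) \<in> borel_measurable path_space"
      unfolding path_space_def by measurable
    have sJ: "sample_path (J i) \<in> measurable M path_space"
      unfolding path_space_def sample_path_def[abs_def] by (intro measurable_restrict) auto
    have sK: "sample_path (K i) \<in> measurable M' path_space"
      unfolding path_space_def sample_path_def[abs_def] by (intro measurable_restrict) auto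
    have "(\<integral>\<omega>. exp (- \<alpha> * K i 1 \<omega>) \<partial>M') = (\<integral>p. exp (- \<alpha> * p 1) \<partial>distr M' path_space (sample_path (K i)))"
      by (subst integral_distr[OF sK ev]) (simp add: sample_path_def)
    also have "\<dots> = (\<integral>p. exp (- \<alpha> * p 1) \<partial>distr M path_space (sample_path (J i)))"
      using assms(21) i by simp
    also have "\<dots> = (\<integral>\<omega>. exp (- \<alpha> * J i 1 \<omega>) \<partial>M)"
      by (subst integral_distr[OF sJ ev]) (simp add: sample_path_def)
    finally show ?thesis by (simp add: laplace_exponent_def)
  qed
  interpret G: subordinator_family M' "{1..<N}" K
    by unfold_locales (use assms(20,22) in auto)
  have exp_G: "G.exponent a \<alpha> = F.exponent a \<alpha>" for \<alpha>
    unfolding G.exponent_def F.exponent_def by (intro sum.cong refl) (simp only: expo')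
  interpret P: tagged_particle M' "{1..<N}" K a V
  proof unfold_locales
    show "G.exponent a \<beta> < \<beta>" if "0 < \<beta>" for \<beta>
      unfolding exp_G using slopes(1)[of 0 \<beta>] mult_pos_pos[OF d that] that \<phi>a0 \<phi>a[of \<beta>] by simp
  qed (use a_nonneg assms(17,18,23) in auto)
  have total_G: "overtaking_input N a K t \<omega> = G.total a t \<omega>" for t \<omega>
    by (simp only: overtaking_input_def G.total_def)
  have law: "(\<integral>\<omega>. exp (- \<beta> * V \<omega>) \<partial>M') * \<rho> N = \<eta> N \<beta> * Q.\<delta> / Q.\<phi> \<beta>" if \<beta>: "0 < \<beta>" for \<beta>
  proof -
    \<comment> \<open>The test function has to be bounded on the whole line; the maximum with 0
      achieves this without changing it on the nonnegative values of the content.\<close>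
    let ?f = "\<lambda>v. exp (- \<beta> * max v 0) :: real"
    let ?m = "\<integral>\<omega>. exp (- \<beta> * V \<omega>) \<partial>M'"
    have V: "V \<in> borel_measurable M'" "\<And>\<omega>. \<omega> \<in> space M' \<Longrightarrow> 0 \<le> V \<omega>" using assms(17,18) by auto
    have m_eq: "(\<integral>v. ?f v \<partial>distr M' borel V) = ?m"
      using V by (subst integral_distr) (auto intro!: Bochner_Integration.integral_cong simp: max_absorb1)
    have int: "integrable M' (\<lambda>\<omega>. exp (- \<beta> * V \<omega>))"
      by (rule M'.integrable_const_bound[of _ 1]) (use V \<beta> in \<open>auto intro!: AE_I2\<close>)
    have m: "0 \<le> ?m" by (rule integral_nonneg_AE) simp
    have m1: "?m \<le> 1" by (rule M'.integral_le_const[OF int]) (use V \<beta> in \<open>auto intro!: AE_I2\<close>)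
    have "continuous_on UNIV ?f" by (intro continuous_intros)
    moreover have "bounded (range ?f)"
      unfolding bounded_iff using \<beta> by (intro exI[of _ 1]) auto
    ultimately have "AE \<omega> in M. ((\<lambda>t. content_average N J c ?f t \<omega>) \<longlongrightarrow> ?m) at_top"
      using assms(19) unfolding steady_state_content_law_def m_eq[symmetric] by blast
    \<comment> \<open>Only integer times are kept, since there every grid of mesh 1 / (m + 1) ends
      exactly.\<close>
    then have lim: "AE \<omega> in M. (\<lambda>n. (c * Q.occ \<beta> n \<omega> + Q.batch_inf \<beta> n \<omega>) / J N (real n) \<omega>) \<longlonglongrightarrow> ?m"
      using AE_space
    proof eventually_elim
      case (elim \<omega>)
      from filterlim_compose[OF elim(1) filterlim_real_sequentially]
      show ?case unfolding Q.content_average_eq[OF \<beta> refl elim(2)] .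
    qed
    have c: "0 \<le> c" using assms(10) by (simp add: levy_khintchine_def)
    have "(\<lambda>j. laplace_exponent M (J N) (real (Suc j)) / real (Suc j)) \<longlonglongrightarrow> c"
      using levy_khintchine_drift[OF assms(10)] by (simp only: assms(9))
    from Q.content_law_mean[OF \<beta> _ c this m m1 lim] show ?thesis
      using assms(7) by (simp add: assms(6,9))
  qed
  have main: "(\<integral>\<omega>. exp (- \<alpha> * waiting_time N a K V \<omega>) \<partial>M') =
      vector_derivative \<phi> (at 0 within {0..}) * \<eta> N (the_inv_into {0..} \<phi>\<^sub>a \<alpha>) /
       (\<rho> N * \<phi> (the_inv_into {0..} \<phi>\<^sub>a \<alpha>))" if \<alpha>: "0 < \<alpha>" for \<alpha>
  proof -
    \<comment> \<open>The exponent at which the martingale has discount rate exactly \<alpha>; it is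
      positive because \<open>\<phi>\<^sub>a\<close> vanishes at 0.\<close>
    define \<beta> where "\<beta> = the_inv_into {0..} \<phi>\<^sub>a \<alpha>"
    have \<phi>\<beta>: "\<phi>\<^sub>a \<beta> = \<alpha>" and \<beta>0: "0 \<le> \<beta>"
      unfolding \<beta>_def using f_the_inv_into_f_bij_betw[OF bij, of \<alpha>] the_inv_into_into[of \<phi>\<^sub>a "{0..}" \<alpha> "{0..}"] bij \<alpha>
      by (auto simp: bij_betw_def)
    then have \<beta>: "0 < \<beta>" using \<alpha> \<phi>a0 by (cases "\<beta> = 0") auto
    have \<alpha>_eq: "\<alpha> = \<beta> - G.exponent a \<beta>" unfolding exp_G using \<phi>a[OF \<beta>0] \<phi>\<beta> by simp
    have "(\<integral>\<omega>. exp (- \<alpha> * waiting_time N a K V \<omega>) \<partial>M') = (\<integral>\<omega>. exp (- \<beta> * V \<omega>) \<partial>M')"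
      unfolding waiting_time_def \<alpha>_eq
      by (rule P.laplace_wait[OF _ _ \<beta>]) (simp_all only: waiting_iterate.simps total_G)
    also have "\<dots> = Q.\<delta> * \<eta> N \<beta> / (\<rho> N * Q.\<phi> \<beta>)"
      using law[OF \<beta>] assms(7) Q.\<phi>_pos[OF \<beta>] by (simp add: field_simps)
    finally show ?thesis unfolding deriv unfolding \<phi>_eq \<beta>_def .
  qed
  show ?thesis
    unfolding exp_eq[symmetric] using \<phi>a bij main by blast
qed

end
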